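(* Let $A$ be a finite local commutative ring. Then the genus $\gamma(L(EG(A)))$ of the line graph of the essential graph of $A$ is neither $1$ nor $2$.
   Context: All rings have unity $1\neq 0$. A ring is local if it has exactly one maximal ideal. An ideal $I$ of a commutative ring $A$ is essential if $I\cap J\neq 0$ for every non-zero ideal $J$ of $A$ (so $A$ itself is essential). For $s\in A$, $\mathrm{ann}_A(s)=\{r\in A : sr=0\}$. The essential graph $EG(A)$ is the simple undirected graph whose vertices are the non-zero zero-divisors of $A$, two distinct vertices $u,v$ being adjacent if and only if $\mathrm{ann}_A(uv)$ is an essential ideal of $A$. The line graph $L(G)$ of a graph $G$ has the edges of $G$ as vertices, two distinct ones being adjacent exactly when the corresponding edges share an endpoint in $G$. The genus $\gamma(G)$ of a graph $G$ is the minimum integer $k\ge 0$ such that $G$ can be drawn without edge crossings on the orientable surface obtained from the sphere by attaching $k$ handles; planar graphs have genus $0$. *)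

theory Defs
  imports
    "HOL-Algebra.Ideal"
    "HOL-Analysis.Analysis"
    "HOL-Library.Extended_Nat"
begin

section \<open>Rings\<close>

definition local_ring :: "('a, 'b) ring_scheme \<Rightarrow> bool" where
  "local_ring A \<longleftrightarrow> (\<exists>!M. maximalideal M A)"

definition essential_ideal :: "'a set \<Rightarrow> ('a, 'b) ring_scheme \<Rightarrow> bool" where
  "essential_ideal I A \<longleftrightarrow>
     ideal I A \<and> (\<forall>J. ideal J A \<and> J \<noteq> {\<zero>\<^bsub>A\<^esub>} \<longrightarrow> I \<inter> J \<noteq> {\<zero>\<^bsub>A\<^esub>})"

definition ann :: "('a, 'b) ring_scheme \<Rightarrow> 'a \<Rightarrow> 'a set" where
  "ann A s = {r \<in> carrier A. s \<otimes>\<^bsub>A\<^esub> r = \<zero>\<^bsub>A\<^esub>}"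

definition nonzero_zero_divisors :: "('a, 'b) ring_scheme \<Rightarrow> 'a set" where
  "nonzero_zero_divisors A =
     {x \<in> carrier A. x \<noteq> \<zero>\<^bsub>A\<^esub> \<and>
        (\<exists>y \<in> carrier A. y \<noteq> \<zero>\<^bsub>A\<^esub> \<and> x \<otimes>\<^bsub>A\<^esub> y = \<zero>\<^bsub>A\<^esub>)}"


section \<open>Simple graphs\<close>

text \<open>An edge is the two-element set of its endpoints.\<close>

record 'v sgraph =
  verts :: "'v set"
  edges :: "'v set set"

definition essential_graph :: "('a, 'b) ring_scheme \<Rightarrow> 'a sgraph" where
  "essential_graph A =
     \<lparr> verts = nonzero_zero_divisors A,
       edges = {{u, v} | u v. u \<in> nonzero_zero_divisors A \<and> v \<in> nonzero_zero_divisors A \<and>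
                  u \<noteq> v \<and> essential_ideal (ann A (u \<otimes>\<^bsub>A\<^esub> v)) A} \<rparr>"

definition line_graph :: "'v sgraph \<Rightarrow> 'v set sgraph" where
  "line_graph G =
     \<lparr> verts = edges G,
       edges = {{e, f} | e f. e \<in> edges G \<and> f \<in> edges G \<and> e \<noteq> f \<and> e \<inter> f \<noteq> {}} \<rparr>"


section \<open>Genus\<close>

text \<open>
  A concrete model of the sphere with \<open>k\<close> handles, inside the Euclidean 3-space
  \<^typ>\<open>complex \<times> real\<close> (the norm of \<open>(z, t)\<close> is the square root of \<open>\<bar>z\<bar>\<^sup>2 + t\<^sup>2\<close>).
  The \<open>k\<close> closed discs with centres \<^term>\<open>handle_centre k i\<close> and radius \<open>1 / (2k)\<close>
  are pairwise disjoint and lie in the open unit disc.  For each of them, the two open discs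
  of the unit sphere lying over and under its interior are removed, and the resulting two boundary
  circles are joined by a vertical tube inside the unit ball.  The tubes are pairwise disjoint and
  the result separates space, hence is orientable.
\<close>

definition handle_centre :: "nat \<Rightarrow> nat \<Rightarrow> complex" where
  "handle_centre k i = complex_of_real ((2 * real i + 1) / real k - 1)"

definition sphere_with_handles :: "nat \<Rightarrow> (complex \<times> real) set" where
  "sphere_with_handles k =
     (sphere 0 1 - (\<Union>i<k. ball (handle_centre k i) (1 / (2 * real k)) \<times> UNIV)) \<union>
     (\<Union>i<k. cball 0 1 \<inter> (sphere (handle_centre k i) (1 / (2 * real k)) \<times> UNIV))"

lemma sphere_with_handles_0: "sphere_with_handles 0 = sphere 0 1"
  by (simp add: sphere_with_handles_def)

definition drawing_on ::
    "'p::topological_space set \<Rightarrow> 'v sgraph \<Rightarrow> ('v \<Rightarrow> 'p) \<Rightarrow> ('v set \<Rightarrow> real \<Rightarrow> 'p) \<Rightarrow> bool" where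
  "drawing_on S G pos curve \<longleftrightarrow>
     inj_on pos (verts G) \<and> pos ` verts G \<subseteq> S \<and>
     (\<forall>e \<in> edges G.
        arc (curve e) \<and> path_image (curve e) \<subseteq> S \<and>
        {pathstart (curve e), pathfinish (curve e)} = pos ` e \<and>
        path_image (curve e) \<inter> pos ` verts G = pos ` e) \<and>
     (\<forall>e \<in> edges G. \<forall>f \<in> edges G. e \<noteq> f \<longrightarrow>
        path_image (curve e) \<inter> path_image (curve f) = pos ` (e \<inter> f))"

definition drawable_on :: "'p::topological_space set \<Rightarrow> 'v sgraph \<Rightarrow> bool" where
  "drawable_on S G \<longleftrightarrow> (\<exists>pos curve. drawing_on S G pos curve)"

text \<open>
  The infimum is a minimum whenever some \<open>k\<close> is admissible, as is the case for every finite graph;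
  extended naturals are used so that no junk value arises from an empty set.
\<close>

definition genus :: "'v sgraph \<Rightarrow> enat" where
  "genus G = Inf (enat ` {k. drawable_on (sphere_with_handles k) G})"

end

theory Submission
  imports Defs "HOL-Algebra.Sylow" "HOL-Algebra.Multiplicative_Group"
begin

text \<open>
Let \<open>M\<close> be the maximal ideal of the finite local ring \<open>A\<close>.  The nonzero zero-divisors are the nonzero elements
of \<open>M\<close>, and all elements of \<open>M\<close> are nilpotent.  If \<open>s\<close> lies in \<open>M\<close> and \<open>x\<close> is a nonzero element of an ideal
\<open>J\<close>, the last nonzero product \<open>s\<^sup>l x\<close> lies in \<open>J\<close> and is killed by \<open>s\<close>; so every annihilator of an element
of \<open>M\<close> is essential, and the essential graph is the complete graph on \<open>n = |M| - 1\<close> vertices.  The value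
\<open>n = 5\<close> does not occur: the additive group of \<open>M\<close> would have order 6, hence elements of order 2 and 3,
so that 2 and 3, and with them \<open>1 = 3 - 2\<close>, would be non-units.

For \<open>n \<le> 4\<close> the line graph of the complete graph is a subgraph of the octahedron and its genus is 0.
For \<open>n \<ge> 6\<close> the line graph cannot be drawn with one or two handles.  This follows from a weak form of
Euler's inequality (\<open>drawing_edge_bound\<close>): a simple graph with \<open>V\<close> vertices and \<open>E \<ge> 3\<close> edges drawn on the
sphere with \<open>k \<ge> 1\<close> handles satisfies \<open>E \<le> 3 V + 6 k\<close>.  Here \<open>V = n (n - 1) / 2\<close> and
\<open>E = n (n - 1) (n - 2) / 2\<close>, so \<open>E - 3 V = n (n - 1) (n - 5) / 2 \<ge> 15\<close>, while \<open>6 k \<le> 12\<close>.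

The inequality is the sum of two estimates for the number \<open>F\<close> of faces, the components of the complement
of the drawing.

\<^item> \<open>3 F \<le> 2 E\<close> (\<open>three_faces_le_two_edges\<close>).  Each edge is first made straight inside a small disc, so that
  it visibly has two sides there and counts for at most two faces.  A face counted by at most two edges
  would be closed and open in the complement of a forest of arcs (these two edges, and the other edges
  without their straight middles).  But forests do not separate a surface; locally this is Janiszewski's
  theorem in the plane.

\<^item> \<open>E \<le> V + F + 2 k\<close> (\<open>edges_le_vertices_faces\<close>).  This replaces homology by maps into the circle modulo
  squares.  For every set of edges there is a map of the drawing into the circle that winds once around
  each of these edges and is constant on the others.  Two such maps differ by a square only if the two
  sets of edges differ by a cut, so each square class has at most \<open>2\<^sup>V\<close> members.  On the other hand every map
  extends to the surface minus one point in each face.  The surface is glued from two copies of a disc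
  with \<open>k\<close> holes, and in the plane the square class of a map is given by a set of punctures and holes.
  So there are at most \<open>F + k\<close> bits for punctures and holes and \<open>k\<close> bits for the signs with which square roots
  on the two copies fit together along the seam, and \<open>2\<^sup>E \<le> 2\<^sup>V 2\<^sup>F\<^sup>+\<^sup>2\<^sup>k\<close>.

Neither estimate needs the curves of the drawing to be tame, which is why maps into the circle are used
instead of cutting the surface along the seam: a curve may meet the seam in a Cantor set.
\<close>

section \<open>The essential graph of a finite local ring\<close>

locale finite_local_ring = cring A for A :: "('a, 'b) ring_scheme" (structure) +
  assumes finite_carrier: "finite (carrier A)" and local: "local_ring A"
begin

definition max_ideal :: "'a set" where "max_ideal = (THE M. maximalideal M A)"

lemma max_ideal: "maximalideal max_ideal A"
  using local unfolding local_ring_def max_ideal_def by (rule theI')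

lemma max_ideal_unique: "maximalideal M A \<Longrightarrow> M = max_ideal"
  using local max_ideal unfolding local_ring_def by blast

lemma ideal_max_ideal: "ideal max_ideal A"
  using max_ideal by (rule maximalideal.axioms(1))

lemma ideal_sub: "ideal J A \<Longrightarrow> J \<subseteq> carrier A"
  by (rule subsetI) (rule ideal.Icarr)

lemma max_ideal_sub: "max_ideal \<subseteq> carrier A"
  by (rule ideal_sub[OF ideal_max_ideal])

lemma one_notin_max_ideal: "\<one> \<notin> max_ideal"
  using ideal.one_imp_carrier[OF ideal_max_ideal] maximalideal.I_notcarr[OF max_ideal] by metis

text \<open>By finiteness an inclusion-maximal one exists among the proper ideals that contain \<open>I\<close>; it is a maximal ideal of the ring.\<close>

lemma proper_ideal_in_max_ideal:
  assumes I: "ideal I A" "\<one> \<notin> I"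
  shows "I \<subseteq> max_ideal"
proof -
  define \<I> where "\<I> = {J. ideal J A \<and> I \<subseteq> J \<and> \<one> \<notin> J}"
  have "\<I> \<subseteq> Pow (carrier A)" unfolding \<I>_def by (auto dest: ideal_sub)
  then have "finite \<I>" using finite_carrier finite_subset by blast
  moreover have "I \<in> \<I>" using I unfolding \<I>_def by blast
  ultimately obtain M where M: "M \<in> \<I>" "I \<subseteq> M" "\<And>J. J \<in> \<I> \<Longrightarrow> M \<subseteq> J \<Longrightarrow> M = J"
    using finite_has_maximal2[of \<I> I] by metis
  have "maximalideal M A"
  proof (rule maximalidealI)
    show "ideal M A" using M(1) unfolding \<I>_def by blast
    show "carrier A \<noteq> M" using M(1) unfolding \<I>_def by blast
    show "J = M \<or> J = carrier A" if "ideal J A" "M \<subseteq> J" "J \<subseteq> carrier A" for J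
    proof (cases "\<one> \<in> J")
      case True then show ?thesis using ideal.one_imp_carrier[OF that(1)] by blast
    next
      case False
      then have "J \<in> \<I>" using that M(2) unfolding \<I>_def by blast
      then show ?thesis using M(3) that by blast
    qed
  qed
  then show ?thesis using max_ideal_unique M(2) by blast
qed

lemma regular_off_max_ideal:
  assumes x: "x \<in> carrier A" "x \<notin> max_ideal" and y: "y \<in> carrier A" "x \<otimes> y = \<zero>"
  shows "y = \<zero>"
proof -
  have "\<one> \<in> PIdl x"
  proof (rule ccontr)
    assume "\<one> \<notin> PIdl x"
    then have "PIdl x \<subseteq> max_ideal" by (rule proper_ideal_in_max_ideal[OF cgenideal_ideal[OF x(1)]])
    then show False using cgenideal_self[OF x(1)] x(2) by blast
  qed
  then obtain z where z: "z \<in> carrier A" "\<one> = z \<otimes> x" unfolding cgenideal_def by blast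
  have "y = \<one> \<otimes> y" using y by simp
  also have "\<dots> = (z \<otimes> x) \<otimes> y" using z(2) by simp
  also have "\<dots> = z \<otimes> (x \<otimes> y)" using z x y by (simp add: m_assoc)
  also have "\<dots> = \<zero>" using y z by simp
  finally show ?thesis .
qed

lemma zero_divisors_eq: "nonzero_zero_divisors A = max_ideal - {\<zero>}"
proof
  show "nonzero_zero_divisors A \<subseteq> max_ideal - {\<zero>}"
    unfolding nonzero_zero_divisors_def using regular_off_max_ideal by blast
  show "max_ideal - {\<zero>} \<subseteq> nonzero_zero_divisors A"
  proof
    fix x assume x: "x \<in> max_ideal - {\<zero>}"
    then have xc: "x \<in> carrier A" using max_ideal_sub by blast
    have "\<not> inj_on (\<lambda>y. x \<otimes> y) (carrier A)"
    proof
      assume "inj_on (\<lambda>y. x \<otimes> y) (carrier A)"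
      moreover have "(\<lambda>y. x \<otimes> y) ` carrier A \<subseteq> carrier A" using xc by blast
      ultimately have "(\<lambda>y. x \<otimes> y) ` carrier A = carrier A"
        using endo_inj_surj[OF finite_carrier] by blast
      then have "\<one> \<in> (\<lambda>y. x \<otimes> y) ` carrier A" by simp
      then obtain y where "y \<in> carrier A" "\<one> = x \<otimes> y" by blast
      then have "\<one> \<in> max_ideal" using ideal.I_r_closed[OF ideal_max_ideal, of x y] x by simp
      then show False using one_notin_max_ideal by blast
    qed
    then obtain y z where yz: "y \<in> carrier A" "z \<in> carrier A" "y \<noteq> z" "x \<otimes> y = x \<otimes> z" unfolding inj_on_def by blast
    have "y \<ominus> z \<in> carrier A" "y \<ominus> z \<noteq> \<zero>" using yz by (simp_all add: r_right_minus_eq)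
    moreover have "x \<otimes> (y \<ominus> z) = \<zero>" using yz xc by (simp add: a_minus_def r_distr r_minus r_neg)
    ultimately show "x \<in> nonzero_zero_divisors A" using x xc unfolding nonzero_zero_divisors_def by blast
  qed
qed

text \<open>Two powers of \<open>s\<close> coincide, say \<open>s\<^sup>a = s\<^sup>a\<^sup>+\<^sup>d\<close>, and \<open>1 - s\<^sup>d\<close> is a unit.\<close>

lemma max_ideal_nilpotent:
  assumes s: "s \<in> max_ideal"
  shows "\<exists>n::nat. s [^] n = \<zero>"
proof -
  have sc: "s \<in> carrier A" using s max_ideal_sub by blast
  have "\<not> inj (\<lambda>n::nat. s [^] n)"
  proof
    assume "inj (\<lambda>n::nat. s [^] n)"
    then have "infinite (range (\<lambda>n::nat. s [^] n))" by (rule range_inj_infinite)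
    moreover have "range (\<lambda>n::nat. s [^] n) \<subseteq> carrier A" using sc by blast
    ultimately show False using finite_carrier finite_subset by blast
  qed
  then obtain a b :: nat where "a \<noteq> b" "s [^] a = s [^] b" unfolding inj_def by blast
  then obtain a b :: nat where ab: "a < b" "s [^] a = s [^] b" by (metis linorder_neqE_nat)
  define d where "d = b - a"
  have d: "b = a + d" "0 < d" using ab(1) unfolding d_def by auto
  have sd: "s [^] d \<in> max_ideal"
  proof -
    obtain e where "d = Suc e" using d(2) by (metis gr0_conv_Suc)
    then have "s [^] d = s [^] e \<otimes> s" by simp
    then show ?thesis using ideal.I_l_closed[OF ideal_max_ideal s, of "s [^] e"] sc by simp
  qed
  \<comment> \<open>\<open>w\<close> is a unit that kills \<open>s [^] a\<close>.\<close>
  define w where "w = \<one> \<ominus> s [^] d"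
  have wc: "w \<in> carrier A" unfolding w_def using sc by simp
  have "w \<notin> max_ideal"
  proof
    assume "w \<in> max_ideal"
    then have "w \<oplus> s [^] d \<in> max_ideal" using additive_subgroup.a_closed[OF ideal.axioms(1)[OF ideal_max_ideal]] sd by blast
    moreover have "w \<oplus> s [^] d = \<one>" unfolding w_def using sc by (simp add: a_minus_def a_assoc l_neg)
    ultimately show False using one_notin_max_ideal by simp
  qed
  moreover have "w \<otimes> s [^] a = \<zero>"
  proof -
    have "w \<otimes> s [^] a = s [^] a \<ominus> s [^] d \<otimes> s [^] a"
      unfolding w_def using sc by (simp add: a_minus_def l_distr l_minus)
    also have "s [^] d \<otimes> s [^] a = s [^] b" using sc unfolding d(1) by (simp add: nat_pow_mult add.commute)
    also have "\<dots> = s [^] a" by (rule ab(2)[symmetric])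
    finally show ?thesis using sc by (simp add: r_right_minus_eq)
  qed
  ultimately have "s [^] a = \<zero>" using regular_off_max_ideal[OF wc] sc by simp
  then show ?thesis by blast
qed

lemma ann_ideal:
  assumes s: "s \<in> carrier A"
  shows "ideal (ann A s) A"
proof (rule idealI)
  show "ring A" by (rule ring_axioms)
  show "subgroup (ann A s) (add_monoid A)"
  proof (rule add.subgroupI)
    show "ann A s \<subseteq> carrier A" unfolding ann_def by blast
    have "\<zero> \<in> ann A s" unfolding ann_def using s by simp
    then show "ann A s \<noteq> {}" by blast
    show "\<ominus> a \<in> ann A s" if "a \<in> ann A s" for a
      using that s unfolding ann_def by (simp add: r_minus)
    show "a \<oplus> b \<in> ann A s" if "a \<in> ann A s" "b \<in> ann A s" for a b
      using that s unfolding ann_def by (simp add: r_distr)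
  qed
  show "x \<otimes> a \<in> ann A s" if "a \<in> ann A s" "x \<in> carrier A" for a x
  proof -
    have a: "a \<in> carrier A" "s \<otimes> a = \<zero>" using that unfolding ann_def by auto
    have "s \<otimes> (x \<otimes> a) = x \<otimes> (s \<otimes> a)" by (rule m_lcomm[OF s that(2) a(1)])
    also have "\<dots> = \<zero>" using a(2) that(2) by simp
    finally show ?thesis using a(1) that(2) unfolding ann_def by simp
  qed
  then show "a \<otimes> x \<in> ann A s" if "a \<in> ann A s" "x \<in> carrier A" for a x
    using that m_comm[of a x] unfolding ann_def by auto
qed

text \<open>For \<open>x \<noteq> 0\<close> in \<open>J\<close> the last nonzero element among \<open>x, s x, s\<^sup>2 x, \<dots>\<close> lies in \<open>J\<close> and in the annihilator.\<close>

lemma ann_essential: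
  assumes s: "s \<in> max_ideal"
  shows "essential_ideal (ann A s) A"
  unfolding essential_ideal_def
proof (intro conjI allI impI)
  have sc: "s \<in> carrier A" using s max_ideal_sub by blast
  show "ideal (ann A s) A" by (rule ann_ideal[OF sc])
  fix J assume J: "ideal J A \<and> J \<noteq> {\<zero>}"
  have "\<zero> \<in> J" by (rule additive_subgroup.zero_closed[OF ideal.axioms(1)[OF conjunct1[OF J]]])
  then obtain x where x: "x \<in> J" "x \<noteq> \<zero>" using J by blast
  have xc: "x \<in> carrier A" using ideal.Icarr[OF conjunct1[OF J] x(1)] .
  obtain n :: nat where "s [^] n = \<zero>" using max_ideal_nilpotent[OF s] by blast
  then have ex: "s [^] n \<otimes> x = \<zero>" using xc by simp
  define m where "m = (LEAST m::nat. s [^] m \<otimes> x = \<zero>)"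
  have m: "s [^] m \<otimes> x = \<zero>" unfolding m_def by (rule LeastI[of "\<lambda>m. s [^] m \<otimes> x = \<zero>", OF ex])
  have "m \<noteq> 0"
  proof
    assume "m = 0"
    then show False using m xc x by simp
  qed
  then obtain l where l: "m = Suc l" by (cases m) simp_all
  have "s [^] l \<otimes> x \<noteq> \<zero>" using not_less_Least[of l "\<lambda>m. s [^] m \<otimes> x = \<zero>"] l unfolding m_def by simp
  moreover have "s [^] l \<otimes> x \<in> J" by (rule ideal.I_l_closed[OF conjunct1[OF J] x(1)]) (use sc in simp)
  moreover have "s \<otimes> (s [^] l \<otimes> x) = \<zero>"
  proof -
    have "s \<otimes> (s [^] l \<otimes> x) = (s \<otimes> s [^] l) \<otimes> x" by (rule m_assoc[symmetric]) (use sc xc in simp_all)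
    also have "s \<otimes> s [^] l = s [^] l \<otimes> s" by (rule m_comm) (use sc in simp_all)
    finally have "s \<otimes> (s [^] l \<otimes> x) = (s [^] l \<otimes> s) \<otimes> x" .
    then show ?thesis using m unfolding l by simp
  qed
  then have "s [^] l \<otimes> x \<in> ann A s" unfolding ann_def using sc xc by simp
  ultimately show "ann A s \<inter> J \<noteq> {\<zero>}" by blast
qed

lemma essential_graph_complete:
  "edges (essential_graph A) = {e. e \<subseteq> nonzero_zero_divisors A \<and> card e = 2}"
proof -
  have "essential_ideal (ann A (u \<otimes> v)) A" if "u \<in> nonzero_zero_divisors A" "v \<in> nonzero_zero_divisors A" for u v
  proof (rule ann_essential)
    have "u \<in> max_ideal" "v \<in> carrier A" using that zero_divisors_eq max_ideal_sub by auto
    then show "u \<otimes> v \<in> max_ideal" by (rule ideal.I_r_closed[OF ideal_max_ideal])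
  qed
  then have "edges (essential_graph A) =
      {{u, v} | u v. u \<in> nonzero_zero_divisors A \<and> v \<in> nonzero_zero_divisors A \<and> u \<noteq> v}"
    unfolding essential_graph_def by auto
  also have "\<dots> = {e. e \<subseteq> nonzero_zero_divisors A \<and> card e = 2}"
    unfolding card_2_iff by blast
  finally show ?thesis .
qed

text \<open>Sylow's theorem gives an element \<open>x \<noteq> 0\<close> of \<open>M\<close> with \<open>p x = 0\<close>, so \<open>p\<close> cannot be a unit.\<close>

lemma max_ideal_torsion:
  assumes p: "prime p" and card: "card max_ideal = p * m"
  shows "[p] \<cdot> \<one> \<in> max_ideal"
proof -
  define H where "H = (add_monoid A)\<lparr>carrier := max_ideal\<rparr>"
  have sg: "subgroup max_ideal (add_monoid A)"
    using additive_subgroup.a_subgroup[OF ideal.axioms(1)[OF ideal_max_ideal]] .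
  then have gH: "group H" unfolding H_def by (rule add.subgroup_imp_group)
  have finH: "finite (carrier H)" unfolding H_def using max_ideal_sub finite_carrier finite_subset by auto
  have "Coset.order H = p ^ 1 * m" unfolding Coset.order_def H_def using card by simp
  then obtain K where K: "subgroup K H" "card K = p ^ 1" using sylow_thm[OF p gH _ finH] by blast
  have "card K \<noteq> 1" using K(2) p prime_nat_iff by auto
  have "finite K" using K(2) p prime_gt_0_nat card_ge_0_finite by auto
  have "K \<noteq> {\<zero>}" using \<open>card K \<noteq> 1\<close> by auto
  moreover have "\<zero> \<in> K" using subgroup.one_closed[OF K(1)] unfolding H_def by simp
  ultimately obtain x where x: "x \<in> K" "x \<noteq> \<zero>" by blast
  have gK: "group (H\<lparr>carrier := K\<rparr>)" by (rule group.subgroup_imp_group[OF gH K(1)])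
  have "x [^]\<^bsub>H\<lparr>carrier := K\<rparr>\<^esub> Coset.order (H\<lparr>carrier := K\<rparr>) = \<one>\<^bsub>H\<lparr>carrier := K\<rparr>\<^esub>"
    by (rule group.pow_order_eq_1[OF gK]) (use x \<open>finite K\<close> in auto)
  then have px: "[p] \<cdot> x = \<zero>"
    using K(2) by (simp add: H_def Coset.order_def add_pow_def nat_pow_def)
  have xc: "x \<in> carrier A" using subgroup.subset[OF K(1)] x(1) max_ideal_sub unfolding H_def by auto
  have "([p] \<cdot> \<one>) \<otimes> x = \<zero>" using add_pow_ldistr[of \<one> x p] px xc by simp
  moreover have "[p] \<cdot> \<one> \<in> carrier A" by simp
  ultimately show ?thesis using regular_off_max_ideal xc x(2) by blast
qed

lemma card_max_ideal_not_6: "card max_ideal \<noteq> 6"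
proof
  assume c: "card max_ideal = 6"
  have "[(2::nat)] \<cdot> \<one> \<in> max_ideal" by (rule max_ideal_torsion[of 2 3]) (use c in auto)
  moreover have "[(3::nat)] \<cdot> \<one> \<in> max_ideal" by (rule max_ideal_torsion[of 3 2]) (use c in auto)
  ultimately have "[(3::nat)] \<cdot> \<one> \<ominus> [(2::nat)] \<cdot> \<one> \<in> max_ideal"
    using additive_subgroup.a_closed[OF ideal.axioms(1)[OF ideal_max_ideal]]
      additive_subgroup.a_inv_closed[OF ideal.axioms(1)[OF ideal_max_ideal]] unfolding a_minus_def by blast
  moreover have "[(3::nat)] \<cdot> \<one> = \<one> \<oplus> [(2::nat)] \<cdot> \<one>"
    by (simp add: numeral_3_eq_3 numeral_2_eq_2 add.nat_pow_Suc a_ac)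
  then have "[(3::nat)] \<cdot> \<one> \<ominus> [(2::nat)] \<cdot> \<one> = \<one>" by (simp add: a_minus_def a_assoc r_neg)
  ultimately show False using one_notin_max_ideal by simp
qed

lemma card_zero_divisors_not_5: "card (nonzero_zero_divisors A) \<noteq> 5"
proof
  assume c: "card (nonzero_zero_divisors A) = 5"
  have "\<zero> \<in> max_ideal" using additive_subgroup.zero_closed[OF ideal.axioms(1)[OF ideal_max_ideal]] .
  moreover have "finite max_ideal" using max_ideal_sub finite_carrier finite_subset by blast
  ultimately have "card max_ideal = 6" using c unfolding zero_divisors_eq by (simp add: card_Diff_singleton)
  then show False using card_max_ideal_not_6 by blast
qed

end

section \<open>Maps into the circle modulo squares\<close>

text \<open>A continuous surjection of a compact space onto a Hausdorff space is a quotient map.\<close>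

lemma continuous_lift_through_compact:
  fixes f :: "'a::t2_space \<Rightarrow> 'b::t2_space" and h :: "'a \<Rightarrow> 'c::topological_space"
  assumes "compact S" "continuous_on S f" "continuous_on S h"
    and eq: "\<And>x y. \<lbrakk>x \<in> S; y \<in> S; f x = f y\<rbrakk> \<Longrightarrow> h x = h y"
  obtains g where "continuous_on (f ` S) g" "\<And>x. x \<in> S \<Longrightarrow> g (f x) = h x"
proof -
  have q: "quotient_map (top_of_set S) (top_of_set (f ` S)) f"
    unfolding quotient_map_def
  proof (intro conjI allI impI)
    show "f ` topspace (top_of_set S) = topspace (top_of_set (f ` S))" by simp
    fix U assume "U \<subseteq> topspace (top_of_set (f ` S))"
    then have "U \<subseteq> f ` S" by simp
    moreover have "{x \<in> topspace (top_of_set S). f x \<in> U} = S \<inter> f -` U" by auto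
    ultimately show "openin (top_of_set S) {x \<in> topspace (top_of_set S). f x \<in> U} \<longleftrightarrow> openin (top_of_set (f ` S)) U"
      using Abstract_Topology_2.continuous_imp_quotient_map[OF assms(2) refl assms(1)] by metis
  qed
  obtain g where "continuous_map (top_of_set (f ` S)) euclidean g" "\<And>x. x \<in> S \<Longrightarrow> g (f x) = h x"
  proof (rule quotient_map_lift_exists[OF q, of euclidean h])
    show "continuous_map (top_of_set S) euclidean h" using assms(3) by simp
    show "h x = h y" if "x \<in> topspace (top_of_set S)" "y \<in> topspace (top_of_set S)" "f x = f y" for x y
      by (rule eq) (use that in auto)
  qed simp
  then show ?thesis by (intro that[of g]) auto
qed

text \<open>The continuous maps from \<open>Y\<close> into the nonzero complex numbers, modulo squares of such maps, form a vector
space over the field with two elements, a stand-in for the first cohomology of \<open>Y\<close>.  Two maps \<open>f\<close> and \<open>g\<close>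
have the same class when \<open>has_sqrt\<close> holds of \<open>f * g\<close>; working with products avoids division.\<close>

definition has_sqrt :: "'a::topological_space set \<Rightarrow> ('a \<Rightarrow> complex) \<Rightarrow> bool" where
  "has_sqrt Y f \<longleftrightarrow> (\<exists>\<sigma>. continuous_on Y \<sigma> \<and> (\<forall>y\<in>Y. f y = (\<sigma> y)\<^sup>2))"

lemma has_sqrt_mult: "has_sqrt Y f \<Longrightarrow> has_sqrt Y g \<Longrightarrow> has_sqrt Y (\<lambda>y. f y * g y)"
  unfolding has_sqrt_def
  by (metis (no_types, lifting) continuous_on_mult power_mult_distrib)

lemma has_sqrt_subset: "has_sqrt Y f \<Longrightarrow> Z \<subseteq> Y \<Longrightarrow> has_sqrt Z f"
  unfolding has_sqrt_def by (meson continuous_on_subset subsetD)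

lemma has_sqrt_cong: "has_sqrt Y f \<Longrightarrow> (\<And>y. y \<in> Y \<Longrightarrow> f y = g y) \<Longrightarrow> has_sqrt Y g"
  unfolding has_sqrt_def by metis

lemma has_sqrt_square: "continuous_on Y f \<Longrightarrow> has_sqrt Y (\<lambda>y. f y * f y)"
  unfolding has_sqrt_def by (metis power2_eq_square)

lemma has_sqrt_cancel:
  assumes "has_sqrt Y (\<lambda>y. f y * g y)" "has_sqrt Y g" "\<And>y. y \<in> Y \<Longrightarrow> g y \<noteq> 0"
  shows "has_sqrt Y f"
proof -
  obtain \<sigma> \<tau> where s: "continuous_on Y \<sigma>" "\<And>y. y\<in>Y \<Longrightarrow> f y * g y = (\<sigma> y)\<^sup>2"
    and t: "continuous_on Y \<tau>" "\<And>y. y\<in>Y \<Longrightarrow> g y = (\<tau> y)\<^sup>2"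
    using assms(1,2) unfolding has_sqrt_def by metis
  have nz: "\<And>y. y \<in> Y \<Longrightarrow> \<tau> y \<noteq> 0" using assms(3) t(2) by force
  show ?thesis unfolding has_sqrt_def
  proof (intro exI conjI ballI)
    show "continuous_on Y (\<lambda>y. \<sigma> y / \<tau> y)" using s t nz by (intro continuous_intros) auto
    show "f y = (\<sigma> y / \<tau> y)\<^sup>2" if "y \<in> Y" for y
      using s(2)[OF that] t(2)[OF that] nz[OF that] by (auto simp: power_divide field_simps)
  qed
qed

text \<open>Transitivity of the relation of having the same square class.\<close>

lemma has_sqrt_trans:
  assumes "has_sqrt Y (\<lambda>y. f y * g y)" "has_sqrt Y (\<lambda>y. g y * h y)"
    and "continuous_on Y g" "\<And>y. y \<in> Y \<Longrightarrow> g y \<noteq> 0"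
  shows "has_sqrt Y (\<lambda>y. f y * h y)"
proof (rule has_sqrt_cancel)
  show "has_sqrt Y (\<lambda>y. f y * h y * (g y * g y))"
    by (rule has_sqrt_cong[OF has_sqrt_mult[OF assms(1,2)]]) (simp add: algebra_simps)
  show "has_sqrt Y (\<lambda>y. g y * g y)" by (rule has_sqrt_square[OF assms(3)])
qed (use assms(4) in auto)

lemma has_sqrt_contractible:
  fixes Y :: "'a::real_normed_vector set"
  assumes "continuous_on Y f" "contractible Y" "\<And>y. y \<in> Y \<Longrightarrow> f y \<noteq> 0"
  shows "has_sqrt Y f"
  using continuous_sqrt_on_contractible[OF assms] unfolding has_sqrt_def by metis

text \<open>The map is lifted along the parametrisation of the circle by the unit interval.  The two ends of the
lift differ by \<open>2 \<pi> d\<close>; subtracting a linear function makes them equal, and the corrected lift then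
descends to the circle.\<close>

lemma circle_map_degree:
  fixes f :: "complex \<Rightarrow> complex"
  assumes "0 < r" "continuous_on (sphere p r) f" "f \<in> sphere p r \<rightarrow> sphere 0 1"
  obtains d :: int and \<theta> :: "complex \<Rightarrow> real"
  where "continuous_on (sphere p r) \<theta>"
    and "\<And>z. z \<in> sphere p r \<Longrightarrow> f z = exp (\<i> * \<theta> z) * ((z - p) / r) powi d"
proof -
  define c where "c = (\<lambda>t::real. p + r * exp (2 * pi * \<i> * t))"
  have cs: "c t \<in> sphere p r" for t
    using assms(1) by (simp add: c_def dist_norm norm_mult)
  have contc: "continuous_on S c" for S unfolding c_def by (intro continuous_intros)
  have cim: "c ` {0..1} = sphere p r"
  proof
    show "sphere p r \<subseteq> c ` {0..1}"
    proof
      fix z assume z: "z \<in> sphere p r"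
      define w where "w = (z - p) / r"
      have nw: "norm w = 1" using z assms(1) by (auto simp: w_def norm_divide dist_norm norm_minus_commute)
      have "w = exp (\<i> * Arg2pi w)" using Arg2pi[of w] nw by (simp add: is_Arg_def)
      then have "z = c (Arg2pi w / (2*pi))"
        using assms(1) by (simp add: c_def w_def field_simps)
      moreover have "Arg2pi w / (2*pi) \<in> {0..1}" using Arg2pi[of w] by (auto simp: field_simps)
      ultimately show "z \<in> c ` {0..1}" by blast
    qed
  qed (use cs in auto)
  have cf: "continuous_on {0..1} (f \<circ> c)"
    using continuous_on_compose[of "{0..1}" c f, OF contc] assms(2) cim by simp
  have nf: "norm (f (c t)) = 1" for t using assms(3) cs[of t] by (auto simp: Pi_iff)
  obtain g where g: "continuous_on {0..1::real} g" "\<And>t. t \<in> {0..1} \<Longrightarrow> (f \<circ> c) t = exp (g t)"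
  proof (rule continuous_logarithm_on_contractible[OF cf])
    show "contractible {0..1::real}" by (rule convex_imp_contractible) simp
    show "(f \<circ> c) t \<noteq> 0" for t using nf[of t] by auto
  qed (rule that)
  define h where "h = (\<lambda>t. Im (g t))"
  have h: "f (c t) = exp (\<i> * h t)" if "t \<in> {0..1}" for t
  proof -
    have "Re (g t) = 0" using g(2)[OF that] nf[of t] norm_exp_eq_Re[of "g t"] by simp
    then have "g t = \<i> * h t" by (simp add: h_def complex_eq_iff)
    then show ?thesis using g(2)[OF that] by simp
  qed
  have "c 0 = c 1" by (simp add: c_def)
  then have "exp (\<i> * h 1) = exp (\<i> * h 0)" using h[of 0] h[of 1] by simp
  then obtain d :: int where d: "\<i> * h 1 = \<i> * h 0 + (of_int (2 * d) * pi) * \<i>"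
    using exp_eq by blast
  have d': "h 1 = h 0 + 2 * pi * d"
    using arg_cong[OF d, of Im] by (simp add: algebra_simps)
  \<comment> \<open>This lift has equal values at 0 and 1 and so descends to the circle.\<close>
  define k where "k = (\<lambda>t. h t - 2 * pi * d * t)"
  obtain \<theta> where \<theta>: "continuous_on (c ` {0..1}) \<theta>" "\<And>t. t \<in> {0..1} \<Longrightarrow> \<theta> (c t) = k t"
  proof (rule continuous_lift_through_compact[of "{0..1::real}" c k])
    show "continuous_on {0..1} k" unfolding k_def h_def by (intro continuous_intros g)
    show "k x = k y" if xy: "x \<in> {0..1}" "y \<in> {0..1}" "c x = c y" for x y
    proof -
      have "exp (2 * pi * \<i> * x) = exp (2 * pi * \<i> * y)" using xy(3) assms(1) by (simp add: c_def)
      then obtain n :: int where n: "2 * pi * \<i> * x = 2 * pi * \<i> * y + (of_int (2 * n) * pi) * \<i>"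
        using exp_eq by blast
      then have "\<i> * complex_of_real (2 * pi * x) = \<i> * complex_of_real (2 * pi * y + 2 * n * pi)"
        by (simp add: algebra_simps)
      then have "2 * pi * x = 2 * pi * y + 2 * n * pi"
        by (simp only: mult_cancel_left of_real_eq_iff) simp
      then have "2 * pi * x = 2 * pi * (y + n)" by (simp add: algebra_simps)
      then have xyn: "x = y + n" by simp
      moreover have "n = 0 \<or> n = 1 \<or> n = -1" using xyn xy(1,2) by auto
      ultimately have "x = y \<or> (x = 1 \<and> y = 0) \<or> (x = 0 \<and> y = 1)" using xy(1,2) by auto
      then show ?thesis using d' by (auto simp: k_def)
    qed
  qed (use contc in auto)
  have key: "f z = exp (\<i> * \<theta> z) * ((z - p) / r) powi d" if "z \<in> sphere p r" for z
  proof -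
    have "z \<in> c ` {0..1}" using that cim by simp
    then obtain t where t: "t \<in> {0..1}" "z = c t" by blast
    have "((c t - p) / r) powi d = exp (\<i> * (2 * pi * d * t))"
    proof -
      have "(c t - p) / r = exp (2 * pi * \<i> * t)" using assms(1) by (simp add: c_def)
      then show ?thesis by (simp only: exp_power_int) (simp add: algebra_simps)
    qed
    moreover have "\<i> * h t = \<i> * k t + \<i> * (2 * pi * d * t)" by (simp add: k_def algebra_simps)
    ultimately show ?thesis using h[OF t(1)] t \<theta>(2)[OF t(1)] by (simp add: exp_add)
  qed
  show ?thesis using that[of \<theta> d] \<theta>(1) cim key by auto
qed

text \<open>Around each puncture \<open>p\<close> the map winds \<open>d\<close> times; divided by the \<open>d\<close>-th power of the unit vector in direction
\<open>z - p\<close> it can be refilled over a small disc around \<open>p\<close>, by extending the exponent with Tietze's theorem.  When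
no puncture is left, a square root exists because the plane is contractible.  Modulo squares only the
punctures with odd \<open>d\<close> are visible.\<close>

lemma planar_sqrt_decomposition:
  fixes h :: "complex \<Rightarrow> complex"
  assumes "finite K" "continuous_on (-K) h" "h \<in> -K \<rightarrow> sphere 0 1" "closed Y" "Y \<inter> K = {}"
  shows "\<exists>N \<subseteq> K. has_sqrt Y (\<lambda>z. h z * (\<Prod>p\<in>N. z - p))"
  using assms
proof (induction K arbitrary: h rule: finite_induct)
  case empty
  have "has_sqrt UNIV h"
    using empty by (intro has_sqrt_contractible contractible_UNIV) (auto simp: Pi_iff, metis norm_zero zero_neq_one)
  then show ?case by (auto intro: has_sqrt_subset)
next
  case (insert p K)
  have "closed (Y \<union> K)" using insert by (auto intro: finite_imp_closed)
  then have "open (- (Y \<union> K))" by (rule open_Compl)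
  moreover have "p \<in> - (Y \<union> K)" using insert by auto
  ultimately obtain r where r: "0 < r" "cball p r \<subseteq> - (Y \<union> K)" using open_contains_cball by metis
  have sub: "sphere p r \<subseteq> - insert p K" using r by auto
  obtain d \<theta> where \<theta>: "continuous_on (sphere p r) \<theta>"
    and d: "\<And>z. z \<in> sphere p r \<Longrightarrow> h z = exp (\<i> * complex_of_real (\<theta> z)) * ((z - p) / r) powi d"
    using circle_map_degree[OF r(1), of p h] insert.prems(1,2) sub
    by (metis (no_types, lifting) Pi_anti_mono continuous_on_subset subsetD)
  obtain \<Theta> where \<Theta>: "continuous_on UNIV \<Theta>" "\<And>z. z \<in> sphere p r \<Longrightarrow> \<Theta> z = \<theta> z"
    using Tietze_unbounded[OF \<theta>, of UNIV] by auto
  define u where "u = (\<lambda>z. (z - p) / norm (z - p))"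
  have nu: "norm (u z) = 1" if "z \<noteq> p" for z using that by (simp add: u_def norm_divide)
  have contu: "continuous_on S u" if "p \<notin> S" for S
    using that unfolding u_def by (intro continuous_intros) auto
  \<comment> \<open>The modified map has one puncture less.  It changes \<open>h\<close> on \<open>Y\<close> only by a power of \<open>u\<close>.\<close>
  define h1 where "h1 = (\<lambda>z. if z \<in> cball p r then exp (\<i> * \<Theta> z) else h z * u z powi (- d))"
  have h1_out: "h1 z = h z * u z powi (- d)" if "z \<notin> ball p r" for z
  proof (cases "z \<in> cball p r")
    case True
    then have z: "z \<in> sphere p r" using that by auto
    then have "u z = (z - p) / r" by (simp add: u_def dist_norm norm_minus_commute)
    moreover have "u z \<noteq> 0" using nu[of z] z r(1) by force
    ultimately show ?thesis using d[OF z] True \<Theta>(2)[OF z] by (simp add: h1_def power_int_minus)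
  qed (simp add: h1_def)
  have cont1: "continuous_on (-K) h1"
  proof -
    have "continuous_on (cball p r \<union> (- ball p r - K)) h1"
    proof (rule continuous_on_Un_local)
      have eq: "cball p r \<union> (- ball p r - K) = -K" using r by auto
      show "closedin (top_of_set (cball p r \<union> (- ball p r - K))) (cball p r)"
        by (simp add: closed_subset)
      show "closedin (top_of_set (cball p r \<union> (- ball p r - K))) (- ball p r - K)"
        unfolding eq closedin_closed by (rule exI[of _ "- ball p r"]) auto
      show "continuous_on (cball p r) h1"
        by (rule continuous_on_eq[of _ "\<lambda>z. exp (\<i> * \<Theta> z)"])
           (auto simp: h1_def intro!: continuous_intros continuous_on_subset[OF \<Theta>(1)])
      have p: "p \<in> ball p r" using r by auto
      have "continuous_on (- ball p r - K) (\<lambda>z. h z * u z powi (- d))"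
        using nu p r(1) by (intro continuous_intros contu continuous_on_subset[OF insert.prems(1)]) (auto simp: u_def)
      then show "continuous_on (- ball p r - K) h1"
        by (rule continuous_on_eq) (use h1_out in auto)
    qed
    moreover have "cball p r \<union> (- ball p r - K) = -K" using r by auto
    ultimately show ?thesis by simp
  qed
  have nh1: "h1 \<in> -K \<rightarrow> sphere 0 1"
  proof
    fix z assume z: "z \<in> -K"
    show "h1 z \<in> sphere 0 1"
    proof (cases "z \<in> cball p r")
      case False
      then have "z \<noteq> p" using r by auto
      then have "norm (h z) = 1" using insert.prems(2) z by (auto simp: Pi_iff)
      then show ?thesis using False nu[OF \<open>z \<noteq> p\<close>] by (simp add: h1_def norm_mult norm_power_int)
    qed (simp add: h1_def)
  qed
  obtain N where N: "N \<subseteq> K" "has_sqrt Y (\<lambda>z. h1 z * (\<Prod>p\<in>N. z - p))"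
    using insert.IH[OF cont1 nh1] insert.prems by auto
  have Yr: "z \<notin> ball p r" "z \<noteq> p" if "z \<in> Y" for z using r that by (auto simp: subset_iff)
  have pY: "p \<notin> Y" using insert.prems by auto
  have hY: "h z = h1 z * u z powi d" if "z \<in> Y" for z
    proof -
    have "u z \<noteq> 0" using nu[OF Yr(2)[OF that]] by auto
    then have "u z powi (-d) * u z powi d = 1" by (simp flip: power_int_add)
    then show ?thesis using h1_out[OF Yr(1)[OF that]] by (simp add: mult.assoc)
  qed
  have nzu: "u z \<noteq> 0" if "z \<in> Y" for z using nu[OF Yr(2)[OF that]] by auto
  show ?case
  proof (cases "even d")
    case True
    then obtain e where e: "d = e + e" by (metis dvdE mult_2)
    have uu: "u z powi d = u z powi e * u z powi e" if "z \<in> Y" for z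
      unfolding e using nzu[OF that] by (rule power_int_add[OF disjI1])
    have "has_sqrt Y (\<lambda>z. u z powi e * u z powi e)"
      using nzu pY by (intro has_sqrt_square continuous_intros contu) auto
    from has_sqrt_mult[OF N(2) this] have "has_sqrt Y (\<lambda>z. h z * (\<Prod>p\<in>N. z - p))"
      by (rule has_sqrt_cong) (simp add: hY uu)
    then show ?thesis using N(1) by blast
  next
    case False
    then obtain e where e: "d + 1 = e + e" by (metis dvdE even_plus_one_iff mult_2)
    define w where "w = (\<lambda>z. u z powi e * complex_of_real (sqrt (norm (z - p))))"
    have "has_sqrt Y (\<lambda>z. w z * w z)"
      using nzu pY unfolding w_def by (intro has_sqrt_square continuous_intros contu) auto
    from has_sqrt_mult[OF N(2) this] have "has_sqrt Y (\<lambda>z. h z * (\<Prod>p\<in>insert p N. z - p))"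
    proof (rule has_sqrt_cong)
      fix z assume z: "z \<in> Y"
      have "w z * w z = u z powi (e + e) * complex_of_real (norm (z - p))"
      proof -
        have "complex_of_real (norm (z - p)) = of_real (sqrt (norm (z - p))) * of_real (sqrt (norm (z - p)))"
          by (simp flip: of_real_mult)
        moreover have "u z powi (e + e) = u z powi e * u z powi e"
          using nzu[OF z] by (rule power_int_add[OF disjI1])
        ultimately show ?thesis unfolding w_def by (simp only: mult_ac)
      qed
      also have "\<dots> = u z powi d * (u z * norm (z - p))"
      proof -
        have "u z powi (d + 1) = u z powi d * u z powi 1"
          using nzu[OF z] by (rule power_int_add[OF disjI1])
        then show ?thesis by (simp add: mult.assoc flip: e)
      qed
      also have "u z * norm (z - p) = z - p" using Yr[OF z] by (simp add: u_def)
      finally have ww: "w z * w z = u z powi d * (z - p)" .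
      have "p \<notin> N" "finite N" using N(1) insert.hyps finite_subset by auto
      then show "h1 z * (\<Prod>p\<in>N. z - p) * (w z * w z) = h z * (\<Prod>p\<in>insert p N. z - p)"
        unfolding ww by (simp add: hY[OF z] mult_ac)
    qed
    then show ?thesis using N(1) by blast
  qed
qed

text \<open>Such a root divided by \<open>exp (\<i> \<pi> t)\<close> along the circle takes at most two values, hence is constant, but it
has opposite values at the two ends of the parametrisation.\<close>

lemma no_sqrt_on_circle:
  assumes "0 < r"
  shows "\<not> has_sqrt (sphere p r) (\<lambda>z. z - p)"
proof
  assume "has_sqrt (sphere p r) (\<lambda>z. z - p)"
  then obtain s where s: "continuous_on (sphere p r) s" "\<And>z. z \<in> sphere p r \<Longrightarrow> z - p = (s z)\<^sup>2"
    unfolding has_sqrt_def by metis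
  define c where "c = (\<lambda>t::real. p + r * exp (2 * pi * \<i> * t))"
  have cs: "c t \<in> sphere p r" for t
    using assms(1) by (simp add: c_def dist_norm norm_mult)
  have contc: "continuous_on S c" for S unfolding c_def by (intro continuous_intros)
  define q where "q = (\<lambda>t. s (c t) / exp (pi * \<i> * t))"
  have contq: "continuous_on {0..1} q"
    unfolding q_def by (intro continuous_intros continuous_on_compose2[OF s(1) contc]) (use cs in auto)
  have q2: "(q t)\<^sup>2 = r" for t
    using s(2)[OF cs[of t]] by (simp add: q_def c_def power_divide field_simps flip: exp_double)
  have fin: "finite (q ` {0..1})"
  proof (rule finite_subset)
    show "q ` {0..1} \<subseteq> {csqrt r, - csqrt r}"
    proof (clarsimp simp: image_subset_iff)
      fix t assume "q t \<noteq> - csqrt (complex_of_real r)"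
      moreover have "(q t)\<^sup>2 = (csqrt r)\<^sup>2" using q2[of t] by simp
      ultimately show "q t = csqrt (complex_of_real r)" by (simp only: power2_eq_iff) blast
    qed
  qed simp
  have "q constant_on {0..1}"
    by (rule continuous_finite_range_constant[OF _ contq fin]) simp
  then have "q 0 = q 1" unfolding constant_on_def by force
  moreover have "q 0 = - q 1" by (simp add: q_def c_def)
  ultimately have "q 0 = 0" by simp
  then show False using q2[of 0] assms by simp
qed

section \<open>Complements of forests on a surface\<close>

definition embedded_disc :: "'a::real_normed_vector set \<Rightarrow> (complex \<Rightarrow> 'a) \<Rightarrow> bool" where
  "embedded_disc S h \<longleftrightarrow> continuous_on (cball 0 1) h \<and> inj_on h (cball 0 1) \<and> h ` cball 0 1 \<subseteq> S \<and>
     openin (top_of_set S) (h ` ball 0 1)"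

text \<open>The form in which surfaces enter: discs are closed, carry a parametrisation up to the boundary, and can be
chosen inside any neighbourhood of their centre.\<close>

definition locally_disc :: "'a::real_normed_vector set \<Rightarrow> bool" where
  "locally_disc S \<longleftrightarrow> (\<forall>x\<in>S. \<forall>U. openin (top_of_set S) U \<and> x \<in> U \<longrightarrow>
     (\<exists>h. embedded_disc S h \<and> h 0 = x \<and> h ` cball 0 1 \<subseteq> U))"

lemma locally_discE:
  assumes "locally_disc S" "openin (top_of_set S) U" "x \<in> U"
  obtains h where "embedded_disc S h" "h 0 = x" "h ` cball 0 1 \<subseteq> U"
proof -
  have "x \<in> S" using assms openin_imp_subset by blast
  then show ?thesis using assms that unfolding locally_disc_def by meson
qed

lemma embedded_disc_inverse:
  assumes "embedded_disc S h"
  obtains k where "homeomorphism (cball 0 1) (h ` cball 0 1) h k"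
  using assms homeomorphism_compact[OF compact_cball _ refl] unfolding embedded_disc_def by metis

lemma embedded_disc_open_image:
  assumes "embedded_disc S h" "open V" "V \<subseteq> ball 0 1"
  shows "openin (top_of_set S) (h ` V)"
proof -
  obtain k where k: "homeomorphism (cball 0 1) (h ` cball 0 1) h k"
    using embedded_disc_inverse[OF assms(1)] .
  have hom: "homeomorphism (ball 0 1) (h ` ball 0 1) h k"
    by (rule homeomorphism_of_subsets[OF k]) auto
  have "openin (top_of_set (ball 0 1)) V" using assms by (auto simp: openin_open)
  then have "openin (top_of_set (h ` ball 0 1)) (h ` V)"
    using homeomorphism_imp_open_map[OF hom] by blast
  then show ?thesis using assms(1) openin_trans unfolding embedded_disc_def by blast
qed

text \<open>Otherwise the inverse of the arc would embed an open subset of the plane into the line.\<close>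

lemma arc_interior_empty:
  fixes g :: "real \<Rightarrow> complex"
  assumes "arc g" "open U" "U \<subseteq> path_image g"
  shows "U = {}"
proof (rule ccontr)
  assume "U \<noteq> {}"
  obtain k where k: "homeomorphism {0..1} (path_image g) g k"
    using homeomorphism_arc[OF assms(1)] .
  have "continuous_on U k" using k assms(3) continuous_on_subset unfolding homeomorphism_def by metis
  moreover have "inj_on k U"
  proof (rule inj_on_inverseI)
    show "g (k x) = x" if "x \<in> U" for x using k that assms(3) unfolding homeomorphism_def by blast
  qed
  ultimately have "DIM(complex) \<le> DIM(real)"
    using invariance_of_dimension[of U k] assms(2) \<open>U \<noteq> {}\<close> by blast
  then show False by simp
qed

text \<open>Janiszewski's theorem for the arc and the closed set consisting of \<open>P\<close> and the boundary circle; the circle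
keeps the connected sets that it produces inside the disc.\<close>

lemma disc_minus_arc_connected:
  fixes g :: "real \<Rightarrow> complex"
  assumes "arc g" "path_image g \<subseteq> ball 0 1" "closed P" "connected (path_image g \<inter> P)"
    and xy: "connected_component (ball 0 1 - P) x y" "x \<notin> path_image g" "y \<notin> path_image g"
  shows "connected_component (ball 0 1 - P - path_image g) x y"
proof -
  let ?T = "P \<inter> cball 0 1 \<union> sphere 0 1"
  have "connected_component (- (path_image g \<union> ?T)) x y"
  proof (rule Janiszewski)
    show "compact (path_image g)" using assms(1) by (simp add: compact_arc_image)
    show "closed ?T" using assms(3) by (intro closed_Un closed_Int) auto
    have "path_image g \<inter> ?T = path_image g \<inter> P" using assms(2) by (auto simp: subset_iff)
    then show "connected (path_image g \<inter> ?T)" using assms(4) by simp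
    have "connected (- path_image g)" using connected_arc_complement[OF assms(1)] by simp
    then show "connected_component (- path_image g) x y"
      using xy(2,3) by (auto simp: connected_iff_connected_component)
    show "connected_component (- ?T) x y"
      by (rule connected_component_of_subset[OF xy(1)]) (use assms(2) in auto)
  qed
  then obtain W where W: "connected W" "W \<subseteq> - (path_image g \<union> ?T)" "x \<in> W" "y \<in> W"
    unfolding connected_component_def by blast
  have "x \<in> ball 0 1" using xy(1) connected_component_in by blast
  have "W \<subseteq> ball 0 1"
  proof (rule ccontr)
    assume "\<not> W \<subseteq> ball 0 1"
    then have "W \<inter> frontier (ball 0 1) \<noteq> {}"
      using connected_Int_frontier[OF W(1), of "ball 0 1"] W(3) \<open>x \<in> ball 0 1\<close> by blast
    then show False using W(2) by auto
  qed
  then have "W \<subseteq> ball 0 1 - P - path_image g"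
    using W(2) subset_trans[OF \<open>W \<subseteq> ball 0 1\<close> ball_subset_cball] by blast
  then show ?thesis using W unfolding connected_component_def by blast
qed

text \<open>Any two points off \<open>Y\<close> are joined by chains of small neighbourhoods in \<open>S - Y\<close>.  By the planar case each component
of the disc minus \<open>Y\<close> stays connected when the arc is removed, so these chains survive its removal.\<close>

lemma small_arc_complement_connected:
  fixes S :: "'a::real_normed_vector set"
  assumes S: "locally_disc S" and h: "embedded_disc S h"
    and Y: "closedin (top_of_set S) Y" "connected (S - Y)"
    and g: "arc g" "path_image g \<subseteq> h ` ball 0 1" "connected (path_image g \<inter> Y)"
  shows "connected (S - (Y \<union> path_image g))"
proof -
  obtain k where k: "homeomorphism (cball 0 1) (h ` cball 0 1) h k"
    using embedded_disc_inverse[OF h] .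
  have kh: "k (h w) = w" if "w \<in> cball 0 1" for w using k that unfolding homeomorphism_def by blast
  have hk: "h (k x) = x" if "x \<in> h ` cball 0 1" for x using k that unfolding homeomorphism_def by blast
  have contk: "continuous_on (h ` cball 0 1) k" and conth: "continuous_on (cball 0 1) h"
    using k unfolding homeomorphism_def by auto
  have gD: "path_image g \<subseteq> h ` cball 0 1" using g(2) by (auto simp: image_subset_iff subset_iff)
  have hS: "h ` cball 0 1 \<subseteq> S" using h unfolding embedded_disc_def by blast
  define W where "W = S - (Y \<union> path_image g)"
  define P where "P = {w \<in> cball 0 1. h w \<in> Y}"
  have clP: "closed P"
  proof -
    have "closedin (top_of_set (cball 0 1)) (cball 0 1 \<inter> h -` Y)"
      using continuous_closedin_preimage_gen[OF conth _ Y(1)] hS by (simp add: image_subset_iff_funcset)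
    moreover have "P = cball 0 1 \<inter> h -` Y" by (auto simp: P_def)
    ultimately show ?thesis using closedin_closed_trans[OF _ closed_cball] by metis
  qed
  define C where "C = path_image (k \<circ> g)"
  have arcC: "arc (k \<circ> g)"
    unfolding arc_def
  proof
    show "path (k \<circ> g)"
      using g(1) gD by (intro path_continuous_image continuous_on_subset[OF contk]) (auto simp: arc_def)
    show "inj_on (k \<circ> g) {0..1}"
    proof (rule inj_onI)
      fix s t :: real assume st: "s \<in> {0..1}" "t \<in> {0..1}" "(k \<circ> g) s = (k \<circ> g) t"
      then have "g s = g t" using hk gD by (metis comp_apply image_subset_iff path_image_def)
      then show "s = t" using st g(1) unfolding arc_def inj_on_def by blast
    qed
  qed
  have Ceq: "C = k ` path_image g" unfolding C_def by (rule path_image_compose)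
  have Cb: "C \<subseteq> ball 0 1"
  proof
    fix w assume "w \<in> C"
    then obtain x where "x \<in> path_image g" "w = k x" unfolding Ceq by blast
    then obtain v where "v \<in> ball 0 1" "w = k (h v)" using g(2) by blast
    then show "w \<in> ball 0 1" using kh[of v] by (simp add: less_imp_le)
  qed
  have hC: "h w \<in> path_image g \<longleftrightarrow> w \<in> C" if "w \<in> cball 0 1" for w
  proof
    assume "h w \<in> path_image g"
    then have "k (h w) \<in> C" unfolding Ceq by blast
    then show "w \<in> C" using kh[OF that] by simp
  next
    assume "w \<in> C"
    then obtain x where x: "x \<in> path_image g" "w = k x" unfolding Ceq by blast
    then have "h w = x" using hk gD by blast
    then show "h w \<in> path_image g" using x by simp
  qed
  have CP: "connected (C \<inter> P)"
  proof -
    have "connected (k ` (path_image g \<inter> Y))"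
      by (rule connected_continuous_image[OF continuous_on_subset[OF contk] g(3)]) (use gD in auto)
    moreover have "k ` (path_image g \<inter> Y) = C \<inter> P"
    proof
      show "k ` (path_image g \<inter> Y) \<subseteq> C \<inter> P"
        using gD hk Cb unfolding Ceq P_def by (auto simp: subset_iff less_imp_le)
      show "C \<inter> P \<subseteq> k ` (path_image g \<inter> Y)"
        using gD hk unfolding Ceq P_def by (auto simp: subset_iff)
    qed
    ultimately show ?thesis by simp
  qed
  let ?Q = "\<lambda>p. connected_component_set (ball 0 1 - P) (k p)"
  have inW: "h w \<in> W" if "w \<in> ball 0 1 - P - C" for w
    using that hS hC[of w] unfolding W_def P_def by (auto simp: less_imp_le image_subset_iff)
  have Wdisc: "connected_component W (h v) (h w)"
    if "connected_component (ball 0 1 - P) v w" "h v \<in> W" "h w \<in> W" for v w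
  proof -
    have vw: "v \<in> ball 0 1" "w \<in> ball 0 1" using connected_component_in[OF that(1)] by auto
    then have "v \<notin> C" "w \<notin> C" using that(2,3) hC[of v] hC[of w] unfolding W_def by (auto simp: less_imp_le)
    then have "connected_component (ball 0 1 - P - C) v w"
      using disc_minus_arc_connected[OF arcC _ clP] that(1) Cb CP unfolding C_def by blast
    then obtain T where T: "connected T" "T \<subseteq> ball 0 1 - P - C" "v \<in> T" "w \<in> T"
      unfolding connected_component_def by blast
    have "T \<subseteq> cball 0 1" using T(2) by (auto simp: less_imp_le)
    then have "connected (h ` T)" using T(1) connected_continuous_image continuous_on_subset[OF conth] by blast
    moreover have "h ` T \<subseteq> W" using inW T(2) by blast
    ultimately show ?thesis using T(3,4) unfolding connected_component_def by blast
  qed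
  \<comment> \<open>\<open>near p x\<close>: the point \<open>x\<close> off the arc may represent \<open>p\<close>.  A point on the arc is represented by the points off the
    arc in its component of the disc minus \<open>Y\<close>.\<close>
  define near where "near = (\<lambda>p x. x \<in> W \<and> (x = p \<or> p \<in> h ` ball 0 1 \<and> x \<in> h ` ?Q p))"
  have kball: "k p \<in> ball 0 1 \<and> h (k p) = p" if "p \<in> h ` ball 0 1" for p
    using that kh by (auto simp: less_imp_le)
  have nearW: "connected_component W p x" if "near p x" "p \<in> W" for p x
  proof (cases "x = p")
    case True then show ?thesis using that by simp
  next
    case False
    have *: "p \<in> h ` ball 0 1" "x \<in> h ` ?Q p" using that(1) False unfolding near_def by auto
    then obtain w where "x = h w" "connected_component (ball 0 1 - P) (k p) w" by blast
    note w = *(1) this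
    then show ?thesis using Wdisc[OF w(3)] that kball[OF w(1)] unfolding near_def by auto
  qed
  have QP: "k p \<in> ball 0 1 - P" if "p \<in> h ` ball 0 1" "p \<in> S - Y" for p
    using kball[OF that(1)] that(2) unfolding P_def by auto
  have near_rel: "connected_component W x y"
    if near: "p \<in> h ` ball 0 1" "p \<in> S - Y" "q \<in> h ` ?Q p" "near p x" "near q y" for p q x y
  proof -
    obtain w where w: "q = h w" "connected_component (ball 0 1 - P) (k p) w" using near(3) by auto
    have wb: "w \<in> ball 0 1" using connected_component_in[OF w(2)] by blast
    then have kq: "k q = w" using kh w(1) by (simp add: less_imp_le)
    have 1: "\<exists>v. x = h v \<and> connected_component (ball 0 1 - P) (k p) v"
    proof (cases "x = p")
      case True
      then show ?thesis using kball[OF near(1)] QP[OF near(1,2)]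
        by (intro exI[of _ "k p"]) (simp add: connected_component_refl)
    next
      case False then show ?thesis using near(4) unfolding near_def by auto
    qed
    have 2: "\<exists>v. y = h v \<and> connected_component (ball 0 1 - P) (k p) v"
    proof (cases "y = q")
      case True then show ?thesis using w by blast
    next
      case False
      then obtain v where "y = h v" "connected_component (ball 0 1 - P) w v"
        using near(5) kq unfolding near_def by auto
      then show ?thesis using w(2) connected_component_trans by blast
    qed
    show ?thesis
      using 1 2 Wdisc near(4,5) unfolding near_def by (metis connected_component_sym connected_component_trans)
  qed
  have near_ex: "\<exists>x. near p x" if p: "p \<in> S - Y" for p
  proof (cases "p \<in> W")
    case True then show ?thesis unfolding near_def by blast
  next
    case False
    then have pg: "p \<in> path_image g" using p unfolding W_def by blast
    then have pb: "p \<in> h ` ball 0 1" using g(2) by blast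
    have "open (ball 0 1 - P)" using clP by (simp add: open_Diff)
    then have "open (?Q p)" by (rule open_connected_component)
    moreover have "k p \<in> ?Q p" using QP[OF pb p] by (simp add: connected_component_refl)
    ultimately have "\<not> ?Q p \<subseteq> C" using arc_interior_empty[OF arcC] unfolding C_def by blast
    then obtain w where w: "w \<in> ?Q p" "w \<notin> C" by blast
    have "?Q p \<subseteq> ball 0 1 - P" by (rule connected_component_subset)
    then have "h w \<in> W" using inW w by blast
    then show ?thesis using w(1) pb unfolding near_def by blast
  qed
  have all: "\<forall>x y. near p x \<longrightarrow> near q y \<longrightarrow> connected_component W x y" if "p \<in> S - Y" "q \<in> S - Y" for p q
  proof (rule connected_equivalence_relation[OF Y(2) that, of "\<lambda>p q. \<forall>x y. near p x \<longrightarrow> near q y \<longrightarrow> connected_component W x y"])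
    show "\<And>p q. \<lbrakk>\<forall>x y. near p x \<longrightarrow> near q y \<longrightarrow> connected_component W x y; p \<in> S - Y; q \<in> S - Y\<rbrakk>
       \<Longrightarrow> \<forall>x y. near q x \<longrightarrow> near p y \<longrightarrow> connected_component W x y"
      using connected_component_sym by blast
    show "\<And>p q r. \<lbrakk>\<forall>x y. near p x \<longrightarrow> near q y \<longrightarrow> connected_component W x y;
        \<forall>x y. near q x \<longrightarrow> near r y \<longrightarrow> connected_component W x y; p \<in> S - Y; q \<in> S - Y; r \<in> S - Y\<rbrakk>
       \<Longrightarrow> \<forall>x y. near p x \<longrightarrow> near r y \<longrightarrow> connected_component W x y"
      using near_ex connected_component_trans by meson
    fix p assume p: "p \<in> S - Y"
    show "\<exists>T. openin (top_of_set (S - Y)) T \<and> p \<in> T \<and>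
        (\<forall>q\<in>T. \<forall>x y. near p x \<longrightarrow> near q y \<longrightarrow> connected_component W x y)"
    proof (cases "p \<in> h ` ball 0 1")
      case True
      have "open (?Q p)" using clP by (simp add: open_Diff open_connected_component)
      moreover have Qs: "?Q p \<subseteq> ball 0 1 - P" by (rule connected_component_subset)
      ultimately have "openin (top_of_set S) (h ` ?Q p)" using embedded_disc_open_image[OF h] by blast
      moreover have "h ` ?Q p \<subseteq> S - Y"
      proof (rule image_subsetI)
        fix w assume "w \<in> ?Q p"
        then have w: "w \<in> cball 0 1" "w \<notin> P" using subsetD[OF Qs] by (auto simp: less_imp_le)
        then show "h w \<in> S - Y" using hS unfolding P_def by blast
      qed
      ultimately have "openin (top_of_set (S - Y)) (h ` ?Q p)"
        by (rule openin_subset_trans) auto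
      moreover have "p \<in> h ` ?Q p"
        using kball[OF True] QP[OF True p] by (metis (no_types, lifting) connected_component_refl image_eqI mem_Collect_eq)
      ultimately show ?thesis using near_rel[OF True p] by blast
    next
      case False
      then have pW: "p \<in> W" using p g(2) unfolding W_def by blast
      have "closedin (top_of_set S) (path_image g)"
        using gD hS compact_arc_image[OF g(1)] by (intro closed_subset compact_imp_closed) auto
      then have "openin (top_of_set S) W" unfolding W_def using Y(1) by (intro openin_diff) auto
      then obtain h' where h': "embedded_disc S h'" "h' 0 = p" "h' ` cball 0 1 \<subseteq> W"
        using locally_discE[OF S] pW by metis
      have sub: "h' ` ball 0 1 \<subseteq> W" using h'(3) by (auto simp: less_imp_le image_subset_iff)
      have "connected (h' ` ball 0 1)"
        using h'(1) by (intro connected_continuous_image) (auto simp: embedded_disc_def intro: continuous_on_subset)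
      moreover have op: "openin (top_of_set S) (h' ` ball 0 1)" using h'(1) unfolding embedded_disc_def by blast
      moreover have p0: "p \<in> h' ` ball 0 1" using h'(2) by force
      ultimately have conn: "connected_component W p q" if "q \<in> h' ` ball 0 1" for q
        using sub that unfolding connected_component_def by blast
      have "openin (top_of_set (S - Y)) (h' ` ball 0 1)"
        by (rule openin_subset_trans[OF op]) (use sub W_def in auto)
      moreover have "connected_component W x y" if "q \<in> h' ` ball 0 1" "near p x" "near q y" for q x y
      proof -
        have "x = p" using that(2) False unfolding near_def by blast
        moreover have "connected_component W q y" using nearW[OF that(3)] sub that(1) by blast
        ultimately show ?thesis using conn[OF that(1)] connected_component_trans by blast
      qed
      ultimately show ?thesis using p0 by blast
    qed
  qed
  have "connected_component W x y" if "x \<in> W" "y \<in> W" for x y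
    using all[of x y] that unfolding near_def W_def by blast
  then show ?thesis unfolding connected_iff_connected_component W_def by blast
qed

text \<open>The arc is cut into pieces so short that each lies in an embedded disc, and these are removed one after the
other.  Each meets what has been removed before in at most its initial point.\<close>

lemma arc_complement_connected:
  fixes S :: "'a::real_normed_vector set"
  assumes S: "locally_disc S" and Y: "closedin (top_of_set S) Y" "connected (S - Y)"
    and g: "arc g" "path_image g \<subseteq> S" "path_image g \<inter> Y \<subseteq> {pathstart g}"
  shows "connected (S - (Y \<union> path_image g))"
proof -
  have contg: "continuous_on {0..1} g" and injg: "inj_on g {0..1}"
    using g(1) by (auto simp: arc_def path_def)
  define \<C> where "\<C> = {V. open V \<and> (\<exists>h. embedded_disc S h \<and> g ` ({0..1} \<inter> V) \<subseteq> h ` ball 0 1)}"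
  have cover: "{0..1} \<subseteq> \<Union>\<C>"
  proof
    fix t :: real assume t: "t \<in> {0..1}"
    then have "g t \<in> S" using g(2) by (auto simp: path_image_def)
    then obtain h where h: "embedded_disc S h" "h 0 = g t"
      using locally_discE[OF S openin_subtopology_self, of "g t"] by metis
    then have "openin (top_of_set S) (h ` ball 0 1)" unfolding embedded_disc_def by blast
    then have "openin (top_of_set {0..1}) ({0..1} \<inter> g -` (h ` ball 0 1))"
      using contg g(2) by (intro continuous_openin_preimage) (auto simp: path_image_def)
    then obtain V where V: "open V" "{0..1} \<inter> g -` (h ` ball 0 1) = {0..1} \<inter> V"
      by (auto simp: openin_open)
    then have "V \<in> \<C>" using h(1) unfolding \<C>_def by blast
    moreover have "h 0 \<in> h ` ball 0 1" by (rule imageI) simp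
    then have "g t \<in> h ` ball 0 1" using h(2) by simp
    then have "t \<in> V" using V t by blast
    ultimately show "t \<in> \<Union>\<C>" by blast
  qed
  obtain \<delta> where \<delta>: "0 < \<delta>" "\<And>T. \<lbrakk>T \<subseteq> {0..1}; diameter T < \<delta>\<rbrakk> \<Longrightarrow> \<exists>B\<in>\<C>. T \<subseteq> B"
  proof (rule Lebesgue_number_lemma[of "{0..1::real}" \<C>])
    show "\<C> \<noteq> {}" using cover by force
    show "\<And>B. B \<in> \<C> \<Longrightarrow> open B" by (simp add: \<C>_def)
  qed (use cover in auto)
  obtain n :: nat where n: "n > 0" "1 / n < \<delta>"
    using \<delta>(1) by (metis nat_approx_posE zero_less_Suc)
  have closed_part: "closedin (top_of_set S) (g ` {0..t})" if "t \<le> 1" for t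
    using that g(2) compact_continuous_image[OF continuous_on_subset[OF contg]]
    by (intro closed_subset compact_imp_closed) (auto simp: path_image_def)
  have step: "connected (S - (Z \<union> g ` {real i / n..real (Suc i) / n}))"
    if i: "Suc i \<le> n" and Z: "closedin (top_of_set S) Z" "connected (S - Z)"
      "g ` {real i / n..real (Suc i) / n} \<inter> Z \<subseteq> {g (real i / n)}" for i Z
  proof -
    let ?u = "real i / n" and ?v = "real (Suc i) / n"
    have uv: "?u \<in> {0..1}" "?v \<in> {0..1}" "?u < ?v"
      using i n(1) by (auto simp: field_simps)
    have "diameter {?u..?v} = 1 / n" using uv by (simp add: diameter_closed_interval add_divide_distrib)
    then obtain B where "B \<in> \<C>" "{?u..?v} \<subseteq> B" using \<delta>(2)[of "{?u..?v}"] n(2) uv by auto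
    then obtain h where h: "embedded_disc S h" "g ` {?u..?v} \<subseteq> h ` ball 0 1"
    proof -
      have "{?u..?v} \<subseteq> {0..1} \<inter> B" using \<open>{?u..?v} \<subseteq> B\<close> uv by auto
      moreover obtain h where "embedded_disc S h" "g ` ({0..1} \<inter> B) \<subseteq> h ` ball 0 1"
        using \<open>B \<in> \<C>\<close> unfolding \<C>_def by blast
      ultimately show ?thesis using that[of h] by blast
    qed
    have pim: "path_image (subpath ?u ?v g) = g ` {?u..?v}" using uv by (simp add: path_image_subpath)
    have "connected (S - (Z \<union> path_image (subpath ?u ?v g)))"
    proof (rule small_arc_complement_connected[OF S h(1) Z(1,2)])
      show "arc (subpath ?u ?v g)" using arc_subpath_arc[OF g(1) uv(1,2)] uv(3) n(1) by simp
      show "connected (path_image (subpath ?u ?v g) \<inter> Z)"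
        using Z(3) unfolding pim by (metis connected_empty connected_sing subset_singletonD)
    qed (use h(2) pim in simp)
    then show ?thesis unfolding pim .
  qed
  have "connected (S - (Y \<union> g ` {0..real (Suc i) / n}))" if "Suc i \<le> n" for i
    using that
  proof (induction i)
    case 0
    have "{0..real (Suc 0) / n} \<subseteq> {0..1}" using n(1) by (auto simp: field_simps)
    then have "g ` {0..real (Suc 0) / n} \<inter> Y \<subseteq> {g 0}"
      using g(3) unfolding path_image_def pathstart_def by blast
    then show ?case using step[of 0 Y] 0 Y by simp
  next
    case (Suc i)
    let ?u = "real (Suc i) / n" and ?v = "real (Suc (Suc i)) / n"
    have uv: "0 < ?u" "?u \<le> 1" "?v \<le> 1" "?u < ?v" using Suc.prems n(1) by (auto simp: field_simps)
    have "connected (S - ((Y \<union> g ` {0..?u}) \<union> g ` {?u..?v}))"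
    proof (rule step[OF Suc.prems])
      show "closedin (top_of_set S) (Y \<union> g ` {0..?u})" using Y(1) closed_part uv by (intro closedin_Un) auto
      show "connected (S - (Y \<union> g ` {0..?u}))" using Suc.IH Suc.prems by simp
      have "g s \<notin> Y" if "s \<in> {?u..?v}" for s
      proof
        assume "g s \<in> Y"
        moreover have "s \<in> {0..1}" using that uv by auto
        ultimately have "g s = g 0" using g(3) unfolding path_image_def pathstart_def by blast
        then have "s = 0" using injg \<open>s \<in> {0..1}\<close> by (auto dest: inj_onD)
        then show False using that uv by auto
      qed
      moreover have "g s = g ?u" if s: "s \<in> {?u..?v}" "g s \<in> g ` {0..?u}" for s
      proof -
        obtain t where t: "t \<in> {0..?u}" "g s = g t" using s(2) by blast
        then have "s = t" using injg s(1) uv by (auto dest!: inj_onD)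
        then have "s = ?u" using t(1) s(1) by auto
        then show ?thesis by simp
      qed
      ultimately show "g ` {?u..?v} \<inter> (Y \<union> g ` {0..?u}) \<subseteq> {g ?u}" by blast
    qed
    moreover have "{0..?v} = {0..?u} \<union> {?u..?v}" using uv by auto
    ultimately show ?case by (simp only: image_Un Un_assoc)
  qed
  from this[of "n - 1"] show ?thesis using n(1) by (simp add: path_image_def)
qed

text \<open>The condition on intersections makes the arcs pendant, in whatever order they are removed.\<close>

lemma forest_complement_connected:
  fixes S :: "'a::real_normed_vector set"
  assumes S: "locally_disc S" and Y: "closedin (top_of_set S) Y" "connected (S - Y)"
    and "finite \<A>" "\<And>a. a \<in> \<A> \<Longrightarrow> arc a \<and> path_image a \<subseteq> S \<and> path_image a \<inter> Y \<subseteq> {pathstart a}"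
    and "\<And>a b. \<lbrakk>a \<in> \<A>; b \<in> \<A>; a \<noteq> b\<rbrakk> \<Longrightarrow> path_image a \<inter> path_image b \<subseteq> {pathstart a}"
  shows "connected (S - (Y \<union> (\<Union>a\<in>\<A>. path_image a)))"
  using assms(4-)
proof (induction \<A> rule: finite_induct)
  case empty
  then show ?case using Y by simp
next
  case (insert a \<A>)
  have "connected (S - ((Y \<union> (\<Union>a\<in>\<A>. path_image a)) \<union> path_image a))"
  proof (rule arc_complement_connected[OF S])
    show "closedin (top_of_set S) (Y \<union> (\<Union>a\<in>\<A>. path_image a))"
      using insert.hyps(1) insert.prems(1) Y(1)
      by (intro closedin_Un closedin_Union) (auto intro!: closed_subset compact_imp_closed compact_arc_image)
    show "connected (S - (Y \<union> (\<Union>a\<in>\<A>. path_image a)))"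
      using insert by simp
    show "path_image a \<inter> (Y \<union> (\<Union>a\<in>\<A>. path_image a)) \<subseteq> {pathstart a}"
      using insert.hyps(2) insert.prems by blast
  qed (use insert.prems(1) in auto)
  then show ?case by (simp add: Un_ac)
qed

section \<open>Moving punctures\<close>

text \<open>A map into the circle that is defined off \<open>p\<close> and finitely many other points can be changed away from \<open>X\<close> so that
the puncture \<open>p\<close> is replaced by \<open>q\<close>.\<close>

definition moves_puncture :: "'a::real_normed_vector set \<Rightarrow> 'a set \<Rightarrow> 'a \<Rightarrow> 'a \<Rightarrow> bool" where
  "moves_puncture S X p q \<longleftrightarrow> (\<forall>K g. finite K \<and> continuous_on (S - insert p K) g \<and>
      g ` (S - insert p K) \<subseteq> sphere (0::complex) 1 \<longrightarrow>
      (\<exists>g'. continuous_on (S - insert q K) g' \<and> g' ` (S - insert q K) \<subseteq> sphere 0 1 \<and>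
        (\<forall>x\<in>X - K. g' x = g x)))"

lemma moves_punctureE:
  assumes "moves_puncture S X p q" "finite K" "continuous_on (S - insert p K) g"
    "g ` (S - insert p K) \<subseteq> sphere (0::complex) 1"
  obtains g' where "continuous_on (S - insert q K) g'" "g' ` (S - insert q K) \<subseteq> sphere 0 1"
    "\<And>x. x \<in> X - K \<Longrightarrow> g' x = g x"
  using assms unfolding moves_puncture_def by (metis (no_types, lifting))

text \<open>Inside a disc around both points the new map is the old one on the boundary circle, composed with the
retraction of the disc punctured at the new point.\<close>

lemma moves_puncture_in_disc:
  assumes h: "embedded_disc S h" "h ` cball 0 1 \<inter> X = {}" and pq: "v \<in> ball 0 (1/2)" "w \<in> ball 0 (1/2)"
  shows "moves_puncture S X (h v) (h w)"
  unfolding moves_puncture_def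
proof (intro allI impI, elim conjE)
  fix K and g :: "'a \<Rightarrow> complex"
  assume K: "finite K" and g: "continuous_on (S - insert (h v) K) g"
    "g ` (S - insert (h v) K) \<subseteq> sphere (0::complex) 1"
  obtain k where k: "homeomorphism (cball 0 1) (h ` cball 0 1) h k"
    using embedded_disc_inverse[OF h(1)] .
  have kh: "k (h w) = w" if "w \<in> cball 0 1" for w using k that unfolding homeomorphism_def by blast
  have contk: "continuous_on (h ` cball 0 1) k" and conth: "continuous_on (cball 0 1) h"
    using k unfolding homeomorphism_def by auto
  have hS: "h ` cball 0 1 \<subseteq> S" using h(1) unfolding embedded_disc_def by blast
  have "finite ((norm \<circ> k) ` K)" using K by simp
  moreover have "infinite {1/2<..<1::real}" by simp
  \<comment> \<open>A radius is chosen for which the boundary circle avoids the finitely many other punctures.\<close>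
  ultimately obtain r where r: "r \<in> {1/2<..<1}" "r \<notin> (norm \<circ> k) ` K"
    by (meson finite_subset subsetI)
  have rsub: "cball 0 r \<subseteq> (cball 0 1 :: complex set)" "sphere 0 r \<subseteq> (cball 0 1 :: complex set)"
     "ball 0 r \<subseteq> (ball 0 1 :: complex set)" "ball 0 r \<subseteq> (cball 0 1 :: complex set)" "sphere 0 r \<subseteq> (cball 0 r :: complex set)"
    using r(1) by auto
  have vw: "v \<in> ball 0 r" "w \<in> ball 0 r" "w \<in> cball 0 1" "v \<in> cball 0 1" using pq r(1) by auto
  have "sphere 0 r retract_of (- {w})" using sphere_retract_of_punctured_universe_gen[OF vw(2)] .
  then obtain \<rho> where \<rho>: "continuous_on (- {w}) \<rho>" "\<rho> ` (- {w}) \<subseteq> sphere 0 r" "\<And>z. z \<in> sphere 0 r \<Longrightarrow> \<rho> z = z"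
    unfolding retract_of_def retraction_def by blast
  have sphK: "h z \<notin> insert (h v) K" if "z \<in> sphere 0 r" for z
  proof -
    have "z \<in> cball 0 1" using that rsub by blast
    then have "norm (k (h z)) = r" using kh that by simp
    then have "h z \<notin> K" using r(2) by auto
    moreover have "h z \<noteq> h v"
    proof
      assume "h z = h v"
      then have "z = v" using kh[OF \<open>z \<in> cball 0 1\<close>] kh[OF vw(4)] by metis
      then show False using vw(1) that by simp
    qed
    ultimately show ?thesis by simp
  qed
  define D where "D = h ` cball 0 r"
  define g' where "g' = (\<lambda>x. if x \<in> D then g (h (\<rho> (k x))) else g x)"
  have Dc: "compact D" unfolding D_def
    by (rule compact_continuous_image[OF continuous_on_subset[OF conth]]) (use rsub in auto)
  have kD: "k x \<in> cball 0 r" "k x \<in> - {w}" if "x \<in> D - {h w}" for x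
    using that kh rsub unfolding D_def by (auto simp: subset_iff)
  have im: "h (\<rho> (k x)) \<in> S - insert (h v) K" if "x \<in> D - {h w}" for x
  proof -
    have z: "\<rho> (k x) \<in> sphere 0 r" using kD(2)[OF that] \<rho>(2) by blast
    then have "h (\<rho> (k x)) \<in> S" using hS rsub(2) by blast
    then show ?thesis using sphK[OF z] by blast
  qed
  have contD: "continuous_on (D - {h w}) (\<lambda>x. g (h (\<rho> (k x))))"
  proof -
    have "continuous_on (D - {h w}) k"
      by (rule continuous_on_subset[OF contk]) (use rsub in \<open>auto simp: D_def\<close>)
    then have "continuous_on (D - {h w}) (\<lambda>x. \<rho> (k x))"
      by (rule continuous_on_compose2[OF \<rho>(1)]) (use kD in auto)
    then have "continuous_on (D - {h w}) (\<lambda>x. h (\<rho> (k x)))"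
      by (rule continuous_on_compose2[OF conth]) (use kD(2) \<rho>(2) rsub(2) in blast)
    then show ?thesis by (rule continuous_on_compose2[OF g(1)]) (rule image_subsetI, rule im)
  qed
  define E where "E = S - h ` ball 0 r - K"
  have opb: "openin (top_of_set S) (h ` ball 0 r)" using embedded_disc_open_image[OF h(1) _ rsub(3)] by simp
  have uni: "S - insert (h w) K = (D - insert (h w) K) \<union> E"
    unfolding D_def E_def using hS rsub vw by (auto simp: image_subset_iff subset_iff less_imp_le)
  have g'E: "g' x = g x" if "x \<in> E" for x
  proof (cases "x \<in> D")
    case True
    then obtain z where z: "z \<in> cball 0 r" "x = h z" unfolding D_def by blast
    then have "z \<in> sphere 0 r" using that unfolding E_def by (auto simp: image_iff)
    then have "\<rho> z = z" by (rule \<rho>(3))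
    moreover have "k (h z) = z" using z(1) rsub(1) by (intro kh) blast
    ultimately show ?thesis using True z(2) unfolding g'_def by simp
  qed (simp add: g'_def)
  have Esub: "E \<subseteq> S - insert (h v) K" unfolding E_def using vw by blast
  have "continuous_on ((D - insert (h w) K) \<union> E) g'"
  proof (rule continuous_on_Un_local)
    show "closedin (top_of_set (D - insert (h w) K \<union> E)) (D - insert (h w) K)"
      unfolding closedin_closed
      by (rule exI[of _ D]) (use Dc compact_imp_closed in \<open>auto simp: E_def\<close>, use vw in blast)
    have "closedin (top_of_set S) (S - h ` ball 0 r)" using opb by (intro closedin_diff) auto
    then obtain T where T: "closed T" "S - h ` ball 0 r = S \<inter> T" by (auto simp: closedin_closed)
    have "E = (D - insert (h w) K \<union> E) \<inter> T"
    proof -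
      have "E = (S - insert (h w) K) \<inter> T" using T(2) vw unfolding E_def by blast
      then show ?thesis using uni by simp
    qed
    then show "closedin (top_of_set (D - insert (h w) K \<union> E)) E"
      unfolding closedin_closed using T(1) by blast
    show "continuous_on (D - insert (h w) K) g'"
      by (rule continuous_on_eq[OF continuous_on_subset[OF contD]]) (auto simp: g'_def)
    show "continuous_on E g'"
      by (rule continuous_on_eq[OF continuous_on_subset[OF g(1) Esub]]) (use g'E in auto)
  qed
  moreover have "g' ` (S - insert (h w) K) \<subseteq> sphere 0 1"
  proof (rule image_subsetI)
    fix x assume x: "x \<in> S - insert (h w) K"
    show "g' x \<in> sphere 0 1"
    proof (cases "x \<in> D")
      case True
      then show ?thesis using im[of x] x g(2) unfolding g'_def by auto
    next
      case False
      then have "x \<in> E" using uni x by blast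
      then show ?thesis using g'E[of x] subsetD[OF g(2) imageI, of x] Esub by auto
    qed
  qed
  moreover have "\<forall>x\<in>X - K. g' x = g x"
  proof
    fix x assume "x \<in> X - K"
    then have "x \<notin> D" using h(2) rsub(1) unfolding D_def by blast
    then show "g' x = g x" by (simp add: g'_def)
  qed
  ultimately show "\<exists>g'. continuous_on (S - insert (h w) K) g' \<and> g' ` (S - insert (h w) K) \<subseteq> sphere 0 1 \<and>
        (\<forall>x\<in>X - K. g' x = g x)"
    using uni by metis
qed

lemma moves_puncture_connected:
  assumes S: "locally_disc S" and X: "closedin (top_of_set S) X"
    and C: "connected C" "C \<subseteq> S - X" "p \<in> C" "q \<in> C"
  shows "moves_puncture S X p q"
proof -
  have trans: "moves_puncture S X x z" if mv: "moves_puncture S X x y" "moves_puncture S X y z" for x y z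
    unfolding moves_puncture_def
  proof (intro allI impI)
    fix K g assume g: "finite K \<and> continuous_on (S - insert x K) g \<and> g ` (S - insert x K) \<subseteq> sphere (0::complex) 1"
    obtain g' where g': "continuous_on (S - insert y K) g'" "g' ` (S - insert y K) \<subseteq> sphere 0 1"
        "\<And>x. x \<in> X - K \<Longrightarrow> g' x = g x"
      by (rule moves_punctureE[OF mv(1), of K g]) (use g in auto)
    obtain g'' where g'': "continuous_on (S - insert z K) g''" "g'' ` (S - insert z K) \<subseteq> sphere 0 1"
        "\<And>x. x \<in> X - K \<Longrightarrow> g'' x = g' x"
      by (rule moves_punctureE[OF mv(2), of K g']) (use g g' in auto)
    then show "\<exists>g'. continuous_on (S - insert z K) g' \<and> g' ` (S - insert z K) \<subseteq> sphere 0 1 \<and> (\<forall>x\<in>X - K. g' x = g x)"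
      using g'(3) by (intro exI[of _ g'']) auto
  qed
  have "moves_puncture S X p q \<and> moves_puncture S X q p"
  proof (rule connected_equivalence_relation[OF C(1) C(3,4), of "\<lambda>p q. moves_puncture S X p q \<and> moves_puncture S X q p"])
    fix a assume a: "a \<in> C"
    have "openin (top_of_set S) (S - X)" using X by (intro openin_diff) auto
    then obtain h where h: "embedded_disc S h" "h 0 = a" "h ` cball 0 1 \<subseteq> S - X"
      using locally_discE[OF S] a C(2) by (metis subsetD)
    have "openin (top_of_set S) (h ` ball 0 (1/2))"
      by (rule embedded_disc_open_image[OF h(1)]) auto
    then obtain T where "open T" "h ` ball 0 (1/2) = S \<inter> T" by (auto simp: openin_open)
    then have "openin (top_of_set C) (C \<inter> h ` ball 0 (1/2))"
      using C(2) unfolding openin_open by (intro exI[of _ T]) blast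
    moreover have "a \<in> h ` ball 0 (1/2)" using h(2) by force
    moreover have "moves_puncture S X a x \<and> moves_puncture S X x a" if x: "x \<in> h ` ball 0 (1/2)" for x
    proof -
      obtain w where w: "w \<in> ball 0 (1/2)" "x = h w" using x by blast
      have "h ` cball 0 1 \<inter> X = {}" using h(3) by blast
      then show ?thesis using moves_puncture_in_disc[OF h(1) _ w(1), of X 0] moves_puncture_in_disc[OF h(1) _ _ w(1), of X 0]
        unfolding w(2) h(2) by simp
    qed
    ultimately show "\<exists>T. openin (top_of_set C) T \<and> a \<in> T \<and> (\<forall>x\<in>T. moves_puncture S X a x \<and> moves_puncture S X x a)"
      using a by blast
  qed (use trans in blast)+
  then show ?thesis by blast
qed

text \<open>All punctures of one face can be merged into a chosen point of this face.\<close>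

lemma punctures_into_transversal:
  assumes S: "locally_disc S" and X: "closedin (top_of_set S) X"
    and L: "\<And>C. C \<in> components (S - X) \<Longrightarrow> C \<inter> L \<noteq> {}"
    and "finite K" "K \<subseteq> S - X" "continuous_on (S - K) g" "g ` (S - K) \<subseteq> sphere (0::complex) 1"
  shows "\<exists>K' g'. K' \<subseteq> L \<inter> (S - X) \<and> finite K' \<and> continuous_on (S - K') g' \<and> g' ` (S - K') \<subseteq> sphere (0::complex) 1 \<and> (\<forall>x\<in>X. g' x = g x)"
  using assms(4-)
proof (induction "card (K - L)" arbitrary: K g rule: less_induct)
  case less
  show ?case
  proof (cases "K \<subseteq> L")
    case True then show ?thesis using less.prems by (intro exI[of _ K] exI[of _ g]) auto
  next
    case False
    then obtain p where p: "p \<in> K" "p \<notin> L" by blast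
    have "p \<in> S - X" using p less.prems by blast
    then obtain C where C: "C \<in> components (S - X)" "p \<in> C"
      by (metis componentsI connected_component_refl mem_Collect_eq)
    then obtain q where q: "q \<in> C" "q \<in> L" using L by blast
    have Csub: "C \<subseteq> S - X" "connected C" using C(1) in_components_subset in_components_connected by auto
    have mv: "moves_puncture S X p q"
      using moves_puncture_connected[OF S X Csub(2,1) C(2) q(1)] .
    have Kp: "insert p (K - {p}) = K" using p by blast
    obtain g' where g': "continuous_on (S - insert q (K - {p})) g'" "g' ` (S - insert q (K - {p})) \<subseteq> sphere 0 1"
        "\<And>x. x \<in> X - (K - {p}) \<Longrightarrow> g' x = g x"
      by (rule moves_punctureE[OF mv, of "K - {p}" g]) (use less.prems Kp in auto)
    have "card (insert q (K - {p}) - L) < card (K - L)"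
      using p q less.prems(1) by (intro psubset_card_mono) auto
    from less.hyps[OF this _ _ g'(1,2)]
    obtain K' g'' where "K' \<subseteq> L \<inter> (S - X)" "finite K'" "continuous_on (S - K') g''" "g'' ` (S - K') \<subseteq> sphere (0::complex) 1" "\<forall>x\<in>X. g'' x = g' x"
      using less.prems(1,2) q(1) Csub by blast
    moreover have "X \<inter> K = {}" using less.prems(2) by blast
    ultimately show ?thesis using g'(3) by (intro exI[of _ K'] exI[of _ g'']) (auto simp: disjoint_iff)
  qed
qed

section \<open>Straightening the edges and counting faces from above\<close>

text \<open>The line through two points of the unit circle meets the open disc exactly in the open chord.\<close>

lemma chord_inside_ball:
  fixes z1 z2 w :: complex
  assumes "norm z1 = 1" "norm z2 = 1" "z1 \<noteq> z2"
  shows "w \<in> ball 0 1 \<and> Im ((w - z1) * cnj (z2 - z1)) = 0 \<longleftrightarrow> w \<in> open_segment z1 z2"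
proof
  assume w: "w \<in> ball 0 1 \<and> Im ((w - z1) * cnj (z2 - z1)) = 0"
  define l where "l = Re ((w - z1) * cnj (z2 - z1)) / (norm (z2 - z1))\<^sup>2"
  have "(w - z1) * cnj (z2 - z1) = of_real (Re ((w - z1) * cnj (z2 - z1)))"
    using w by (simp add: complex_eq_iff)
  then have "(w - z1) * (cnj (z2 - z1) * (z2 - z1)) = of_real (Re ((w - z1) * cnj (z2 - z1))) * (z2 - z1)"
    by (metis mult.assoc)
  moreover have "cnj (z2 - z1) * (z2 - z1) = of_real ((norm (z2 - z1))\<^sup>2)"
    by (metis complex_norm_square mult.commute of_real_power)
  moreover have nz: "(norm (z2 - z1))\<^sup>2 \<noteq> 0" using assms(3) by simp
  ultimately have wl: "w = z1 + of_real l * (z2 - z1)"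
    unfolding l_def by (simp add: field_simps del: of_real_power complex_cnj_diff)
  have nw: "norm w < 1" using w by simp
  have "0 < l"
  proof (rule ccontr)
    assume "\<not> 0 < l"
    then have l: "l \<le> 0" by simp
    have "of_real (1 - l) * z1 = w - of_real l * z2" using wl by (simp add: algebra_simps)
    then have "norm (of_real (1 - l) * z1) \<le> norm w + norm (of_real l * z2)" by (metis norm_triangle_ineq4)
    then have "1 - l \<le> norm w - l" using l assms(1,2) by (simp add: norm_mult del: of_real_diff)
    then show False using nw by simp
  qed
  moreover have "l < 1"
  proof (rule ccontr)
    assume "\<not> l < 1"
    then have l: "l \<ge> 1" by simp
    have "of_real l * z2 = w + of_real (l - 1) * z1" using wl by (simp add: algebra_simps)
    then have "norm (of_real l * z2) \<le> norm w + norm (of_real (l - 1) * z1)" by (metis norm_triangle_ineq)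
    then have "l \<le> norm w + (l - 1)" using l assms(1,2) by (simp add: norm_mult del: of_real_diff)
    then show False using nw by simp
  qed
  ultimately show "w \<in> open_segment z1 z2"
    using assms(3) wl unfolding in_segment by (auto simp: scaleR_conv_of_real algebra_simps intro!: exI[of _ l])
next
  assume w: "w \<in> open_segment z1 z2"
  then obtain u where u: "0 < u" "u < 1" "w = (1 - u) *\<^sub>R z1 + u *\<^sub>R z2" unfolding in_segment by blast
  have "dist w 0 < 1"
    using dist_decreases_open_segment[OF w, of 0] assms(1,2) by (auto simp: dist_commute)
  moreover have "w - z1 = of_real u * (z2 - z1)" using u(3) by (simp add: scaleR_conv_of_real algebra_simps)
  then have "(w - z1) * cnj (z2 - z1) = of_real u * ((z2 - z1) * cnj (z2 - z1))" by (simp only: mult.assoc)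
  then have "Im ((w - z1) * cnj (z2 - z1)) = 0"
    by (simp only: complex_norm_square[symmetric] of_real_mult[symmetric] of_real_power[symmetric] Im_complex_of_real)
  ultimately show "w \<in> ball 0 1 \<and> Im ((w - z1) * cnj (z2 - z1)) = 0" by simp
qed

text \<open>Between its first and its last visit to the disc the arc is replaced by a straight chord in the coordinates of the
disc.  The chord has two convex sides.\<close>

lemma straighten_arc:
  fixes S :: "'a::real_normed_vector set"
  assumes c: "arc c" "path_image c \<subseteq> S" and h: "embedded_disc S h" "h 0 = c (1/2)"
    and ends: "pathstart c \<notin> h ` cball 0 1" "pathfinish c \<notin> h ` cball 0 1"
  obtains c' s t where "arc c'" "pathstart c' = pathstart c" "pathfinish c' = pathfinish c"
    "path_image c' \<subseteq> path_image c \<union> h ` cball 0 1" "0 < s" "s < t" "t < 1"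
    "h ` ball 0 1 \<inter> path_image c' = c' ` {s<..<t}"
    "\<exists>H1 H2. connected H1 \<and> connected H2 \<and> h ` ball 0 1 - c' ` {s<..<t} = H1 \<union> H2"
proof -
  obtain k where k: "homeomorphism (cball 0 1) (h ` cball 0 1) h k"
    using embedded_disc_inverse[OF h(1)] .
  have conth: "continuous_on (cball 0 1) h" using k unfolding homeomorphism_def by auto
  have injh: "inj_on h (cball 0 1)" using h(1) unfolding embedded_disc_def by blast
  have contc: "continuous_on {0..1} c" and injc: "inj_on c {0..1}"
    using c(1) by (auto simp: arc_def path_def)
  let ?F = "h ` cball 0 1"
  have cF: "compact ?F" by (rule compact_continuous_image[OF conth]) simp
  \<comment> \<open>The times at which the arc visits the disc; \<open>a\<close> and \<open>b\<close> below are the first and the last of them.\<close>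
  define A where "A = {x \<in> {0..1}. c x \<in> ?F}"
  have "closedin (top_of_set {0..1}) ({0..1} \<inter> c -` ?F)"
    by (rule continuous_closedin_preimage[OF contc compact_imp_closed[OF cF]])
  moreover have "A = {0..1} \<inter> c -` ?F" by (auto simp: A_def)
  ultimately have "closed A" using closedin_closed_trans[OF _ closed_atLeastAtMost] by metis
  then have cA: "compact A" unfolding compact_eq_bounded_closed A_def
    by (auto intro: bounded_subset[OF bounded_closed_interval, of _ 0 1])
  have h0: "c (1/2) \<in> h ` ball 0 1" unfolding h(2)[symmetric] by (rule imageI) simp
  then have half: "1/2 \<in> A" using image_mono[OF ball_subset_cball] unfolding A_def by auto
  obtain a where a: "a \<in> A" "\<And>x. x \<in> A \<Longrightarrow> a \<le> x" using compact_attains_inf[OF cA] half by blast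
  obtain b where b: "b \<in> A" "\<And>x. x \<in> A \<Longrightarrow> x \<le> b" using compact_attains_sup[OF cA] half by blast
  have ab: "0 < a" "b < 1"
  proof -
    have "a \<noteq> 0" "b \<noteq> 1" using a(1) b(1) ends unfolding A_def pathstart_def pathfinish_def by auto
    then show "0 < a" "b < 1" using a(1) b(1) unfolding A_def by auto
  qed
  have "openin (top_of_set S) (h ` ball 0 1)" using h(1) unfolding embedded_disc_def by blast
  then have "openin (top_of_set {0..1}) ({0..1} \<inter> c -` (h ` ball 0 1))"
    using contc c(2) by (intro continuous_openin_preimage) (auto simp: path_image_def)
  then obtain V where V: "open V" "{0..1} \<inter> c -` (h ` ball 0 1) = {0..1} \<inter> V"
    by (auto simp: openin_open)
  have inner: "\<exists>x y. x \<in> A \<and> y \<in> A \<and> x < r \<and> r < y" if r: "r \<in> {0<..<1}" "c r \<in> h ` ball 0 1" for r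
  proof -
    have "r \<in> {0..1} \<inter> c -` (h ` ball 0 1)" using r by auto
    then have "r \<in> V" unfolding V(2) by blast
    then have "r \<in> V \<inter> {0<..<1}" using r(1) by blast
    moreover have "open (V \<inter> {0<..<1})" using V(1) by auto
    ultimately obtain e where e: "0 < e" "cball r e \<subseteq> V \<inter> {0<..<1}"
      using open_contains_cball by metis
    have "cball r e \<subseteq> A"
    proof
      fix x assume "x \<in> cball r e"
      then have "x \<in> V \<inter> {0<..<1}" using e(2) by blast
      then have x: "x \<in> {0..1} \<inter> V" by auto
      then have "c x \<in> h ` ball 0 1" unfolding V(2)[symmetric] by blast
      then have "c x \<in> ?F" using ball_subset_cball by blast
      then show "x \<in> A" using x unfolding A_def by blast
    qed
    moreover have "r - e \<in> cball r e" "r + e \<in> cball r e" using e(1) by (auto simp: dist_norm)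
    ultimately have "r - e \<in> A" "r + e \<in> A" "r - e < r" "r < r + e" using e(1) by auto
    then show ?thesis by blast
  qed
  have "a < 1/2" "1/2 < b" using inner[of "1/2"] h0 a(2) b(2) by fastforce+
  then have aab: "a < b" by simp
  have a01: "a \<in> {0..1}" "b \<in> {0..1}" "a \<in> {0<..<1}" "b \<in> {0<..<1}" using ab aab by auto
  have nob: "c a \<notin> h ` ball 0 1" "c b \<notin> h ` ball 0 1"
    using inner[of a] inner[of b] a(2) b(2) a01 by fastforce+
  obtain z1 where z1: "z1 \<in> cball 0 1" "c a = h z1" using a(1) unfolding A_def by blast
  obtain z2 where z2: "z2 \<in> cball 0 1" "c b = h z2" using b(1) unfolding A_def by blast
  have "z1 \<notin> ball 0 1" "z2 \<notin> ball 0 1" using nob z1(2) z2(2) by auto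
  then have nz: "norm z1 = 1" "norm z2 = 1" using z1(1) z2(1) by auto
  have "c a \<noteq> c b" using injc a01 aab by (auto dest: inj_onD)
  then have z12: "z1 \<noteq> z2" using z1 z2 by auto
  have seg: "closed_segment z1 z2 \<subseteq> cball 0 1" using z1 z2 by (intro closed_segment_subset) auto
  have oseg: "open_segment z1 z2 \<subseteq> ball 0 1" using chord_inside_ball[OF nz z12] by blast
  define L where "L = h \<circ> linepath z1 z2"
  have imL: "path_image L = h ` closed_segment z1 z2" unfolding L_def by (simp add: path_image_compose)
  have arcL: "arc L"
    unfolding arc_def
  proof
    show "path L" unfolding L_def
      by (intro path_continuous_image continuous_on_subset[OF conth]) (use seg in auto)
    have "inj_on (linepath z1 z2) {0..1}" using arc_linepath[OF z12] by (simp add: arc_def)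
    then show "inj_on L {0..1}" unfolding L_def
      by (rule comp_inj_on) (rule inj_on_subset[OF injh], use seg in \<open>auto simp: linepath_image_01\<close>)
  qed
  define c1 where "c1 = subpath 0 a c"
  define c2 where "c2 = subpath b 1 c"
  have im1: "path_image c1 = c ` {0..a}" unfolding c1_def using ab by (simp add: path_image_subpath)
  have im2: "path_image c2 = c ` {b..1}" unfolding c2_def using ab by (simp add: path_image_subpath)
  have arc1: "arc c1" "arc c2" unfolding c1_def c2_def using arc_subpath_arc[OF c(1)] ab a01 by auto
  have F1: "c x \<notin> ?F" if "x \<in> {0..<a}" for x using a(2)[of x] that ab a01 unfolding A_def by force
  have F2: "c x \<notin> ?F" if "x \<in> {b<..1}" for x using b(2)[of x] that ab a01 unfolding A_def by force
  have LF: "path_image L \<subseteq> ?F" using imL seg by auto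
  have arc2: "arc (L +++ c2)"
  proof (rule arc_join[OF arcL arc1(2)])
    show "pathfinish L = pathstart c2" using z2 by (simp add: L_def c2_def pathfinish_compose)
    show "path_image L \<inter> path_image c2 \<subseteq> {pathstart c2}"
    proof
      fix x assume x: "x \<in> path_image L \<inter> path_image c2"
      then obtain u where u: "u \<in> {b..1}" "x = c u" unfolding im2 by blast
      then have "u = b" using F2[of u] x LF by force
      then show "x \<in> {pathstart c2}" using u by (simp add: c2_def)
    qed
  qed
  have im3: "path_image (L +++ c2) = path_image L \<union> path_image c2"
    using z2 by (intro path_image_join) (simp add: L_def c2_def pathfinish_compose)
  define c' where "c' = c1 +++ (L +++ c2)"
  have arc': "arc c'" unfolding c'_def
  proof (rule arc_join[OF arc1(1) arc2])
    show "pathfinish c1 = pathstart (L +++ c2)" using z1 by (simp add: L_def c1_def pathstart_compose)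
    show "path_image c1 \<inter> path_image (L +++ c2) \<subseteq> {pathstart (L +++ c2)}"
    proof
      fix x assume x: "x \<in> path_image c1 \<inter> path_image (L +++ c2)"
      then obtain u where u: "u \<in> {0..a}" "x = c u" unfolding im1 by blast
      have "u = a"
      proof (cases "x \<in> path_image L")
        case True
        then show ?thesis using F1[of u] u LF by force
      next
        case False
        then obtain v where v: "v \<in> {b..1}" "x = c v" using x unfolding im3 im2 by blast
        then have "u = v" using injc u a01 by (auto dest!: inj_onD)
        then show ?thesis using u v aab by auto
      qed
      then show "x \<in> {pathstart (L +++ c2)}" using u z1 by (simp add: L_def pathstart_compose)
    qed
  qed
  have im': "path_image c' = c ` {0..a} \<union> h ` closed_segment z1 z2 \<union> c ` {b..1}"
  proof -
    have "path_image c' = path_image c1 \<union> path_image (L +++ c2)" unfolding c'_def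
      using z1 by (intro path_image_join) (simp add: L_def c1_def pathstart_compose)
    then show ?thesis unfolding im3 im1 im2 imL by blast
  qed
  have mid: "c' ` {1/2<..<3/4} = h ` open_segment z1 z2"
  proof -
    have "c' x = h (linepath z1 z2 (4 * x - 2))" if "x \<in> {1/2<..<3/4}" for x
      using that by (auto simp: c'_def joinpaths_def L_def)
    then have "c' ` {1/2<..<3/4} = (\<lambda>x. h (linepath z1 z2 (4 * x - 2))) ` {1/2<..<3/4}" by (rule image_cong[OF refl])
    also have "\<dots> = h ` linepath z1 z2 ` ((\<lambda>x. 4 * x - 2) ` {1/2<..<3/4})" by (simp add: image_image)
    also have "(\<lambda>x. 4 * x - 2) ` {1/2<..<3/4} = {0<..<1::real}"
    proof
      show "{0<..<1::real} \<subseteq> (\<lambda>x. 4 * x - 2) ` {1/2<..<3/4}"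
      proof
        fix y :: real assume "y \<in> {0<..<1}"
        then show "y \<in> (\<lambda>x. 4 * x - 2) ` {1/2<..<3/4}" by (intro image_eqI[of _ _ "(y + 2)/4"]) (auto simp: field_simps)
      qed
    qed auto
    also have "linepath z1 z2 ` {0<..<1} = open_segment z1 z2"
      using z12 by (auto simp: in_segment linepath_def)
    finally show ?thesis .
  qed
  have meet: "h ` ball 0 1 \<inter> path_image c' = c' ` {1/2<..<3/4}"
    unfolding mid
  proof
    show "h ` open_segment z1 z2 \<subseteq> h ` ball 0 1 \<inter> path_image c'"
      using oseg open_closed_segment unfolding im' by blast
    show "h ` ball 0 1 \<inter> path_image c' \<subseteq> h ` open_segment z1 z2"
    proof
      fix x assume x: "x \<in> h ` ball 0 1 \<inter> path_image c'"
      then have xF: "x \<in> ?F" using ball_subset_cball by blast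
      have "x \<notin> c ` {0..a}"
      proof
        assume "x \<in> c ` {0..a}"
        then obtain u where u: "u \<in> {0..a}" "x = c u" by blast
        then have "u = a" using F1[of u] xF by force
        then show False using nob x u by simp
      qed
      moreover have "x \<notin> c ` {b..1}"
      proof
        assume "x \<in> c ` {b..1}"
        then obtain u where u: "u \<in> {b..1}" "x = c u" by blast
        then have "u = b" using F2[of u] xF by force
        then show False using nob x u by simp
      qed
      ultimately obtain w where w: "w \<in> closed_segment z1 z2" "x = h w" using x unfolding im' by blast
      have "w \<noteq> z1" "w \<noteq> z2" using nob x w z1 z2 by auto
      then have "w \<in> open_segment z1 z2" using w(1) by (simp add: open_segment_def)
      then show "x \<in> h ` open_segment z1 z2" using w(2) by blast
    qed
  qed
  define P where "P = {w \<in> ball 0 1. Im ((w - z1) * cnj (z2 - z1)) > 0}"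
  define N where "N = {w \<in> ball 0 1. Im ((w - z1) * cnj (z2 - z1)) < 0}"
  have lin: "Im (((u *\<^sub>R x + v *\<^sub>R y) - z1) * cnj (z2 - z1)) =
      u * Im ((x - z1) * cnj (z2 - z1)) + v * Im ((y - z1) * cnj (z2 - z1))" if "u + v = 1" for u v :: real and x y
  proof -
    have "u *\<^sub>R x + v *\<^sub>R y - z1 = u *\<^sub>R (x - z1) + v *\<^sub>R (y - z1)"
      using that by (simp add: algebra_simps flip: scaleR_add_left)
    then have "(u *\<^sub>R x + v *\<^sub>R y - z1) * cnj (z2 - z1) = u *\<^sub>R ((x - z1) * cnj (z2 - z1)) + v *\<^sub>R ((y - z1) * cnj (z2 - z1))"
      by (simp only: distrib_right mult_scaleR_left)
    then show ?thesis by simp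
  qed
  have cb: "u *\<^sub>R x + v *\<^sub>R y \<in> ball 0 1" if "x \<in> ball 0 1" "y \<in> ball 0 1" "0 \<le> u" "0 \<le> v" "u + v = 1" for u v :: real and x y :: complex
    using convexD[OF convex_ball that] .
  have "convex P"
    unfolding convex_def P_def
  proof (intro ballI allI impI)
    fix x y :: complex and u v :: real
    assume xy: "x \<in> {w \<in> ball 0 1. Im ((w - z1) * cnj (z2 - z1)) > 0}" "y \<in> {w \<in> ball 0 1. Im ((w - z1) * cnj (z2 - z1)) > 0}"
      and uv: "0 \<le> u" "0 \<le> v" "u + v = 1"
    have "0 < u * Im ((x - z1) * cnj (z2 - z1)) + v * Im ((y - z1) * cnj (z2 - z1))"
    proof (cases "u = 0")
      case True then show ?thesis using xy uv by auto
    next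
      case False
      then show ?thesis using xy uv by (intro add_pos_nonneg mult_pos_pos mult_nonneg_nonneg) auto
    qed
    then show "u *\<^sub>R x + v *\<^sub>R y \<in> {w \<in> ball 0 1. Im ((w - z1) * cnj (z2 - z1)) > 0}"
      using lin[OF uv(3)] cb[OF _ _ uv] xy by (simp only: mem_Collect_eq)
  qed
  moreover have "convex N"
    unfolding convex_def N_def
  proof (intro ballI allI impI)
    fix x y :: complex and u v :: real
    assume xy: "x \<in> {w \<in> ball 0 1. Im ((w - z1) * cnj (z2 - z1)) < 0}" "y \<in> {w \<in> ball 0 1. Im ((w - z1) * cnj (z2 - z1)) < 0}"
      and uv: "0 \<le> u" "0 \<le> v" "u + v = 1"
    have "u * Im ((x - z1) * cnj (z2 - z1)) + v * Im ((y - z1) * cnj (z2 - z1)) < 0"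
    proof (cases "u = 0")
      case True then show ?thesis using xy uv by auto
    next
      case False
      then show ?thesis using xy uv by (intro add_neg_nonpos mult_pos_neg mult_nonneg_nonpos) auto
    qed
    then show "u *\<^sub>R x + v *\<^sub>R y \<in> {w \<in> ball 0 1. Im ((w - z1) * cnj (z2 - z1)) < 0}"
      using lin[OF uv(3)] cb[OF _ _ uv] xy by (simp only: mem_Collect_eq)
  qed
  moreover have "P \<subseteq> cball 0 1" "N \<subseteq> cball 0 1" unfolding P_def N_def using ball_subset_cball by blast+
  ultimately have conn: "connected (h ` P)" "connected (h ` N)"
    by (meson connected_continuous_image convex_connected continuous_on_subset[OF conth])+
  have "h ` ball 0 1 - h ` open_segment z1 z2 = h ` (ball 0 1 - open_segment z1 z2)"
  proof (rule inj_on_image_set_diff[OF injh, symmetric])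
    show "ball 0 1 - open_segment z1 z2 \<subseteq> cball 0 1"
      by (rule subset_trans[OF Diff_subset ball_subset_cball])
    show "open_segment z1 z2 \<subseteq> cball 0 1" by (rule subset_trans[OF oseg ball_subset_cball])
  qed
  also have "ball 0 1 - open_segment z1 z2 = P \<union> N"
  proof (rule Set.set_eqI)
    fix w
    define g where "g = Im ((w - z1) * cnj (z2 - z1))"
    have "w \<in> open_segment z1 z2 \<longleftrightarrow> w \<in> ball 0 1 \<and> g = 0"
      using chord_inside_ball[OF nz z12, of w] unfolding g_def by blast
    moreover have "w \<in> P \<longleftrightarrow> w \<in> ball 0 1 \<and> g > 0" "w \<in> N \<longleftrightarrow> w \<in> ball 0 1 \<and> g < 0"
      unfolding P_def N_def g_def by blast+
    moreover have "g < 0 \<or> g = 0 \<or> g > 0" by linarith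
    ultimately show "w \<in> ball 0 1 - open_segment z1 z2 \<longleftrightarrow> w \<in> P \<union> N" by force
  qed
  finally have split: "h ` ball 0 1 - c' ` {1/2<..<3/4} = h ` P \<union> h ` N" unfolding mid by (simp add: image_Un)
  have "path_image c' \<subseteq> path_image c \<union> ?F"
  proof -
    have "c ` {0..a} \<subseteq> path_image c" "c ` {b..1} \<subseteq> path_image c"
      unfolding path_image_def using a01 by (auto intro!: image_mono)
    moreover have "h ` closed_segment z1 z2 \<subseteq> ?F" by (rule image_mono[OF seg])
    ultimately show ?thesis unfolding im' by blast
  qed
  moreover have "pathstart c' = pathstart c" "pathfinish c' = pathfinish c"
    by (simp_all add: c'_def c1_def c2_def pathstart_def[of c] pathfinish_def[of c])
  moreover have "\<exists>H1 H2. connected H1 \<and> connected H2 \<and> h ` ball 0 1 - c' ` {1/2<..<3/4} = H1 \<union> H2"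
    using conn split by blast
  ultimately show ?thesis using that[of c' "1/2" "3/4"] arc' meet by simp
qed

definition drawn_set :: "'v sgraph \<Rightarrow> ('v set \<Rightarrow> real \<Rightarrow> 'p::topological_space) \<Rightarrow> 'p set" where
  "drawn_set G curve = (\<Union>e\<in>edges G. path_image (curve e))"

text \<open>Every edge has a neighbourhood of an inner part in which nothing else is drawn and whose rest is the union of
two connected sets, the sides of the edge.\<close>

definition straight_drawing ::
    "'p::real_normed_vector set \<Rightarrow> 'v sgraph \<Rightarrow> ('v set \<Rightarrow> real \<Rightarrow> 'p) \<Rightarrow> bool" where
  "straight_drawing S G curve \<longleftrightarrow> (\<forall>e\<in>edges G. \<exists>s t U H1 H2.
     0 < s \<and> s < t \<and> t < 1 \<and> openin (top_of_set S) U \<and> U \<inter> drawn_set G curve = curve e ` {s<..<t} \<and>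
     connected H1 \<and> connected H2 \<and> U - drawn_set G curve = H1 \<union> H2)"

text \<open>Around the midpoints of the edges there are disjoint discs that meet no vertex and no other edge; straightening
inside them does not create intersections.\<close>

lemma straight_drawing_exists:
  fixes S :: "'p::real_normed_vector set"
  assumes S: "locally_disc S" and dr: "drawing_on S G pos curve"
    and fin: "finite (verts G)" "finite (edges G)"
  obtains curve' where "drawing_on S G pos curve'" "straight_drawing S G curve'"
proof -
  have arcs: "arc (curve e)" "path_image (curve e) \<subseteq> S" "{pathstart (curve e), pathfinish (curve e)} = pos ` e"
    "path_image (curve e) \<inter> pos ` verts G = pos ` e" if "e \<in> edges G" for e
    using dr that unfolding drawing_on_def by auto
  have meet: "path_image (curve e) \<inter> path_image (curve f) = pos ` (e \<inter> f)"
    if "e \<in> edges G" "f \<in> edges G" "e \<noteq> f" for e f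
    using dr that unfolding drawing_on_def by auto
  define x where "x = (\<lambda>e. curve e (1/2))"
  have xe: "x e \<in> path_image (curve e)" for e unfolding x_def path_image_def by auto
  have xV: "x e \<notin> pos ` verts G" if e: "e \<in> edges G" for e
  proof
    assume "x e \<in> pos ` verts G"
    then have "x e \<in> {pathstart (curve e), pathfinish (curve e)}" using xe arcs[OF e] by blast
    moreover have "inj_on (curve e) {0..1}" using arcs(1)[OF e] by (simp add: arc_def)
    ultimately show False unfolding x_def pathstart_def pathfinish_def
      by (auto dest: inj_onD[of _ _ "1/2"])
  qed
  have ev: "pos ` (e \<inter> f) \<subseteq> pos ` verts G" if "e \<in> edges G" for e f
    using arcs(4)[OF that] by blast
  have xf: "x e \<notin> path_image (curve f)" if "e \<in> edges G" "f \<in> edges G" "e \<noteq> f" for e f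
    using meet[OF that] xe[of e] xV[OF that(1)] ev[OF that(1), of f] by blast
  have "\<exists>d>0. \<forall>y\<in>x ` edges G. y \<noteq> x e \<longrightarrow> d \<le> dist (x e) y" for e
    using finite_set_avoid[of "x ` edges G"] fin(2) by blast
  then obtain d where d: "\<And>e. d e > 0" "\<And>e y. y \<in> x ` edges G \<Longrightarrow> y \<noteq> x e \<Longrightarrow> d e \<le> dist (x e) y"
    by metis
  \<comment> \<open>As \<open>d e\<close> is at most the distance of \<open>x e\<close> to each other midpoint, these neighbourhoods are disjoint.\<close>
  define U where "U = (\<lambda>e. S \<inter> ball (x e) (d e / 2) - (pos ` verts G \<union> (\<Union>f\<in>edges G - {e}. path_image (curve f))))"
  have Uop: "openin (top_of_set S) (U e)" if "e \<in> edges G" for e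
  proof -
    have "closed (pos ` verts G \<union> (\<Union>f\<in>edges G - {e}. path_image (curve f)))"
      using fin arcs(1) by (intro closed_Un closed_UN finite_imp_closed) (auto intro: closed_arc_image)
    then have "open (ball (x e) (d e / 2) - (pos ` verts G \<union> (\<Union>f\<in>edges G - {e}. path_image (curve f))))"
      by (intro open_Diff) auto
    moreover have "U e = S \<inter> (ball (x e) (d e / 2) - (pos ` verts G \<union> (\<Union>f\<in>edges G - {e}. path_image (curve f))))"
      unfolding U_def by blast
    ultimately show ?thesis by (auto simp: openin_open)
  qed
  have xU: "x e \<in> U e" if e: "e \<in> edges G" for e
    using xe[of e] arcs(2)[OF e] xV[OF e] xf[OF e] d(1)[of e] unfolding U_def by auto
  have Udisj: "U e \<inter> U f = {}" if ef: "e \<in> edges G" "f \<in> edges G" "e \<noteq> f" for e f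
  proof (rule ccontr)
    assume "U e \<inter> U f \<noteq> {}"
    then obtain y where y: "dist (x e) y < d e / 2" "dist (x f) y < d f / 2" unfolding U_def by auto
    have ne: "x e \<noteq> x f" using xf[OF ef] xe[of f] by metis
    have "dist (x e) (x f) < d e / 2 + d f / 2" using y dist_triangle2[of "x e" "x f" y] by linarith
    moreover have "d e \<le> dist (x e) (x f)" "d f \<le> dist (x e) (x f)"
      using d(2)[of "x f" e] d(2)[of "x e" f] ne ef by (auto simp: dist_commute)
    ultimately show False by linarith
  qed
  define P where "P = (\<lambda>e c' h s t. arc c' \<and> pathstart c' = pathstart (curve e) \<and> pathfinish c' = pathfinish (curve e) \<and>
    path_image c' \<subseteq> path_image (curve e) \<union> h ` cball 0 1 \<and> 0 < s \<and> s < t \<and> t < 1 \<and>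
    h ` ball 0 1 \<inter> path_image c' = c' ` {s<..<t} \<and> h ` cball 0 1 \<subseteq> U e \<and> embedded_disc S h \<and>
    (\<exists>H1 H2. connected H1 \<and> connected H2 \<and> h ` ball 0 1 - c' ` {s<..<t} = H1 \<union> H2))"
  have "\<exists>c' h s t. P e c' h s t"
    if e: "e \<in> edges G" for e
  proof -
    obtain h where h: "embedded_disc S h" "h 0 = x e" "h ` cball 0 1 \<subseteq> U e"
      using locally_discE[OF S Uop[OF e] xU[OF e]] .
    have "{pathstart (curve e), pathfinish (curve e)} \<inter> U e = {}"
      using arcs(3,4)[OF e] unfolding U_def by blast
    then have ends: "pathstart (curve e) \<notin> h ` cball 0 1" "pathfinish (curve e) \<notin> h ` cball 0 1"
      using h(3) by blast+
    show ?thesis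
      by (rule straighten_arc[OF arcs(1,2)[OF e] h(1) h(2)[unfolded x_def] ends]) (unfold P_def, use h in blast)
  qed
  then obtain curve' h s t where P: "\<And>e. e \<in> edges G \<Longrightarrow> P e (curve' e) (h e) (s e) (t e)"
    by metis
  have c': "\<And>e. e \<in> edges G \<Longrightarrow> arc (curve' e)"
    "\<And>e. e \<in> edges G \<Longrightarrow> pathstart (curve' e) = pathstart (curve e)"
    "\<And>e. e \<in> edges G \<Longrightarrow> pathfinish (curve' e) = pathfinish (curve e)"
    "\<And>e. e \<in> edges G \<Longrightarrow> path_image (curve' e) \<subseteq> path_image (curve e) \<union> h e ` cball 0 1"
    "\<And>e. e \<in> edges G \<Longrightarrow> 0 < s e \<and> s e < t e \<and> t e < 1"
    "\<And>e. e \<in> edges G \<Longrightarrow> h e ` ball 0 1 \<inter> path_image (curve' e) = curve' e ` {s e<..<t e}"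
    "\<And>e. e \<in> edges G \<Longrightarrow> h e ` cball 0 1 \<subseteq> U e"
    "\<And>e. e \<in> edges G \<Longrightarrow> embedded_disc S (h e)"
    "\<And>e. e \<in> edges G \<Longrightarrow> (\<exists>H1 H2. connected H1 \<and> connected H2 \<and> h e ` ball 0 1 - curve' e ` {s e<..<t e} = H1 \<union> H2)"
    using P unfolding P_def by simp_all
  have UX: "U e \<inter> path_image (curve f) = {}" if "f \<in> edges G" "e \<noteq> f" for e f
    using that unfolding U_def by blast
  have UV: "U e \<inter> pos ` verts G = {}" for e unfolding U_def by blast
  have ends': "{pathstart (curve' e), pathfinish (curve' e)} = pos ` e" if "e \<in> edges G" for e
    using arcs(3)[OF that] c'(2,3)[OF that] by simp
  have sub': "pos ` e \<subseteq> path_image (curve' e)" if "e \<in> edges G" for e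
    using ends'[OF that] by (metis bot_least insert_subset pathfinish_in_path_image pathstart_in_path_image)
  have cU: "path_image (curve' e) \<subseteq> path_image (curve e) \<union> U e" if "e \<in> edges G" for e
    using c'(4,7)[OF that] by blast
  have "drawing_on S G pos curve'"
    unfolding drawing_on_def
  proof (intro conjI ballI impI)
    show "inj_on pos (verts G)" "pos ` verts G \<subseteq> S" using dr unfolding drawing_on_def by auto
  next
    fix e assume e: "e \<in> edges G"
    show "arc (curve' e)" using c'(1)[OF e] .
    have "U e \<subseteq> S" unfolding U_def by blast
    then show "path_image (curve' e) \<subseteq> S" using cU[OF e] arcs(2)[OF e] by blast
    show "{pathstart (curve' e), pathfinish (curve' e)} = pos ` e" using ends'[OF e] .
    show "path_image (curve' e) \<inter> pos ` verts G = pos ` e"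
      using cU[OF e] UV[of e] arcs(4)[OF e] sub'[OF e] by blast
  next
    fix e f assume ef: "e \<in> edges G" "f \<in> edges G" "e \<noteq> f"
    have "path_image (curve' e) \<inter> path_image (curve' f) \<subseteq> pos ` (e \<inter> f)"
      using cU[OF ef(1)] cU[OF ef(2)] Udisj[OF ef] UX[OF ef(2,3)] UX[OF ef(1), of f] ef(3) meet[OF ef] by blast
    moreover have "pos ` (e \<inter> f) \<subseteq> path_image (curve' e) \<inter> path_image (curve' f)"
      using sub'[OF ef(1)] sub'[OF ef(2)] by blast
    ultimately show "path_image (curve' e) \<inter> path_image (curve' f) = pos ` (e \<inter> f)" by blast
  qed
  moreover have "straight_drawing S G curve'"
    unfolding straight_drawing_def
  proof
    fix e assume e: "e \<in> edges G"
    have "h e ` ball 0 1 \<inter> path_image (curve' f) = {}" if f: "f \<in> edges G" "f \<noteq> e" for f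
    proof -
      have "h e ` ball 0 1 \<subseteq> U e" by (rule subset_trans[OF image_mono[OF ball_subset_cball] c'(7)[OF e]])
      then show ?thesis using cU[OF f(1)] Udisj[OF e f(1)] UX[OF f(1), of e] f(2) by blast
    qed
    then have eq: "h e ` ball 0 1 \<inter> drawn_set G curve' = h e ` ball 0 1 \<inter> path_image (curve' e)"
      using e unfolding drawn_set_def by blast
    then have "h e ` ball 0 1 \<inter> drawn_set G curve' = curve' e ` {s e<..<t e}" using c'(6)[OF e] by simp
    moreover from this have "h e ` ball 0 1 - drawn_set G curve' = h e ` ball 0 1 - curve' e ` {s e<..<t e}" by blast
    moreover have "openin (top_of_set S) (h e ` ball 0 1)" using c'(8)[OF e] unfolding embedded_disc_def by blast
    ultimately show "\<exists>s t U H1 H2. 0 < s \<and> s < t \<and> t < 1 \<and> openin (top_of_set S) U \<and>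
      U \<inter> drawn_set G curve' = curve' e ` {s<..<t} \<and>
      connected H1 \<and> connected H2 \<and> U - drawn_set G curve' = H1 \<union> H2"
      using c'(5,9)[OF e] by metis
  qed
  ultimately show ?thesis using that by blast
qed

lemma openin_component_locally_disc:
  assumes S: "locally_disc S" and W: "openin (top_of_set S) W" and C: "C \<in> components W"
  shows "openin (top_of_set S) C"
proof (subst openin_subopen, rule ballI)
  fix x assume x: "x \<in> C"
  then have "x \<in> W" using C in_components_subset by blast
  then obtain h where h: "embedded_disc S h" "h 0 = x" "h ` cball 0 1 \<subseteq> W"
    using locally_discE[OF S W] by blast
  have sub: "h ` ball 0 1 \<subseteq> W" by (rule subset_trans[OF image_mono[OF ball_subset_cball] h(3)])
  have "connected (h ` ball 0 1)"
    using h(1) by (intro connected_continuous_image) (auto simp: embedded_disc_def intro: continuous_on_subset)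
  moreover have hx: "x \<in> h ` ball 0 1" using h(2) imageI[of 0 "ball 0 1" h] by simp
  ultimately have "h ` ball 0 1 \<subseteq> C"
    using components_maximal[OF C _ sub] x by blast
  then show "\<exists>T. openin (top_of_set S) T \<and> x \<in> T \<and> T \<subseteq> C"
    using hx h(1) unfolding embedded_disc_def by blast
qed

text \<open>Suppose that the face \<open>C\<close> meets the neighbourhoods of at most two edges.  Remove from the surface these
edges, or any two edges containing them, and from each other edge only the two ends that remain without its
straight middle.  As the graph is simple, this is a forest of arcs and its complement is
connected.  But \<open>C\<close> is open and closed in this complement and misses the middle of a third edge.\<close>

lemma faces_meet_three_edges:
  fixes S :: "'p::real_normed_vector set"
  assumes S: "locally_disc S" "connected S" and dr: "drawing_on S G pos curve"
    and fin: "finite (edges G)" and three: "3 \<le> card (edges G)"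
    and e2: "\<And>e. e \<in> edges G \<Longrightarrow> card e = 2 \<and> e \<subseteq> verts G"
    and st: "\<And>e. e \<in> edges G \<Longrightarrow> 0 < s e \<and> s e < t e \<and> t e < (1::real)"
    and U: "\<And>e. e \<in> edges G \<Longrightarrow> openin (top_of_set S) (U e) \<and> U e \<inter> drawn_set G curve = curve e ` {s e<..<t e}"
    and C: "C \<in> components (S - drawn_set G curve)"
  shows "3 \<le> card {e \<in> edges G. U e \<inter> C \<noteq> {}}"
proof (rule ccontr)
  let ?I = "{e \<in> edges G. U e \<inter> C \<noteq> {}}"
  let ?X = "drawn_set G curve"
  assume "\<not> 3 \<le> card ?I"
  then have I2: "card ?I \<le> 2" by simp
  obtain J where J: "?I \<subseteq> J" "J \<subseteq> edges G" "card J = 2"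
    using obtain_subset_with_card_n[of 2 "edges G"] exists_subset_between[of ?I 2 "edges G"] I2 three fin by auto
  then obtain e1 e2' where J2: "J = {e1, e2'}" "e1 \<noteq> e2'" by (auto simp: card_2_iff)
  have e12: "e1 \<in> edges G" "e2' \<in> edges G" using J J2 by auto
  have "\<not> edges G \<subseteq> J" using J(3) three card_mono[of J "edges G"] J2 by fastforce
  then obtain e3 where e3: "e3 \<in> edges G" "e3 \<notin> J" by blast
  have arcs: "arc (curve e)" "path_image (curve e) \<subseteq> S" "{pathstart (curve e), pathfinish (curve e)} = pos ` e"
    "path_image (curve e) \<inter> pos ` verts G = pos ` e" if "e \<in> edges G" for e
    using dr that unfolding drawing_on_def by auto
  have meet: "path_image (curve e) \<inter> path_image (curve f) = pos ` (e \<inter> f)"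
    if "e \<in> edges G" "f \<in> edges G" "e \<noteq> f" for e f
    using dr that unfolding drawing_on_def by auto
  have inj: "inj_on (curve e) {0..1}" if "e \<in> edges G" for e using arcs(1)[OF that] by (simp add: arc_def)
  have Xc: "closedin (top_of_set S) ?X"
    unfolding drawn_set_def using fin arcs(1,2)
    by (intro closed_subset closed_UN) (auto intro: closed_arc_image)
  define Y where "Y = path_image (curve e1) \<union> path_image (curve e2')"
  have Yc: "closedin (top_of_set S) Y"
    unfolding Y_def using e12 arcs(1,2) by (intro closed_subset closed_Un) (auto intro: closed_arc_image)
  have "connected (S - Y)"
  proof -
    have "connected (S - ({} \<union> path_image (curve e1)))"
      by (rule arc_complement_connected[OF S(1)]) (use S(2) arcs[OF e12(1)] in auto)
    then have c1: "connected (S - path_image (curve e1))" by simp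
    have "e1 \<inter> e2' \<noteq> e2'"
    proof
      assume "e1 \<inter> e2' = e2'"
      then have "e2' \<subseteq> e1" by blast
      moreover have "finite e1" using e2[OF e12(1)] by (metis card.infinite zero_neq_numeral)
      ultimately have "e2' = e1" using e2[OF e12(1)] e2[OF e12(2)] by (metis card_subset_eq)
      then show False using J2 by simp
    qed
    then obtain v where v: "v \<in> e2'" "v \<notin> e1" by blast
    have vV: "v \<in> verts G" using v e2[OF e12(2)] by blast
    have vn: "pos v \<notin> pos ` (e2' \<inter> e1)"
    proof
      assume "pos v \<in> pos ` (e2' \<inter> e1)"
      then obtain w where "w \<in> e1" "pos v = pos w" "w \<in> verts G" using e2[OF e12(1)] by blast
      moreover have "inj_on pos (verts G)" using dr unfolding drawing_on_def by blast
      ultimately show False using v vV by (auto dest: inj_onD)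
    qed
    have se: "{pathstart (curve e2'), pathfinish (curve e2')} = pos ` e2'" using arcs(3)[OF e12(2)] .
    have sub: "path_image (curve e2') \<inter> path_image (curve e1) \<subseteq> {pathstart (curve e2'), pathfinish (curve e2')} - {pos v}"
      using meet[OF e12(2,1)] J2(2) vn se by blast
    have vse: "pos v = pathstart (curve e2') \<or> pos v = pathfinish (curve e2')" using se v by blast
    have cl1: "closedin (top_of_set S) (path_image (curve e1))"
      using e12 arcs(1,2) by (intro closed_subset) (auto intro: closed_arc_image)
    show ?thesis
    proof (cases "pos v = pathfinish (curve e2')")
      case True
      then show ?thesis unfolding Y_def
        using sub arcs[OF e12(2)] by (intro arc_complement_connected[OF S(1) cl1 c1]) auto
    next
      case False
      then have "pos v = pathstart (curve e2')" using vse by blast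
      then have "connected (S - (path_image (curve e1) \<union> path_image (reversepath (curve e2'))))"
        using sub arcs[OF e12(2)] by (intro arc_complement_connected[OF S(1) cl1 c1]) (auto simp: arc_reversepath)
      then show ?thesis unfolding Y_def by simp
    qed
  qed
  \<comment> \<open>The two ends of an edge, both starting at a vertex.\<close>
  define a where "a = (\<lambda>e. subpath 0 (s e) (curve e))"
  define b where "b = (\<lambda>e. subpath 1 (t e) (curve e))"
  let ?R = "edges G - {e1, e2'}"
  define \<A> where "\<A> = a ` ?R \<union> b ` ?R"
  have ima: "path_image (a e) = curve e ` {0..s e}" "path_image (b e) = curve e ` {t e..1}" if "e \<in> edges G" for e
    using st[OF that] by (simp_all add: a_def b_def path_image_subpath)
  have starts: "pathstart (a e) = curve e 0" "pathstart (b e) = curve e 1" for e by (simp_all add: a_def b_def)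
  have arcab: "arc (a e)" "arc (b e)" if "e \<in> edges G" for e
    using arc_subpath_arc[OF arcs(1)[OF that]] st[OF that] by (auto simp: a_def b_def)
  have subab: "path_image (a e) \<subseteq> path_image (curve e)" "path_image (b e) \<subseteq> path_image (curve e)" if "e \<in> edges G" for e
    using ima[OF that] st[OF that] by (auto simp: path_image_def)
  have other: "path_image (a e) \<inter> path_image (curve f) \<subseteq> {pathstart (a e)}"
      "path_image (b e) \<inter> path_image (curve f) \<subseteq> {pathstart (b e)}"
    if ef: "e \<in> edges G" "f \<in> edges G" "e \<noteq> f" for e f
  proof -
    have sub: "path_image (curve e) \<inter> path_image (curve f) \<subseteq> {curve e 0, curve e 1}"
      using meet[OF ef] arcs(3)[OF ef(1)] by (auto simp: pathstart_def pathfinish_def)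
    have "curve e 1 \<notin> path_image (a e)"
    proof
      assume "curve e 1 \<in> path_image (a e)"
      then obtain u where "u \<in> {0..s e}" "curve e 1 = curve e u" unfolding ima[OF ef(1)] by blast
      then show False using inj[OF ef(1)] st[OF ef(1)] by (auto dest: inj_onD)
    qed
    moreover have "curve e 0 \<notin> path_image (b e)"
    proof
      assume "curve e 0 \<in> path_image (b e)"
      then obtain u where "u \<in> {t e..1}" "curve e 0 = curve e u" unfolding ima[OF ef(1)] by blast
      then show False using inj[OF ef(1)] st[OF ef(1)] by (auto dest: inj_onD)
    qed
    ultimately show "path_image (a e) \<inter> path_image (curve f) \<subseteq> {pathstart (a e)}"
      "path_image (b e) \<inter> path_image (curve f) \<subseteq> {pathstart (b e)}"
      using sub subab[OF ef(1)] starts by auto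
  qed
  have same: "path_image (a e) \<inter> path_image (b e) = {}" if e: "e \<in> edges G" for e
  proof (rule ccontr)
    assume "path_image (a e) \<inter> path_image (b e) \<noteq> {}"
    then obtain u v where uv: "u \<in> {0..s e}" "v \<in> {t e..1}" "curve e u = curve e v" unfolding ima[OF e] by fastforce
    then have "u = v" using inj[OF e] st[OF e] by (auto dest!: inj_onD)
    then show False using uv st[OF e] by auto
  qed
  define T where "T = Y \<union> (\<Union>c\<in>\<A>. path_image c)"
  have conT: "connected (S - T)"
    unfolding T_def
  proof (rule forest_complement_connected[OF S(1) Yc \<open>connected (S - Y)\<close>])
    show "finite \<A>" unfolding \<A>_def using fin by simp
    show "arc c \<and> path_image c \<subseteq> S \<and> path_image c \<inter> Y \<subseteq> {pathstart c}" if c: "c \<in> \<A>" for c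
    proof -
      obtain e where e: "e \<in> ?R" "c = a e \<or> c = b e" using c unfolding \<A>_def by blast
      then have eG: "e \<in> edges G" by blast
      have "path_image c \<inter> path_image (curve f) \<subseteq> {pathstart c}" if "f \<in> {e1, e2'}" for f
        using other[OF eG, of f] e e12 that by blast
      then have "path_image c \<inter> Y \<subseteq> {pathstart c}" unfolding Y_def by blast
      moreover have "arc c" "path_image c \<subseteq> path_image (curve e)"
        using e(2) arcab[OF eG] subab[OF eG] by auto
      ultimately show ?thesis using arcs(2)[OF eG] by blast
    qed
    show "path_image c \<inter> path_image c' \<subseteq> {pathstart c}" if cc: "c \<in> \<A>" "c' \<in> \<A>" "c \<noteq> c'" for c c'
    proof -
      obtain e where e: "e \<in> ?R" "c = a e \<or> c = b e" using cc unfolding \<A>_def by blast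
      obtain f where f: "f \<in> ?R" "c' = a f \<or> c' = b f" using cc unfolding \<A>_def by blast
      show ?thesis
      proof (cases "e = f")
        case True
        then show ?thesis using same[of e] e f cc(3) by blast
      next
        case False
        have "path_image c' \<subseteq> path_image (curve f)" using subab[of f] f by blast
        then show ?thesis using other[of e f] e f False by blast
      qed
    qed
  qed
  have TX: "T \<subseteq> ?X" unfolding T_def Y_def \<A>_def drawn_set_def using e12 subab by blast
  have UT: "U e \<inter> T = {}" if e: "e \<in> ?R" for e
  proof (rule ccontr)
    assume "U e \<inter> T \<noteq> {}"
    then obtain x where x: "x \<in> U e" "x \<in> T" by blast
    have eG: "e \<in> edges G" using e by blast
    have "x \<in> curve e ` {s e<..<t e}" using U[OF eG] x TX by blast
    then obtain u where u: "u \<in> {s e<..<t e}" "x = curve e u" by blast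
    have u01: "u \<in> {0<..<1}" using u st[OF eG] by auto
    have xe: "x \<in> path_image (curve e)" using u u01 by (auto simp: path_image_def)
    have xnot: "x \<notin> path_image (curve f)" if f: "f \<in> edges G" "f \<noteq> e" for f
    proof
      assume "x \<in> path_image (curve f)"
      then have "x \<in> {curve e 0, curve e 1}"
        using meet[OF eG f(1)] f(2) xe arcs(3)[OF eG] by (auto simp: pathstart_def pathfinish_def)
      then show False using u u01 inj[OF eG] by (auto dest: inj_onD)
    qed
    obtain f where f: "f \<in> ?R" "x \<in> path_image (a f) \<union> path_image (b f)"
      using x(2) xnot e e12 unfolding T_def Y_def \<A>_def by blast
    then have "f = e" using xnot[of f] subab[of f] by blast
    then obtain v where v: "v \<in> {0..s e} \<union> {t e..1}" "x = curve e v" using f ima[OF eG] by blast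
    then have "u = v" using u u01 inj[OF eG] st[OF eG] by (auto dest!: inj_onD)
    then show False using u v by auto
  qed
  \<comment> \<open>The complement of \<open>C\<close> in \<open>S - T\<close>: the other faces, and the neighbourhoods of the edges that \<open>C\<close> does not meet.\<close>
  define R where "R = (S - ?X - C) \<union> (\<Union>e\<in>?R. U e)"
  have opW: "openin (top_of_set S) (S - ?X)" using Xc by (intro openin_diff) auto
  have opC: "openin (top_of_set S) C" by (rule openin_component_locally_disc[OF S(1) opW C])
  have CX: "C \<subseteq> S - ?X" using C in_components_subset by blast
  have opR: "openin (top_of_set S) R"
  proof -
    have eq: "S - ?X - C = \<Union>(components (S - ?X) - {C})"
    proof -
      have "C \<inter> D = {}" if "D \<in> components (S - ?X) - {C}" for D
        using components_eq[OF C, of D] that by blast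
      then have "C \<inter> \<Union>(components (S - ?X) - {C}) = {}" by blast
      moreover have "\<Union>(components (S - ?X)) = S - ?X" by (rule Union_components)
      ultimately show ?thesis using C by blast
    qed
    have "openin (top_of_set S) (S - ?X - C)"
      unfolding eq by (rule openin_Union) (use openin_component_locally_disc[OF S(1) opW] in blast)
    moreover have "openin (top_of_set S) (\<Union>e\<in>?R. U e)" using U by (intro openin_Union) blast
    ultimately show ?thesis unfolding R_def by (rule openin_Un)
  qed
  have cov: "S - T = C \<union> R"
  proof
    show "S - T \<subseteq> C \<union> R"
    proof
      fix x assume x: "x \<in> S - T"
      show "x \<in> C \<union> R"
      proof (cases "x \<in> ?X")
        case True
        then obtain e where e: "e \<in> edges G" "x \<in> path_image (curve e)" unfolding drawn_set_def by blast
        then have eR: "e \<in> ?R" using x unfolding T_def Y_def by blast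
        obtain u where u: "u \<in> {0..1}" "x = curve e u" using e(2) by (auto simp: path_image_def)
        have "x \<notin> path_image (a e)" "x \<notin> path_image (b e)" using x eR unfolding T_def \<A>_def by blast+
        then have "u \<in> {s e<..<t e}" using u unfolding ima[OF e(1)] by force
        then have "x \<in> U e" using U[OF e(1)] u by blast
        then show ?thesis using eR unfolding R_def by blast
      qed (use x R_def in blast)
    qed
    have "U e \<subseteq> S - T" if e: "e \<in> ?R" for e
    proof -
      have "openin (top_of_set S) (U e)" using U e by blast
      then show ?thesis using UT[OF e] openin_imp_subset by blast
    qed
    then have "(\<Union>e\<in>?R. U e) \<subseteq> S - T" by (rule UN_least)
    moreover have XT: "S - ?X \<subseteq> S - T" by (rule Diff_mono[OF subset_refl TX])
    moreover have "S - ?X - C \<subseteq> S - T" by (rule subset_trans[OF Diff_subset XT])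
    ultimately show "C \<union> R \<subseteq> S - T" unfolding R_def
      by (intro Un_least subset_trans[OF CX XT])
  qed
  have disj: "C \<inter> R = {}"
  proof -
    have "U e \<inter> C = {}" if e: "e \<in> ?R" for e
    proof (rule ccontr)
      assume "U e \<inter> C \<noteq> {}"
      then have "e \<in> ?I" using e by simp
      then have "e \<in> J" using J(1) by (rule rev_subsetD)
      then show False using e J2(1) by simp
    qed
    then have "C \<inter> (\<Union>e\<in>?R. U e) = {}" by fast
    moreover have "C \<inter> (S - ?X - C) = {}" by fast
    ultimately show ?thesis unfolding R_def by (simp add: Int_Un_distrib)
  qed
  have e3R: "e3 \<in> ?R" using e3 J2 by blast
  have "(s e3 + t e3) / 2 \<in> {s e3<..<t e3}" using st[OF e3(1)] by auto
  then have "curve e3 ((s e3 + t e3) / 2) \<in> U e3" using U[OF e3(1)] by blast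
  then have "R \<noteq> {}" using e3R unfolding R_def by blast
  moreover have "C \<noteq> {}" using C in_components_nonempty by blast
  moreover have "openin (top_of_set (S - T)) C" "openin (top_of_set (S - T)) R"
    using openin_subset_trans[OF opC _ Diff_subset] openin_subset_trans[OF opR _ Diff_subset] cov by blast+
  ultimately show False using conT disj cov unfolding connected_openin by (metis subset_refl)
qed

text \<open>Double counting of the pairs of a face and an edge whose neighbourhood it meets.  Each edge has only two sides,
hence occurs in at most two pairs.\<close>

theorem three_faces_le_two_edges:
  fixes S :: "'p::real_normed_vector set"
  assumes S: "locally_disc S" "connected S" and dr: "drawing_on S G pos curve" "straight_drawing S G curve"
    and fin: "finite (edges G)" and three: "3 \<le> card (edges G)"
    and e2: "\<And>e. e \<in> edges G \<Longrightarrow> card e = 2 \<and> e \<subseteq> verts G"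
  shows "finite (components (S - drawn_set G curve))"
    and "3 * card (components (S - drawn_set G curve)) \<le> 2 * card (edges G)"
proof -
  let ?X = "drawn_set G curve"
  let ?F = "components (S - ?X)"
  obtain s t U H1 H2 where st: "\<And>e. e \<in> edges G \<Longrightarrow> 0 < s e \<and> s e < t e \<and> t e < (1::real)"
    and U: "\<And>e. e \<in> edges G \<Longrightarrow> openin (top_of_set S) (U e) \<and> U e \<inter> ?X = curve e ` {s e<..<t e}"
    and H: "\<And>e. e \<in> edges G \<Longrightarrow> connected (H1 e) \<and> connected (H2 e) \<and> U e - ?X = H1 e \<union> H2 e"
    using dr(2) unfolding straight_drawing_def by metis
  have three_e: "3 \<le> card {e \<in> edges G. U e \<inter> C \<noteq> {}}" if "C \<in> ?F" for C
    by (rule faces_meet_three_edges[OF S dr(1) fin three e2 st U that])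
  have two: "finite {C \<in> ?F. U e \<inter> C \<noteq> {}} \<and> card {C \<in> ?F. U e \<inter> C \<noteq> {}} \<le> 2" if e: "e \<in> edges G" for e
  proof -
    have US: "U e \<subseteq> S" using U[OF e] openin_imp_subset by blast
    define P where "P = (\<lambda>H. {C \<in> ?F. H \<inter> C \<noteq> {}})"
    have P1: "finite (P H) \<and> card (P H) \<le> 1" if H: "connected H" "H \<subseteq> S - ?X" for H
    proof -
      have "C = D" if "C \<in> P H" "D \<in> P H" for C D
      proof -
        have CD: "C \<in> ?F" "D \<in> ?F" "H \<inter> C \<noteq> {}" "H \<inter> D \<noteq> {}" using that unfolding P_def by auto
        then have "H \<subseteq> C" "H \<subseteq> D" using components_maximal H by (metis inf_commute)+
        then have "C \<inter> D \<noteq> {}" using CD by blast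
        then show ?thesis using CD components_eq by metis
      qed
      then have "P H = {} \<or> (\<exists>C. P H = {C})" by blast
      then show ?thesis by auto
    qed
    have "{C \<in> ?F. U e \<inter> C \<noteq> {}} \<subseteq> P (H1 e) \<union> P (H2 e)"
    proof
      fix C assume C: "C \<in> {C \<in> ?F. U e \<inter> C \<noteq> {}}"
      then have "C \<subseteq> S - ?X" using in_components_subset by blast
      then have "(U e - ?X) \<inter> C \<noteq> {}" using C by blast
      then show "C \<in> P (H1 e) \<union> P (H2 e)" using C H[OF e] unfolding P_def by auto
    qed
    moreover have "H1 e \<subseteq> S - ?X" "H2 e \<subseteq> S - ?X" using H[OF e] US by blast+
    then have "finite (P (H1 e)) \<and> card (P (H1 e)) \<le> 1" "finite (P (H2 e)) \<and> card (P (H2 e)) \<le> 1"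
      using P1 H[OF e] by blast+
    ultimately show ?thesis
      using card_mono[of "P (H1 e) \<union> P (H2 e)" "{C \<in> ?F. U e \<inter> C \<noteq> {}}"] card_Un_le[of "P (H1 e)" "P (H2 e)"]
        finite_subset[of "{C \<in> ?F. U e \<inter> C \<noteq> {}}"] by auto
  qed
  have "?F \<subseteq> (\<Union>e\<in>edges G. {C \<in> ?F. U e \<inter> C \<noteq> {}})"
  proof
    fix C assume C: "C \<in> ?F"
    then have "{e \<in> edges G. U e \<inter> C \<noteq> {}} \<noteq> {}" using three_e[OF C] by force
    then show "C \<in> (\<Union>e\<in>edges G. {C \<in> ?F. U e \<inter> C \<noteq> {}})" using C by blast
  qed
  moreover have "finite (\<Union>e\<in>edges G. {C \<in> ?F. U e \<inter> C \<noteq> {}})" using fin two by blast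
  ultimately show finF: "finite ?F" by (rule finite_subset)
  have "3 * card ?F = (\<Sum>C\<in>?F. 3)" by simp
  also have "\<dots> \<le> (\<Sum>C\<in>?F. card {e \<in> edges G. U e \<inter> C \<noteq> {}})" by (rule sum_mono) (use three_e in simp)
  also have "\<dots> = (\<Sum>C\<in>?F. \<Sum>e\<in>{e \<in> edges G. U e \<inter> C \<noteq> {}}. 1)" by simp
  also have "\<dots> = (\<Sum>e\<in>edges G. \<Sum>C\<in>{C \<in> ?F. U e \<inter> C \<noteq> {}}. 1)"
    by (rule sum.swap_restrict[OF finF fin])
  also have "\<dots> = (\<Sum>e\<in>edges G. card {C \<in> ?F. U e \<inter> C \<noteq> {}})" by simp
  also have "\<dots> \<le> (\<Sum>e\<in>edges G. 2)" by (rule sum_mono) (use two in simp)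
  finally show "3 * card ?F \<le> 2 * card (edges G)" by simp
qed

section \<open>The square classes defined by a drawing\<close>

text \<open>Extension of circle-valued maps from a compact subset of the plane, transported along an embedding.\<close>

lemma extend_through_embedding:
  fixes q :: "'p::t2_space \<Rightarrow> complex" and f :: "'p \<Rightarrow> complex"
  assumes "compact W" "continuous_on W q" "inj_on q W" "continuous_on W f" "f ` W \<subseteq> sphere 0 1"
    and L: "\<And>C. \<lbrakk>C \<in> components (- q ` W); bounded C\<rbrakk> \<Longrightarrow> C \<inter> L \<noteq> {}"
  obtains K g where "finite K" "K \<subseteq> L" "K \<inter> q ` W = {}" "continuous_on (- K) g" "g ` (- K) \<subseteq> sphere 0 1"
    "\<And>x. x \<in> W \<Longrightarrow> g (q x) = f x"
proof -
  obtain f' where f': "continuous_on (q ` W) f'" "\<And>x. x \<in> W \<Longrightarrow> f' (q x) = f x"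
    using continuous_lift_through_compact[OF assms(1,2,4)] assms(3) by (metis inj_onD)
  have "f' \<in> q ` W \<rightarrow> sphere 0 1" using f'(2) assms(5) by fastforce
  then obtain K g where K: "finite K" "K \<subseteq> L" "disjnt K (q ` W)" "continuous_on (- K) g"
      "g \<in> (- K) \<rightarrow> sphere 0 1" "\<And>x. x \<in> q ` W \<Longrightarrow> g x = f' x"
    using extend_map_UNIV_to_sphere_cofinite[of 1 "q ` W" f' 0 L] f'(1) L
      compact_continuous_image[OF assms(2,1)] by (metis dual_order.refl zero_le_one)
  show ?thesis
    by (rule that[of K g]) (use K f'(2) in \<open>auto simp: disjnt_def image_subset_iff_funcset\<close>)
qed

text \<open>All factors except \<open>z - c\<close> have no zero in the disc and are squares there.\<close>

lemma no_sqrt_prod_on_circle: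
  assumes "0 < r" "finite N" "finite M" "c \<in> N" "c \<notin> M"
    and far: "\<And>p. \<lbrakk>p \<in> N \<union> M; p \<noteq> c\<rbrakk> \<Longrightarrow> p \<notin> cball c r"
  shows "\<not> has_sqrt (sphere c r) (\<lambda>z. (\<Prod>p\<in>N. z - p) * (\<Prod>p\<in>M. z - p))"
proof
  assume sq: "has_sqrt (sphere c r) (\<lambda>z. (\<Prod>p\<in>N. z - p) * (\<Prod>p\<in>M. z - p))"
  let ?R = "\<lambda>z. (\<Prod>p\<in>N - {c}. z - p) * (\<Prod>p\<in>M. z - p)"
  have nz: "?R z \<noteq> 0" if "z \<in> cball c r" for z
    using far that assms(2,3,5) by auto
  have "has_sqrt (cball c r) ?R"
    by (rule has_sqrt_contractible) (use nz in \<open>auto intro!: continuous_intros convex_imp_contractible\<close>)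
  then have "has_sqrt (sphere c r) ?R" by (rule has_sqrt_subset) auto
  moreover have "has_sqrt (sphere c r) (\<lambda>z. (z - c) * ?R z)"
    by (rule has_sqrt_cong[OF sq]) (simp add: prod.remove[OF assms(2,4)] mult.assoc)
  ultimately have "has_sqrt (sphere c r) (\<lambda>z. z - c)"
    using has_sqrt_cancel[of "sphere c r" "\<lambda>z. z - c" ?R] nz sphere_cball by blast
  then show False using no_sqrt_on_circle[OF assms(1)] by blast
qed

lemma square_roots_differ_by_sign:
  fixes \<sigma> \<tau> :: "'a::topological_space \<Rightarrow> complex"
  assumes "connected T" "continuous_on T \<sigma>" "continuous_on T \<tau>"
    and sq: "\<And>x. x \<in> T \<Longrightarrow> (\<sigma> x)\<^sup>2 = (\<tau> x)\<^sup>2" and nz: "\<And>x. x \<in> T \<Longrightarrow> \<tau> x \<noteq> 0"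
  shows "(\<forall>x\<in>T. \<sigma> x = \<tau> x) \<or> (\<forall>x\<in>T. \<sigma> x = - \<tau> x)"
proof (cases "T = {}")
  case False
  define u where "u = (\<lambda>x. \<sigma> x / \<tau> x)"
  have cu: "continuous_on T u" unfolding u_def using assms by (intro continuous_intros) auto
  have "u x \<in> {1, -1}" if "x \<in> T" for x
    using sq[OF that] nz[OF that] unfolding u_def power2_eq_iff by auto
  then have "finite (u ` T)" by (meson finite.emptyI finite_insert finite_subset image_subsetI)
  then have "u constant_on T" using continuous_finite_range_constant[OF assms(1) cu] by blast
  then obtain a where a: "\<And>x. x \<in> T \<Longrightarrow> u x = a" unfolding constant_on_def by blast
  then have "a = 1 \<or> a = -1" using \<open>\<And>x. x \<in> T \<Longrightarrow> u x \<in> {1, -1}\<close> False by auto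
  then show ?thesis using a nz unfolding u_def by (auto simp: divide_eq_1_iff divide_eq_minus_1_iff)
qed simp

text \<open>The map \<open>\<psi> e\<close> winds once around the edge \<open>e\<close> and is 1 on all other edges and at the vertices.\<close>

lemma edge_functions:
  fixes curve :: "'v set \<Rightarrow> real \<Rightarrow> 'p::t2_space"
  assumes dr: "drawing_on S G pos curve" and fin: "finite (edges G)"
  obtains \<psi> :: "'v set \<Rightarrow> 'p \<Rightarrow> complex" where
    "\<And>e. e \<in> edges G \<Longrightarrow> continuous_on (drawn_set G curve) (\<psi> e)"
    "\<And>e x. e \<in> edges G \<Longrightarrow> x \<in> drawn_set G curve \<Longrightarrow> norm (\<psi> e x) = 1"
    "\<And>e t. e \<in> edges G \<Longrightarrow> t \<in> {0..1} \<Longrightarrow> \<psi> e (curve e t) = exp (2 * pi * \<i> * t)"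
    "\<And>e f t. e \<in> edges G \<Longrightarrow> f \<in> edges G \<Longrightarrow> e \<noteq> f \<Longrightarrow> t \<in> {0..1} \<Longrightarrow> \<psi> e (curve f t) = 1"
proof -
  have arcs: "arc (curve e)" "{pathstart (curve e), pathfinish (curve e)} = pos ` e" if "e \<in> edges G" for e
    using dr that unfolding drawing_on_def by auto
  have meet: "path_image (curve e) \<inter> path_image (curve f) = pos ` (e \<inter> f)"
    if "e \<in> edges G" "f \<in> edges G" "e \<noteq> f" for e f
    using dr that unfolding drawing_on_def by auto
  let ?X = "drawn_set G curve"
  have "\<exists>\<psi>. continuous_on ?X \<psi> \<and> (\<forall>x\<in>?X. norm (\<psi> x) = 1) \<and> (\<forall>t\<in>{0..1}. \<psi> (curve e t) = exp (2 * pi * \<i> * t)) \<and>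
      (\<forall>f\<in>edges G. e \<noteq> f \<longrightarrow> (\<forall>t\<in>{0..1}. \<psi> (curve f t) = 1))" if e: "e \<in> edges G" for e
  proof -
    have ce: "continuous_on {0..1} (curve e)" "inj_on (curve e) {0..1}" using arcs(1)[OF e] by (auto simp: arc_def path_def)
    define R where "R = (\<Union>f\<in>edges G - {e}. path_image (curve f))"
    obtain \<phi> where \<phi>: "continuous_on (curve e ` {0..1}) \<phi>" "\<And>t. t \<in> {0..1} \<Longrightarrow> \<phi> (curve e t) = exp (2 * pi * \<i> * complex_of_real t)"
    proof (rule continuous_lift_through_compact[of "{0..1::real}" "curve e" "\<lambda>t. exp (2 * pi * \<i> * complex_of_real t)"])
      show "exp (2 * pi * \<i> * complex_of_real x) = exp (2 * pi * \<i> * complex_of_real y)"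
        if "x \<in> {0..1}" "y \<in> {0..1}" "curve e x = curve e y" for x y
        using inj_onD[OF ce(2) that(3,1,2)] by simp
    qed (use ce in \<open>auto intro!: continuous_intros\<close>)
    have Xeq: "?X = path_image (curve e) \<union> R" unfolding drawn_set_def R_def using e by blast
    define \<psi> where "\<psi> = (\<lambda>x. if x \<in> path_image (curve e) then \<phi> x else 1)"
    have one: "\<psi> x = 1" if xR: "x \<in> R" for x
    proof (cases "x \<in> path_image (curve e)")
      case True
      obtain f where "f \<in> edges G" "f \<noteq> e" "x \<in> path_image (curve f)" using xR unfolding R_def by blast
      then have "x \<in> pos ` e" using meet[OF e, of f] True by blast
      then have "x = curve e 0 \<or> x = curve e 1" using arcs(2)[OF e] by (auto simp: pathstart_def pathfinish_def)
      then have "\<phi> x = 1" using \<phi>(2)[of 0] \<phi>(2)[of 1] by (auto simp: exp_eq_1)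
      then show ?thesis by (simp add: \<psi>_def)
    qed (simp add: \<psi>_def)
    have "continuous_on (path_image (curve e) \<union> R) \<psi>"
    proof (rule continuous_on_closed_Un)
      show "closed (path_image (curve e))" using closed_arc_image arcs(1)[OF e] by (simp add: compact_arc_image compact_imp_closed)
      show "closed R" unfolding R_def using fin arcs(1) by (intro closed_UN) (auto simp: compact_arc_image compact_imp_closed)
      show "continuous_on (path_image (curve e)) \<psi>"
        by (rule continuous_on_eq[OF \<phi>(1)[folded path_image_def]]) (simp add: \<psi>_def)
      show "continuous_on R \<psi>" by (rule continuous_on_eq[of _ "\<lambda>_. 1"]) (use one in auto)
    qed
    moreover have "norm (\<psi> x) = 1" for x
    proof (cases "x \<in> path_image (curve e)")
      case True
      then obtain t where "t \<in> {0..1}" "x = curve e t" unfolding path_image_def by blast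
      then show ?thesis using \<phi>(2)[of t] True by (simp add: \<psi>_def)
    qed (simp add: \<psi>_def)
    moreover have "\<psi> (curve e t) = exp (2 * pi * \<i> * t)" if "t \<in> {0..1}" for t
      using \<phi>(2)[OF that] that by (auto simp: \<psi>_def path_image_def)
    moreover have "\<psi> (curve f t) = 1" if "f \<in> edges G" "e \<noteq> f" "t \<in> {0..1}" for f t
    proof (rule one)
      have "curve f t \<in> path_image (curve f)" using that(3) by (simp add: path_image_def)
      then show "curve f t \<in> R" unfolding R_def using that(1,2) by blast
    qed
    ultimately show ?thesis unfolding Xeq by blast
  qed
  then obtain \<psi> where "\<And>e. e \<in> edges G \<Longrightarrow> continuous_on ?X (\<psi> e) \<and> (\<forall>x\<in>?X. norm (\<psi> e x) = 1) \<and>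
      (\<forall>t\<in>{0..1}. \<psi> e (curve e t) = exp (2 * pi * \<i> * t)) \<and>
      (\<forall>f\<in>edges G. e \<noteq> f \<longrightarrow> (\<forall>t\<in>{0..1}. \<psi> e (curve f t) = 1))" by metis
  then show ?thesis using that[of \<psi>] by blast
qed

text \<open>A square root takes the values 1 and -1 at the vertices.  Along an edge it changes sign exactly if the edge belongs to
one of \<open>F\<close> and \<open>F'\<close> but not to both.  So these edges are the ones between the vertices with
value 1 and the vertices with value -1.\<close>

lemma sqrt_of_edge_functions_is_cut:
  fixes curve :: "'v set \<Rightarrow> real \<Rightarrow> 'p::t2_space"
  assumes dr: "drawing_on S G pos curve" and fin: "finite (edges G)"
    and eV: "\<And>e. e \<in> edges G \<Longrightarrow> e \<subseteq> verts G"
    and \<psi>: "\<And>e t. e \<in> edges G \<Longrightarrow> t \<in> {0..1} \<Longrightarrow> \<psi> e (curve e t) = exp (2 * pi * \<i> * t)"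
    "\<And>e f t. e \<in> edges G \<Longrightarrow> f \<in> edges G \<Longrightarrow> e \<noteq> f \<Longrightarrow> t \<in> {0..1} \<Longrightarrow> \<psi> e (curve f t) = 1"
    and F: "F \<subseteq> edges G" "F' \<subseteq> edges G"
    and sq: "has_sqrt (drawn_set G curve) (\<lambda>x. (\<Prod>e\<in>F. \<psi> e x) * (\<Prod>e\<in>F'. \<psi> e x))"
  shows "\<exists>s \<subseteq> verts G. F' = {e \<in> edges G. (e \<in> F) \<noteq> (e \<inter> s \<noteq> {} \<and> e - s \<noteq> {})}"
proof -
  obtain \<sigma> where \<sigma>: "continuous_on (drawn_set G curve) \<sigma>"
    "\<And>x. x \<in> drawn_set G curve \<Longrightarrow> (\<Prod>e\<in>F. \<psi> e x) * (\<Prod>e\<in>F'. \<psi> e x) = (\<sigma> x)\<^sup>2"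
    using sq unfolding has_sqrt_def by metis
  have val: "(\<Prod>f\<in>H. \<psi> f (curve e t)) = (if e \<in> H then exp (2 * pi * \<i> * t) else 1)"
    if H: "H \<subseteq> edges G" and e: "e \<in> edges G" and t: "t \<in> {0..1}" for H e and t :: real
  proof -
    have "(\<Prod>f\<in>H. \<psi> f (curve e t)) = (\<Prod>f\<in>H. if f = e then exp (2 * pi * \<i> * t) else 1)"
      using \<psi>(1)[OF e t] \<psi>(2)[OF _ e _ t] H by (intro prod.cong) auto
    also have "\<dots> = (if e \<in> H then exp (2 * pi * \<i> * t) else 1)"
      using finite_subset[OF H fin] by (simp add: prod.delta)
    finally show ?thesis .
  qed
  define s where "s = {v \<in> verts G. \<sigma> (pos v) = 1}"
  have cut: "(e \<in> F') = ((e \<in> F) \<noteq> (e \<inter> s \<noteq> {} \<and> e - s \<noteq> {}))" if e: "e \<in> edges G" for e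
  proof -
    have arc: "arc (curve e)" and ends: "{curve e 0, curve e 1} = pos ` e"
      using dr e unfolding drawing_on_def by (auto simp: pathstart_def pathfinish_def)
    have cX: "curve e t \<in> drawn_set G curve" if "t \<in> {0..1}" for t
      using e that unfolding drawn_set_def path_image_def by blast
    \<comment> \<open>Along the edge the product of the two maps winds \<open>n\<close> times.\<close>
    define n :: nat where "n = (if e \<in> F then 1 else 0) + (if e \<in> F' then 1 else 0)"
    have s2: "(\<sigma> (curve e t))\<^sup>2 = (exp (n * pi * \<i> * t))\<^sup>2" if t: "t \<in> {0..1}" for t
    proof -
      define z where "z = exp (pi * \<i> * complex_of_real t)"
      have z2: "exp (2 * pi * \<i> * complex_of_real t) = z * z"
        unfolding z_def exp_add[symmetric] by (simp add: algebra_simps)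
      have zn: "exp (n * pi * \<i> * complex_of_real t) = z ^ n"
        unfolding z_def exp_of_nat_mult[symmetric] by (simp add: mult.assoc)
      show ?thesis
        using \<sigma>(2)[OF cX[OF t]] unfolding val[OF F(1) e t] val[OF F(2) e t] zn z2
        by (auto simp: n_def power2_eq_square mult.assoc split: if_splits)
    qed
    have cs: "continuous_on {0..1} (\<lambda>t. \<sigma> (curve e t))"
      using arc cX by (intro continuous_on_compose2[OF \<sigma>(1)]) (auto simp: arc_def path_def)
    have "(\<forall>t\<in>{0..1}. \<sigma> (curve e t) = exp (n * pi * \<i> * t)) \<or> (\<forall>t\<in>{0..1}. \<sigma> (curve e t) = - exp (n * pi * \<i> * t))"
      by (rule square_roots_differ_by_sign[OF _ cs]) (use s2 in \<open>auto intro!: continuous_intros\<close>)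
    moreover have "exp (n * pi * \<i> * complex_of_real 1) = (- 1) ^ n"
    proof -
      have "exp (n * pi * \<i> * complex_of_real 1) = exp (pi * \<i>) ^ n"
        unfolding exp_of_nat_mult[symmetric] by (simp add: mult.assoc)
      then show ?thesis by simp
    qed
    moreover have "exp (n * pi * \<i> * complex_of_real 0) = 1" by simp
    moreover have "0 \<in> {0..1::real}" "1 \<in> {0..1::real}" by auto
    ultimately have "\<exists>\<delta>\<in>{1, -1}. \<sigma> (curve e 0) = \<delta> \<and> \<sigma> (curve e 1) = \<delta> * (- 1) ^ n"
      by (smt (verit, best) insertI1 insertI2 mult_1 mult_minus1)
    then obtain \<delta> where \<delta>: "\<delta> \<in> {1, -1}" "\<sigma> (curve e 0) = \<delta>" "\<sigma> (curve e 1) = \<delta> * (- 1) ^ n" by blast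
    have flip: "(\<sigma> (curve e 0) = \<sigma> (curve e 1)) = even n" and
        pm: "\<sigma> (curve e 0) \<in> {1, -1}" "\<sigma> (curve e 1) \<in> {1, -1}"
      unfolding \<delta>(2,3) using \<delta>(1) by (cases "even n"; auto)+
    have im: "\<sigma> ` pos ` e = {\<sigma> (curve e 0), \<sigma> (curve e 1)}" unfolding ends[symmetric] by simp
    have "e \<inter> s \<noteq> {} \<longleftrightarrow> 1 \<in> \<sigma> ` pos ` e" using eV[OF e] unfolding s_def by auto
    moreover have "e - s \<noteq> {} \<longleftrightarrow> -1 \<in> \<sigma> ` pos ` e"
    proof -
      have "\<sigma> (pos v) \<in> {1, -1}" if "v \<in> e" for v
      proof -
        have "\<sigma> (pos v) \<in> {\<sigma> (curve e 0), \<sigma> (curve e 1)}" using im that by blast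
        then show ?thesis using pm by auto
      qed
      moreover have "(1::complex) \<noteq> -1" by simp
      ultimately show ?thesis using eV[OF e] unfolding s_def by (auto simp: image_iff) (metis one_neq_neg_one)+
    qed
    ultimately have "(e \<inter> s \<noteq> {} \<and> e - s \<noteq> {}) \<longleftrightarrow>
        (1 \<in> {\<sigma> (curve e 0), \<sigma> (curve e 1)} \<and> -1 \<in> {\<sigma> (curve e 0), \<sigma> (curve e 1)})"
      unfolding im by blast
    also have "\<dots> \<longleftrightarrow> \<sigma> (curve e 0) \<noteq> \<sigma> (curve e 1)"
    proof -
      have "\<sigma> (curve e 0) = 1 \<or> \<sigma> (curve e 0) = -1" "\<sigma> (curve e 1) = 1 \<or> \<sigma> (curve e 1) = -1"
        using pm by (simp_all only: insert_iff empty_iff) blast+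
      then show ?thesis by (elim disjE) (simp_all only: insert_iff empty_iff, simp_all)
    qed
    also have "\<dots> \<longleftrightarrow> odd n" using flip by blast
    finally show ?thesis unfolding n_def by (cases "e \<in> F"; cases "e \<in> F'"; simp)
  qed
  have F'eq: "F' = {e \<in> edges G. (e \<in> F) \<noteq> (e \<inter> s \<noteq> {} \<and> e - s \<noteq> {})}"
  proof (intro Set.set_eqI)
    fix e show "e \<in> F' \<longleftrightarrow> e \<in> {e \<in> edges G. (e \<in> F) \<noteq> (e \<inter> s \<noteq> {} \<and> e - s \<noteq> {})}"
    proof (cases "e \<in> edges G")
      case True
      then show ?thesis unfolding mem_Collect_eq using cut[OF True] by simp
    next
      case False
      then have "e \<notin> F'" using F(2) by blast
      then show ?thesis using False by simp
    qed
  qed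
  have "s \<subseteq> verts G" unfolding s_def by (rule Collect_subset)
  then show ?thesis using F'eq by (intro exI[of _ s] conjI)
qed

section \<open>Surfaces doubled from a disc with holes\<close>

definition holed_disc :: "nat \<Rightarrow> (nat \<Rightarrow> complex) \<Rightarrow> real \<Rightarrow> complex set" where
  "holed_disc k c r = cball 0 1 - (\<Union>i<k. ball (c i) r)"

definition holed_disc_rim :: "nat \<Rightarrow> (nat \<Rightarrow> complex) \<Rightarrow> real \<Rightarrow> complex set" where
  "holed_disc_rim k c r = sphere 0 1 \<union> (\<Union>i<k. sphere (c i) r)"

text \<open>Two copies \<open>A\<close> and \<open>B\<close> of a disc with \<open>k\<close> round holes, glued along all of their boundary circles; \<open>q\<close> folds both
onto the disc.  The double is a sphere with \<open>k\<close> handles, and the symmetric description reduces questions about it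
to questions about the plane.\<close>

locale doubled_disc =
  fixes S A B :: "'p::euclidean_space set" and q :: "'p \<Rightarrow> complex"
    and k :: nat and c :: "nat \<Rightarrow> complex" and r :: real
  assumes r: "0 < r"
    and holes_inside: "i < k \<Longrightarrow> cball (c i) r \<subseteq> ball 0 1"
    and holes_disjoint: "\<lbrakk>i < k; j < k; i \<noteq> j\<rbrakk> \<Longrightarrow> cball (c i) r \<inter> cball (c j) r = {}"
    and compact_sheets: "compact A" "compact B"
    and S_eq: "S = A \<union> B"
    and cont_q: "continuous_on S q"
    and inj_sheets: "inj_on q A" "inj_on q B"
    and q_sheets: "q ` A = holed_disc k c r" "q ` B = holed_disc k c r"
    and seam: "A \<inter> B = {x \<in> S. q x \<in> holed_disc_rim k c r}"
begin

lemma compact_S: "compact S"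
  using compact_sheets S_eq by auto

lemma cont_q_sheets: "continuous_on A q" "continuous_on B q"
  using cont_q S_eq by (auto intro: continuous_on_subset)

lemma swap: "doubled_disc S B A q k c r"
proof (rule doubled_disc.intro)
  show "S = B \<union> A" using S_eq by (simp only: Un_commute)
  show "B \<inter> A = {x \<in> S. q x \<in> holed_disc_rim k c r}" using seam by (simp only: Int_commute)
qed (fact r holes_inside holes_disjoint compact_sheets cont_q inj_sheets q_sheets)+

lemma rim_in_holed_disc: "holed_disc_rim k c r \<subseteq> holed_disc k c r"
proof
  fix z assume "z \<in> holed_disc_rim k c r"
  then consider "z \<in> sphere 0 1" | i where "i < k" "z \<in> sphere (c i) r"
    unfolding holed_disc_rim_def by auto
  then show "z \<in> holed_disc k c r"
  proof cases
    case 1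
    have "z \<notin> ball (c j) r" if "j < k" for j
    proof
      assume "z \<in> ball (c j) r"
      then have "z \<in> ball 0 1" using holes_inside[OF that] ball_subset_cball by blast
      then show False using 1 by simp
    qed
    then show ?thesis using 1 unfolding holed_disc_def by auto
  next
    case (2 i)
    have zi: "z \<in> cball (c i) r" using 2 by simp
    then have "z \<in> ball 0 1" using holes_inside[OF 2(1)] by blast
    moreover have "z \<notin> ball (c j) r" if "j < k" for j
    proof (cases "j = i")
      case True then show ?thesis using 2 by simp
    next
      case False
      then show ?thesis using holes_disjoint[OF that 2(1)] zi ball_subset_cball by blast
    qed
    ultimately show ?thesis unfolding holed_disc_def by auto
  qed
qed

lemma rim_interior_empty:
  assumes "open U" "U \<subseteq> holed_disc_rim k c r"
  shows "U = {}"
proof (rule ccontr)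
  assume "U \<noteq> {}"
  have "negligible (holed_disc_rim k c r)"
    unfolding holed_disc_rim_def by (intro negligible_Un negligible_sphere negligible_Union) (auto intro: negligible_sphere)
  then have "negligible U" using assms(2) negligible_subset by blast
  then show False using open_not_negligible[OF assms(1)] \<open>U \<noteq> {}\<close> by blast
qed

text \<open>The map is first extended to the seam.  This needs no puncture on the seam, since the finitely many punctures of
an extension to the plane can be placed off the seam.  The result is then extended to each of the two
copies, again off finitely many points, and the two extensions agree on the seam.\<close>

lemma circle_function_extends_off_finite:
  assumes X: "closedin (top_of_set S) X" and f: "continuous_on X f" "f ` X \<subseteq> sphere (0::complex) 1"
  shows "\<exists>K g. finite K \<and> K \<subseteq> S - X \<and> continuous_on (S - K) g \<and> g ` (S - K) \<subseteq> sphere 0 1 \<and> (\<forall>x\<in>X. g x = f x)"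
proof -
  let ?E = "A \<inter> B"
  have Xcl: "closed X" using closedin_closed_trans[OF X] compact_S compact_imp_closed by blast
  have XS: "X \<subseteq> S" using X closedin_imp_subset by blast
  have Ec: "compact ?E" using compact_sheets by (simp add: compact_Int)
  have XE: "compact (X \<inter> ?E)" using Xcl Ec closed_Int_compact by blast
  obtain K1 g1 where "finite K1" and g1: "K1 \<subseteq> - holed_disc_rim k c r" "K1 \<inter> q ` (X \<inter> ?E) = {}" "continuous_on (- K1) g1" "g1 ` (- K1) \<subseteq> sphere 0 1"
    "\<And>x. x \<in> X \<inter> ?E \<Longrightarrow> g1 (q x) = f x"
  proof (rule extend_through_embedding[OF XE, of q f "- holed_disc_rim k c r"])
    show "continuous_on (X \<inter> ?E) q" by (rule continuous_on_subset[OF cont_q_sheets(1)]) blast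
    show "inj_on q (X \<inter> ?E)" by (rule inj_on_subset[OF inj_sheets(1)]) blast
    show "continuous_on (X \<inter> ?E) f" by (rule continuous_on_subset[OF f(1)]) blast
    show "f ` (X \<inter> ?E) \<subseteq> sphere 0 1" using f(2) by blast
    fix C assume C: "C \<in> components (- q ` (X \<inter> ?E))"
    have "compact (q ` (X \<inter> ?E))"
      by (rule compact_continuous_image[OF _ XE]) (rule continuous_on_subset[OF cont_q_sheets(1)], blast)
    then have "open C" using C open_components compact_imp_closed open_Compl by blast
    then have "\<not> C \<subseteq> holed_disc_rim k c r" using rim_interior_empty C in_components_nonempty by blast
    then show "C \<inter> - holed_disc_rim k c r \<noteq> {}" by blast
  qed blast
  have Eq: "q x \<in> - K1" if "x \<in> ?E" for x using that g1(1) seam by blast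
  define f1 where "f1 = (\<lambda>x. if x \<in> X then f x else g1 (q x))"
  define Y where "Y = X \<union> ?E"
  have f1E: "f1 x = g1 (q x)" if "x \<in> ?E" for x using g1(5)[of x] that unfolding f1_def by auto
  have cf1: "continuous_on Y f1" unfolding Y_def
  proof (rule continuous_on_closed_Un[OF Xcl compact_imp_closed[OF Ec]])
    show "continuous_on X f1" by (rule continuous_on_eq[OF f(1)]) (simp add: f1_def)
    have "continuous_on ?E (\<lambda>x. g1 (q x))"
      by (rule continuous_on_compose2[OF g1(3) continuous_on_subset[OF cont_q_sheets(1)]]) (use Eq in auto)
    then show "continuous_on ?E f1" by (rule continuous_on_eq) (use f1E in auto)
  qed
  have nf1: "f1 ` Y \<subseteq> sphere 0 1"
  proof (rule image_subsetI)
    fix x assume "x \<in> Y"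
    then show "f1 x \<in> sphere 0 1"
    proof (cases "x \<in> X")
      case True
      then show ?thesis using f(2) unfolding f1_def by auto
    next
      case False
      then have "x \<in> ?E" using \<open>x \<in> Y\<close> unfolding Y_def by blast
      then have "g1 (q x) \<in> sphere 0 1" using Eq g1(4) by blast
      then show ?thesis using False unfolding f1_def by simp
    qed
  qed
  have Ycl: "closed Y" unfolding Y_def by (rule closed_Un[OF Xcl compact_imp_closed[OF Ec]])
  have half: "\<exists>K g. finite K \<and> K \<inter> q ` (Y \<inter> W) = {} \<and> continuous_on (- K) g \<and> g ` (- K) \<subseteq> sphere 0 1 \<and> (\<forall>x\<in>Y \<inter> W. g (q x) = f1 x)"
    if W: "compact W" "continuous_on W q" "inj_on q W" for W
  proof -
    have "compact (Y \<inter> W)" by (rule closed_Int_compact[OF Ycl W(1)])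
    then obtain K g where "finite K" "K \<inter> q ` (Y \<inter> W) = {}" "continuous_on (- K) g" "g ` (- K) \<subseteq> sphere 0 1" "\<And>x. x \<in> Y \<inter> W \<Longrightarrow> g (q x) = f1 x"
    proof (rule extend_through_embedding[of _ q f1 UNIV])
      show "continuous_on (Y \<inter> W) q" by (rule continuous_on_subset[OF W(2)]) blast
      show "inj_on q (Y \<inter> W)" by (rule inj_on_subset[OF W(3)]) blast
      show "continuous_on (Y \<inter> W) f1" by (rule continuous_on_subset[OF cf1]) blast
      show "f1 ` (Y \<inter> W) \<subseteq> sphere 0 1" using nf1 by blast
      show "C \<inter> UNIV \<noteq> {}" if "C \<in> components (- q ` (Y \<inter> W))" for C
        using in_components_nonempty[OF that] by simp
    qed blast
    then show ?thesis by blast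
  qed
  obtain KA gA where A: "finite KA" "KA \<inter> q ` (Y \<inter> A) = {}" "continuous_on (- KA) gA" "gA ` (- KA) \<subseteq> sphere 0 1" "\<forall>x\<in>Y \<inter> A. gA (q x) = f1 x"
    using half[OF compact_sheets(1) cont_q_sheets(1) inj_sheets(1)] by blast
  obtain KB gB where B: "finite KB" "KB \<inter> q ` (Y \<inter> B) = {}" "continuous_on (- KB) gB" "gB ` (- KB) \<subseteq> sphere 0 1" "\<forall>x\<in>Y \<inter> B. gB (q x) = f1 x"
    using half[OF compact_sheets(2) cont_q_sheets(2) inj_sheets(2)] by blast
  define K where "K = (A \<inter> q -` KA) \<union> (B \<inter> q -` KB)"
  define g where "g = (\<lambda>x. if x \<in> A then gA (q x) else gB (q x))"
  have gB': "g x = gB (q x)" if "x \<in> B" for x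
  proof (cases "x \<in> A")
    case True
    then have "x \<in> Y \<inter> A" "x \<in> Y \<inter> B" using that unfolding Y_def by auto
    then show ?thesis using A(5) B(5) True unfolding g_def by simp
  qed (simp add: g_def)
  have KE: "K \<inter> Y = {}" using A(2) B(2) unfolding K_def by blast
  have inA: "q x \<in> - KA" if "x \<in> A - K" for x using that unfolding K_def by blast
  have inB: "q x \<in> - KB" if "x \<in> B - K" for x using that unfolding K_def by blast
  have "finite (A \<inter> q -` KA)" "finite (B \<inter> q -` KB)"
    using finite_vimage_IntI[OF A(1) inj_sheets(1)] finite_vimage_IntI[OF B(1) inj_sheets(2)] by (simp_all add: Int_commute)
  then have finK: "finite K" unfolding K_def by simp
  have "continuous_on ((A - K) \<union> (B - K)) g"
  proof (rule continuous_on_Un_local)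
    show "closedin (top_of_set ((A - K) \<union> (B - K))) (A - K)"
      unfolding closedin_closed by (rule exI[of _ A]) (use compact_sheets compact_imp_closed in blast)
    show "closedin (top_of_set ((A - K) \<union> (B - K))) (B - K)"
      unfolding closedin_closed by (rule exI[of _ B]) (use compact_sheets compact_imp_closed in blast)
    have "continuous_on (A - K) (\<lambda>x. gA (q x))"
      by (rule continuous_on_compose2[OF A(3) continuous_on_subset[OF cont_q_sheets(1)]]) (use inA in auto)
    then show "continuous_on (A - K) g" by (rule continuous_on_eq) (simp add: g_def)
    have "continuous_on (B - K) (\<lambda>x. gB (q x))"
      by (rule continuous_on_compose2[OF B(3) continuous_on_subset[OF cont_q_sheets(2)]]) (use inB in auto)
    then show "continuous_on (B - K) g" by (rule continuous_on_eq) (use gB' in auto)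
  qed
  moreover have "S - K = (A - K) \<union> (B - K)" using S_eq by blast
  ultimately have cg: "continuous_on (S - K) g" by simp
  have ng: "g x \<in> sphere 0 1" if "x \<in> S - K" for x
  proof (cases "x \<in> A")
    case True
    then have "gA (q x) \<in> sphere 0 1" using inA[of x] that A(4) by blast
    then show ?thesis using True by (simp add: g_def)
  next
    case False
    then have "x \<in> B - K" using that S_eq by blast
    then have "gB (q x) \<in> sphere 0 1" using inB[of x] B(4) by blast
    then show ?thesis using False by (simp add: g_def)
  qed
  have "g x = f x" if "x \<in> X" for x
  proof -
    have "f1 x = f x" "x \<in> Y" "x \<in> A \<or> x \<in> B" using that XS S_eq unfolding f1_def Y_def by auto
    then show ?thesis using A(5) gB'[of x] B(5) unfolding g_def by auto
  qed
  moreover have "K \<subseteq> S - X" using KE S_eq unfolding K_def Y_def by blast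
  ultimately show ?thesis using finK cg ng by (intro exI[of _ K] exI[of _ g]) blast
qed

text \<open>On the disc with holes the class of a map modulo squares is given by a set of punctures and holes: after small discs
around the punctures are removed, every bounded component of the complement in the plane contains a puncture or the
centre of a hole.\<close>

lemma sheet_decomposition:
  assumes Y: "compact Y" "Y \<subseteq> A" and P: "finite P" "P \<subseteq> A" "P \<inter> Y = {}"
    and h: "continuous_on (A - P) h" "h ` (A - P) \<subseteq> sphere (0::complex) 1"
  shows "\<exists>N \<subseteq> q ` P \<union> c ` {..<k}. has_sqrt Y (\<lambda>x. h x * (\<Prod>p\<in>N. q x - p))"
proof -
  have PY: "compact (q ` P)" "compact (q ` Y)" "q ` P \<inter> q ` Y = {}"
  proof -
    show "compact (q ` P)" using P(1) by (simp add: finite_imp_compact)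
    show "compact (q ` Y)"
      by (rule compact_continuous_image[OF continuous_on_subset[OF cont_q_sheets(1)] Y(1)]) (use Y in auto)
    show "q ` P \<inter> q ` Y = {}" using inj_on_image_Int[OF inj_sheets(1) P(2) Y(2)] P(3) by simp
  qed
  then obtain d where d: "0 < d" "\<And>x y. x \<in> q ` P \<Longrightarrow> y \<in> q ` Y \<Longrightarrow> d \<le> dist x y"
    using separate_compact_closed[OF PY(1) compact_imp_closed[OF PY(2)] PY(3)] by blast
  define V where "V = (\<Union>p\<in>q ` P. ball p d)"
  define W where "W = A - q -` V"
  have Vo: "open V" unfolding V_def by (intro open_UN ballI open_ball)
  have "closedin (top_of_set A) (A - A \<inter> q -` V)"
    using continuous_openin_preimage_gen[OF cont_q_sheets(1) Vo] by (intro closedin_diff) auto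
  moreover have "A - A \<inter> q -` V = W" unfolding W_def by blast
  ultimately have Wc: "compact W" using closedin_compact[OF compact_sheets(1)] by simp
  have WP: "W \<subseteq> A - P" unfolding W_def V_def using d(1) by force
  have YW: "Y \<subseteq> W"
  proof
    fix y assume y: "y \<in> Y"
    have "q y \<notin> V"
    proof
      assume "q y \<in> V"
      then obtain p where "p \<in> q ` P" "dist p (q y) < d" unfolding V_def by auto
      then show False using d(2)[OF _ imageI[OF y], of p] by simp
    qed
    then show "y \<in> W" using y Y(2) unfolding W_def by blast
  qed
  have qW: "q ` W = holed_disc k c r - V" unfolding W_def q_sheets(1)[symmetric] by blast
  let ?L = "q ` P \<union> c ` {..<k}"
  obtain K g where K: "finite K" "K \<subseteq> ?L" "K \<inter> q ` W = {}" "continuous_on (- K) g" "g ` (- K) \<subseteq> sphere 0 1"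
    "\<And>x. x \<in> W \<Longrightarrow> g (q x) = h x"
  proof (rule extend_through_embedding[OF Wc, of q h ?L])
    show "continuous_on W q" by (rule continuous_on_subset[OF cont_q_sheets(1)]) (use WP in blast)
    show "inj_on q W" by (rule inj_on_subset[OF inj_sheets(1)]) (use WP in blast)
    show "continuous_on W h" by (rule continuous_on_subset[OF h(1) WP])
    show "h ` W \<subseteq> sphere 0 1" using h(2) WP by blast
    fix C assume C: "C \<in> components (- q ` W)" "bounded C"
    then obtain z where z: "z \<in> C" using in_components_nonempty by blast
    have "z \<in> - q ` W" using C(1) z in_components_subset by blast
    then consider "1 < norm z" | i where "i < k" "z \<in> ball (c i) r" | p where "p \<in> q ` P" "z \<in> ball p d"
      unfolding qW holed_disc_def V_def by fastforce
    then show "C \<inter> ?L \<noteq> {}"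
    proof cases
      case 1
      have conn: "connected (- cball (0::complex) 1)"
        by (rule connected_complement_bounded_convex) auto
      have "- cball 0 1 \<subseteq> - q ` W" unfolding qW holed_disc_def by fast
      moreover have "C \<inter> - cball 0 1 \<noteq> {}" using z 1 by auto
      ultimately have sub: "- cball 0 1 \<subseteq> C" by (intro components_maximal[OF C(1) conn])
      have "bounded (- cball (0::complex) 1)" by (rule bounded_subset[OF C(2) sub])
      then have "bounded (UNIV :: complex set)"
        using bounded_cball[of "0::complex" 1] by (metis Compl_partition2 bounded_Un)
      then show ?thesis by simp
    next
      case (2 i)
      have "ball (c i) r \<subseteq> - q ` W" unfolding qW holed_disc_def using 2 by blast
      then have "ball (c i) r \<subseteq> C" using components_maximal[OF C(1) connected_ball] z 2 by blast
      then have "c i \<in> C" using r by auto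
      then show ?thesis using 2(1) by blast
    next
      case (3 p)
      have "ball p d \<subseteq> - q ` W" unfolding qW V_def using 3 by blast
      then have "ball p d \<subseteq> C" using components_maximal[OF C(1) connected_ball] z 3 by blast
      then have "p \<in> C" using d(1) by auto
      then show ?thesis using 3(1) by blast
    qed
  qed blast
  have "closed (q ` Y)" using PY(2) compact_imp_closed by blast
  moreover have "q ` Y \<inter> K = {}" using K(3) YW by blast
  moreover have "g \<in> - K \<rightarrow> sphere 0 1" using K(5) by blast
  ultimately obtain N where N: "N \<subseteq> K" "has_sqrt (q ` Y) (\<lambda>z. g z * (\<Prod>p\<in>N. z - p))"
    using planar_sqrt_decomposition[OF K(1,4)] by blast
  then obtain \<sigma> where \<sigma>: "continuous_on (q ` Y) \<sigma>" "\<And>z. z \<in> q ` Y \<Longrightarrow> g z * (\<Prod>p\<in>N. z - p) = (\<sigma> z)\<^sup>2"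
    unfolding has_sqrt_def by metis
  have "has_sqrt Y (\<lambda>x. h x * (\<Prod>p\<in>N. q x - p))"
    unfolding has_sqrt_def
  proof (intro exI conjI ballI)
    show "continuous_on Y (\<lambda>x. \<sigma> (q x))"
      by (rule continuous_on_compose2[OF \<sigma>(1) continuous_on_subset[OF cont_q_sheets(1) Y(2)]]) simp
    show "h x * (\<Prod>p\<in>N. q x - p) = (\<sigma> (q x))\<^sup>2" if "x \<in> Y" for x
    proof -
      have "x \<in> W" using YW that by blast
      then show ?thesis using \<sigma>(2)[OF imageI[OF that]] K(6)[of x] by simp
    qed
  qed
  then show ?thesis using N(1) K(2) by blast
qed

end

section \<open>Counting faces from below\<close>

lemma has_sqrt_compose:
  assumes "has_sqrt T f" "continuous_on Z j" "j ` Z \<subseteq> T"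
  shows "has_sqrt Z (\<lambda>z. f (j z))"
proof -
  obtain \<sigma> where "continuous_on T \<sigma>" "\<And>y. y \<in> T \<Longrightarrow> f y = (\<sigma> y)\<^sup>2"
    using assms(1) unfolding has_sqrt_def by metis
  then show ?thesis unfolding has_sqrt_def
    using assms(2,3) continuous_on_compose2 by (intro exI[of _ "\<lambda>z. \<sigma> (j z)"]) blast
qed

text \<open>The fibre through \<open>F\<close> is contained in the image of the subsets of \<open>V\<close> under \<open>\<phi> F\<close>.\<close>

lemma card_le_by_fibres:
  assumes "finite D" "finite V" "\<And>F. F \<in> U \<Longrightarrow> \<Phi> F \<in> D"
    and "\<And>F F'. \<lbrakk>F \<in> U; F' \<in> U; \<Phi> F = \<Phi> F'\<rbrakk> \<Longrightarrow> \<exists>s \<subseteq> V. F' = \<phi> F s"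
  shows "card U \<le> card D * 2 ^ card V"
proof -
  define rep where "rep = (\<lambda>d. SOME F. F \<in> U \<and> \<Phi> F = d)"
  have rep: "rep (\<Phi> F) \<in> U \<and> \<Phi> (rep (\<Phi> F)) = \<Phi> F" if "F \<in> U" for F
    unfolding rep_def by (rule someI[of "\<lambda>G. G \<in> U \<and> \<Phi> G = \<Phi> F" F]) (use that in auto)
  have "U \<subseteq> (\<Union>d\<in>D. \<phi> (rep d) ` Pow V)"
  proof
    fix F assume F: "F \<in> U"
    then obtain s where "s \<subseteq> V" "F = \<phi> (rep (\<Phi> F)) s" using assms(4)[of "rep (\<Phi> F)" F] rep[OF F] by blast
    then show "F \<in> (\<Union>d\<in>D. \<phi> (rep d) ` Pow V)" using assms(3)[OF F] by blast
  qed
  then have "card U \<le> card (\<Union>d\<in>D. \<phi> (rep d) ` Pow V)"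
    by (rule card_mono[rotated]) (use assms in auto)
  also have "\<dots> \<le> (\<Sum>d\<in>D. card (\<phi> (rep d) ` Pow V))" by (rule card_UN_le[OF assms(1)])
  also have "\<dots> \<le> (\<Sum>d\<in>D. 2 ^ card V)"
    using assms(2) by (intro sum_mono) (metis card_Pow card_image_le finite_Pow_iff)
  finally show ?thesis by simp
qed

context doubled_disc
begin

lemma sheet_inverse:
  obtains j where "continuous_on (holed_disc k c r) j" "j ` holed_disc k c r \<subseteq> A"
    "\<And>z. z \<in> holed_disc k c r \<Longrightarrow> q (j z) = z" "\<And>x. x \<in> A \<Longrightarrow> j (q x) = x"
proof -
  obtain j where "homeomorphism A (holed_disc k c r) q j"
    using homeomorphism_compact[OF compact_sheets(1) cont_q_sheets(1) q_sheets(1) inj_sheets(1)] by blast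
  then show ?thesis by (intro that[of j]) (auto simp: homeomorphism_def)
qed

lemma seam_circle_connected:
  assumes "connected T" "T \<subseteq> holed_disc_rim k c r"
  shows "connected {x \<in> A \<inter> B. q x \<in> T}"
proof -
  obtain j where j: "continuous_on (holed_disc k c r) j" "j ` holed_disc k c r \<subseteq> A"
    "\<And>z. z \<in> holed_disc k c r \<Longrightarrow> q (j z) = z" "\<And>x. x \<in> A \<Longrightarrow> j (q x) = x"
    using sheet_inverse by blast
  have T: "T \<subseteq> holed_disc k c r" using assms(2) rim_in_holed_disc by blast
  have "{x \<in> A \<inter> B. q x \<in> T} = j ` T"
  proof
    show "{x \<in> A \<inter> B. q x \<in> T} \<subseteq> j ` T" using j(4) by force
    show "j ` T \<subseteq> {x \<in> A \<inter> B. q x \<in> T}"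
    proof (rule image_subsetI)
      fix z assume z: "z \<in> T"
      then have "j z \<in> A" "q (j z) = z" using T j(2,3) by blast+
      moreover from this have "j z \<in> A \<inter> B" unfolding seam using z assms(2) S_eq by auto
      ultimately show "j z \<in> {x \<in> A \<inter> B. q x \<in> T}" using z by simp
    qed
  qed
  moreover have "connected (j ` T)" by (rule connected_continuous_image[OF continuous_on_subset[OF j(1) T] assms(1)])
  ultimately show ?thesis by simp
qed

text \<open>Square roots \<open>\<sigma>\<close> on the copy \<open>A\<close> and \<open>\<tau>\<close> on the copy \<open>B\<close> differ by a sign on each circle of the seam.  The set \<open>J\<close> collects
the holes at which the sign is -1; on the outer circle the roots agree.\<close>

definition seam_signs :: "'p set \<Rightarrow> ('p \<Rightarrow> complex) \<Rightarrow> nat set \<Rightarrow> bool" where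
  "seam_signs Y h J \<longleftrightarrow> J \<subseteq> {..<k} \<and> (\<exists>\<sigma> \<tau>. continuous_on (Y \<inter> A) \<sigma> \<and> continuous_on (Y \<inter> B) \<tau> \<and>
     (\<forall>x\<in>Y \<inter> A. h x = (\<sigma> x)\<^sup>2) \<and> (\<forall>x\<in>Y \<inter> B. h x = (\<tau> x)\<^sup>2) \<and>
     (\<forall>x\<in>A \<inter> B. \<sigma> x = (if \<exists>i\<in>J. q x \<in> sphere (c i) r then - \<tau> x else \<tau> x)))"

text \<open>The sign on the outer circle is normalised by changing the sign of one of the roots, which saves one bit.\<close>

lemma seam_signs_exist:
  assumes "has_sqrt (Y \<inter> A) h" "has_sqrt (Y \<inter> B) h" "A \<inter> B \<subseteq> Y" "\<And>x. x \<in> Y \<Longrightarrow> h x \<noteq> 0"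
  shows "\<exists>J. seam_signs Y h J"
proof -
  obtain \<sigma> where \<sigma>: "continuous_on (Y \<inter> A) \<sigma>" "\<And>x. x \<in> Y \<inter> A \<Longrightarrow> h x = (\<sigma> x)\<^sup>2"
    using assms(1) unfolding has_sqrt_def by metis
  obtain \<tau> where \<tau>: "continuous_on (Y \<inter> B) \<tau>" "\<And>x. x \<in> Y \<inter> B \<Longrightarrow> h x = (\<tau> x)\<^sup>2"
    using assms(2) unfolding has_sqrt_def by metis
  have sgn: "(\<forall>x\<in>C. \<sigma> x = \<tau> x) \<or> (\<forall>x\<in>C. \<sigma> x = - \<tau> x)" if C: "connected C" "C \<subseteq> A \<inter> B" for C
  proof (rule square_roots_differ_by_sign[OF C(1)])
    show "continuous_on C \<sigma>" by (rule continuous_on_subset[OF \<sigma>(1)]) (use C(2) assms(3) in blast)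
    show "continuous_on C \<tau>" by (rule continuous_on_subset[OF \<tau>(1)]) (use C(2) assms(3) in blast)
    fix x assume "x \<in> C"
    then have x: "x \<in> Y \<inter> A" "x \<in> Y \<inter> B" using C(2) assms(3) by blast+
    show "(\<sigma> x)\<^sup>2 = (\<tau> x)\<^sup>2" using \<sigma>(2)[OF x(1)] \<tau>(2)[OF x(2)] by simp
    show "\<tau> x \<noteq> 0" using \<tau>(2)[OF x(2)] assms(4)[of x] x by force
  qed
  let ?Outer = "{x \<in> A \<inter> B. q x \<in> sphere 0 1}"
  let ?C = "\<lambda>i. {x \<in> A \<inter> B. q x \<in> sphere (c i) r}"
  have sph: "connected (sphere a b :: complex set)" for a b by (rule connected_sphere) simp
  have "connected ?Outer" by (rule seam_circle_connected[OF sph]) (auto simp: holed_disc_rim_def)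
  then have "(\<forall>x\<in>?Outer. \<sigma> x = \<tau> x) \<or> (\<forall>x\<in>?Outer. \<sigma> x = - \<tau> x)" by (rule sgn) blast
  then have "\<exists>d::complex. (d = 1 \<or> d = -1) \<and> (\<forall>x\<in>?Outer. \<sigma> x = d * \<tau> x)"
  proof
    assume "\<forall>x\<in>?Outer. \<sigma> x = \<tau> x"
    then show ?thesis by (intro exI[of _ 1]) simp
  next
    assume "\<forall>x\<in>?Outer. \<sigma> x = - \<tau> x"
    then show ?thesis by (intro exI[of _ "-1"]) simp
  qed
  then obtain d :: complex where d: "d = 1 \<or> d = -1" "\<forall>x\<in>?Outer. \<sigma> x = d * \<tau> x" by blast
  define \<tau>' where "\<tau>' = (\<lambda>x. d * \<tau> x)"
  define J where "J = {i. i < k \<and> (\<exists>x\<in>?C i. \<sigma> x \<noteq> \<tau>' x)}"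
  have Ci: "(\<forall>x\<in>?C i. \<sigma> x = \<tau>' x) \<or> (\<forall>x\<in>?C i. \<sigma> x = - \<tau>' x)" if "i < k" for i
  proof -
    have "connected (?C i)" by (rule seam_circle_connected[OF sph]) (use that in \<open>auto simp: holed_disc_rim_def\<close>)
    then have "(\<forall>x\<in>?C i. \<sigma> x = \<tau> x) \<or> (\<forall>x\<in>?C i. \<sigma> x = - \<tau> x)" by (rule sgn) blast
    then show ?thesis using d(1) unfolding \<tau>'_def by auto
  qed
  have "\<sigma> x = (if \<exists>i\<in>J. q x \<in> sphere (c i) r then - \<tau>' x else \<tau>' x)" if x: "x \<in> A \<inter> B" for x
  proof (cases "\<exists>i\<in>J. q x \<in> sphere (c i) r")
    case True
    then obtain i where i: "i \<in> J" "q x \<in> sphere (c i) r" by blast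
    then have "\<forall>x\<in>?C i. \<sigma> x = - \<tau>' x" using Ci[of i] unfolding J_def by blast
    then have "\<sigma> x = - \<tau>' x" using i x by blast
    then show ?thesis using True by simp
  next
    case False
    have "q x \<in> holed_disc_rim k c r" using x unfolding seam by blast
    then consider "q x \<in> sphere 0 1" | i where "i < k" "q x \<in> sphere (c i) r" unfolding holed_disc_rim_def by blast
    then have "\<sigma> x = \<tau>' x"
    proof cases
      case 1 then show ?thesis using d(2) x unfolding \<tau>'_def by blast
    next
      case (2 i)
      then have "i \<notin> J" using False by blast
      then have "\<forall>x\<in>?C i. \<sigma> x = \<tau>' x" using 2(1) unfolding J_def by blast
      then show ?thesis using 2(2) x by blast
    qed
    then show ?thesis using False by simp
  qed
  moreover have "continuous_on (Y \<inter> B) \<tau>'" unfolding \<tau>'_def by (intro continuous_intros \<tau>(1))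
  moreover have "h x = (\<tau>' x)\<^sup>2" if "x \<in> Y \<inter> B" for x
    using \<tau>(2)[OF that] d(1) unfolding \<tau>'_def by auto
  moreover have "J \<subseteq> {..<k}" unfolding J_def by blast
  ultimately have "seam_signs Y h J"
    unfolding seam_signs_def using \<sigma> by (intro conjI exI[of _ \<sigma>] exI[of _ \<tau>']) auto
  then show ?thesis by blast
qed

text \<open>Where both pairs of roots disagree by -1, their products agree, so the products of the roots are compatible along the
whole seam.\<close>

lemma equal_seam_signs_sqrt:
  assumes "seam_signs Y h J" "seam_signs Y h' J" "closed Y" "Y \<subseteq> S"
  shows "has_sqrt Y (\<lambda>x. h x * h' x)"
proof -
  obtain \<sigma> \<tau> where h: "continuous_on (Y \<inter> A) \<sigma>" "continuous_on (Y \<inter> B) \<tau>"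
     "\<forall>x\<in>Y \<inter> A. h x = (\<sigma> x)\<^sup>2" "\<forall>x\<in>Y \<inter> B. h x = (\<tau> x)\<^sup>2"
     "\<forall>x\<in>A \<inter> B. \<sigma> x = (if \<exists>i\<in>J. q x \<in> sphere (c i) r then - \<tau> x else \<tau> x)"
    using assms(1) unfolding seam_signs_def by blast
  obtain \<sigma>' \<tau>' where h': "continuous_on (Y \<inter> A) \<sigma>'" "continuous_on (Y \<inter> B) \<tau>'"
     "\<forall>x\<in>Y \<inter> A. h' x = (\<sigma>' x)\<^sup>2" "\<forall>x\<in>Y \<inter> B. h' x = (\<tau>' x)\<^sup>2"
     "\<forall>x\<in>A \<inter> B. \<sigma>' x = (if \<exists>i\<in>J. q x \<in> sphere (c i) r then - \<tau>' x else \<tau>' x)"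
    using assms(2) unfolding seam_signs_def by blast
  define u where "u = (\<lambda>x. if x \<in> A then \<sigma> x * \<sigma>' x else \<tau> x * \<tau>' x)"
  have uB: "u x = \<tau> x * \<tau>' x" if "x \<in> Y \<inter> B" for x
  proof (cases "x \<in> A")
    case True
    then have "x \<in> A \<inter> B" using that by blast
    then have "\<sigma> x * \<sigma>' x = \<tau> x * \<tau>' x" using h(5) h'(5) by (cases "\<exists>i\<in>J. q x \<in> sphere (c i) r") auto
    then show ?thesis using True by (simp add: u_def)
  qed (simp add: u_def)
  have "continuous_on ((Y \<inter> A) \<union> (Y \<inter> B)) u"
  proof (rule continuous_on_closed_Un)
    show "closed (Y \<inter> A)" "closed (Y \<inter> B)"
      using assms(3) compact_sheets by (auto intro: closed_Int compact_imp_closed)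
    have "continuous_on (Y \<inter> A) (\<lambda>x. \<sigma> x * \<sigma>' x)" by (intro continuous_intros h h')
    then show "continuous_on (Y \<inter> A) u" by (rule continuous_on_eq) (simp add: u_def)
    have "continuous_on (Y \<inter> B) (\<lambda>x. \<tau> x * \<tau>' x)" by (intro continuous_intros h h')
    then show "continuous_on (Y \<inter> B) u" by (rule continuous_on_eq) (use uB in auto)
  qed
  moreover have "(Y \<inter> A) \<union> (Y \<inter> B) = Y" using assms(4) S_eq by blast
  moreover have "h x * h' x = (u x)\<^sup>2" if "x \<in> Y" for x
  proof (cases "x \<in> A")
    case True
    then show ?thesis using h(3) h'(3) that unfolding u_def by (simp add: power_mult_distrib)
  next
    case False
    then have "x \<in> Y \<inter> B" using that assms(4) S_eq by blast
    then show ?thesis using h(4) h'(4) False unfolding u_def by (simp add: power_mult_distrib)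
  qed
  ultimately show ?thesis unfolding has_sqrt_def by (intro exI[of _ u]) auto
qed

text \<open>By invariance of domain an open subset of the seam would be mapped by \<open>q\<close> to a set with interior points in the
boundary circles.\<close>

lemma open_not_subset_seam:
  assumes "locally_disc S" "openin (top_of_set S) U" "U \<subseteq> A \<inter> B"
  shows "U = {}"
proof (rule ccontr)
  assume "U \<noteq> {}"
  then obtain x where "x \<in> U" by blast
  then obtain h where h: "embedded_disc S h" "h ` cball 0 1 \<subseteq> U"
    using locally_discE[OF assms(1,2)] by metis
  have sub: "h ` ball 0 1 \<subseteq> A \<inter> B" using h(2) assms(3) ball_subset_cball by blast
  have ch: "continuous_on (ball 0 1) h" "inj_on h (ball 0 1)"
    using h(1) unfolding embedded_disc_def by (auto intro: continuous_on_subset inj_on_subset)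
  have "continuous_on (ball 0 1) (\<lambda>z. q (h z))"
    by (rule continuous_on_compose2[OF cont_q_sheets(1) ch(1)]) (use sub in blast)
  moreover have "inj_on (\<lambda>z. q (h z)) (ball 0 1)"
    using comp_inj_on[OF ch(2) inj_on_subset[OF inj_sheets(1)], of] sub by (simp add: comp_def)
  ultimately have "open ((\<lambda>z. q (h z)) ` ball 0 1)"
    by (intro invariance_of_domain) auto
  moreover have "(\<lambda>z. q (h z)) ` ball 0 1 \<subseteq> holed_disc_rim k c r" using sub seam by blast
  ultimately have "(\<lambda>z. q (h z)) ` ball 0 1 = {}" by (rule rim_interior_empty)
  then show False by simp
qed

text \<open>Subsets \<open>F\<close> of the edges are counted by the data that determine the square class of their winding maps.  These are the
punctures and holes with odd winding on the copy \<open>A\<close>, the punctures with odd winding on the copy \<open>B\<close>, and the signs at the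
holes.\<close>

lemma edges_le_vertices_faces:
  assumes S: "locally_disc S" and dr: "drawing_on S G pos curve"
    and fin: "finite (verts G)" "finite (edges G)"
    and eV: "\<And>e. e \<in> edges G \<Longrightarrow> e \<subseteq> verts G"
    and faces: "finite (components (S - drawn_set G curve))"
  shows "card (edges G) \<le> card (verts G) + card (components (S - drawn_set G curve)) + 2 * k"
proof -
  let ?X = "drawn_set G curve" and ?E = "A \<inter> B"
  let ?F = "components (S - ?X)"
  have arcs: "arc (curve e)" "path_image (curve e) \<subseteq> S" if "e \<in> edges G" for e
    using dr that unfolding drawing_on_def by auto
  have XS: "?X \<subseteq> S" unfolding drawn_set_def using arcs by blast
  have Xcl: "closed ?X" unfolding drawn_set_def using fin arcs by (intro closed_UN) (auto intro: closed_arc_image)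
  have Xc: "closedin (top_of_set S) ?X" by (rule closed_subset[OF XS Xcl])
  have opW: "openin (top_of_set S) (S - ?X)" using Xc by (intro openin_diff) auto
  \<comment> \<open>One point in each face, off the seam so that it belongs to only one of the two copies.\<close>
  have "\<exists>l. l \<in> C \<and> l \<notin> ?E" if C: "C \<in> ?F" for C
    using open_not_subset_seam[OF S openin_component_locally_disc[OF S opW C]] in_components_nonempty[OF C] by blast
  then obtain l where l: "\<And>C. C \<in> ?F \<Longrightarrow> l C \<in> C \<and> l C \<notin> ?E" by metis
  define L where "L = l ` ?F"
  have finL: "finite L" and cardL: "card L \<le> card ?F" unfolding L_def using faces card_image_le by auto
  have LX: "L \<subseteq> S - ?X" unfolding L_def using l in_components_subset by blast
  have LE: "L \<inter> ?E = {}" unfolding L_def using l by blast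
  obtain \<psi> where \<psi>: "\<And>e. e \<in> edges G \<Longrightarrow> continuous_on ?X (\<psi> e)"
    "\<And>e x. e \<in> edges G \<Longrightarrow> x \<in> ?X \<Longrightarrow> norm (\<psi> e x) = 1"
    "\<And>e t. e \<in> edges G \<Longrightarrow> t \<in> {0..1} \<Longrightarrow> \<psi> e (curve e t) = exp (2 * pi * \<i> * complex_of_real t)"
    "\<And>e f t. e \<in> edges G \<Longrightarrow> f \<in> edges G \<Longrightarrow> e \<noteq> f \<Longrightarrow> t \<in> {0..1} \<Longrightarrow> \<psi> e (curve f t) = 1"
    by (rule edge_functions[OF dr fin(2)]) (rule that)
  have "\<exists>g. continuous_on (S - L) g \<and> g ` (S - L) \<subseteq> sphere 0 1 \<and> (\<forall>x\<in>?X. g x = (\<Prod>e\<in>F. \<psi> e x))"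
    if F: "F \<in> Pow (edges G)" for F
  proof -
    have f: "continuous_on ?X (\<lambda>x. \<Prod>e\<in>F. \<psi> e x)"
      using F \<psi>(1) by (intro continuous_on_prod) auto
    have nf: "(\<lambda>x. \<Prod>e\<in>F. \<psi> e x) ` ?X \<subseteq> sphere 0 1"
    proof (rule image_subsetI)
      fix x assume x: "x \<in> ?X"
      have "norm (\<Prod>e\<in>F. \<psi> e x) = (\<Prod>e\<in>F. norm (\<psi> e x))" by (rule prod_norm[symmetric])
      also have "\<dots> = (\<Prod>e\<in>F. 1)" using \<psi>(2)[OF _ x] F by (intro prod.cong) auto
      finally show "(\<Prod>e\<in>F. \<psi> e x) \<in> sphere 0 1" by simp
    qed
    obtain K g0 where K: "finite K" "K \<subseteq> S - ?X" "continuous_on (S - K) g0" "g0 ` (S - K) \<subseteq> sphere 0 1"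
        "\<forall>x\<in>?X. g0 x = (\<Prod>e\<in>F. \<psi> e x)"
      using circle_function_extends_off_finite[OF Xc f nf] by blast
    have "C \<inter> L \<noteq> {}" if "C \<in> ?F" for C using l[OF that] that unfolding L_def by blast
    then obtain K' g where K': "K' \<subseteq> L \<inter> (S - ?X)" "continuous_on (S - K') g" "g ` (S - K') \<subseteq> sphere 0 1" "\<forall>x\<in>?X. g x = g0 x"
      using punctures_into_transversal[OF S Xc _ K(1-4), of L] by blast
    have "S - L \<subseteq> S - K'" using K'(1) by blast
    then show ?thesis using K' K(5) continuous_on_subset by (intro exI[of _ g]) fastforce
  qed
  then obtain g where g: "\<And>F. F \<in> Pow (edges G) \<Longrightarrow> continuous_on (S - L) (g F)"
      "\<And>F. F \<in> Pow (edges G) \<Longrightarrow> g F ` (S - L) \<subseteq> sphere 0 1"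
      "\<And>F x. F \<in> Pow (edges G) \<Longrightarrow> x \<in> ?X \<Longrightarrow> g F x = (\<Prod>e\<in>F. \<psi> e x)" by metis
  define Y where "Y = ?X \<union> ?E"
  have Ycl: "closed Y" unfolding Y_def using Xcl compact_sheets compact_imp_closed by (intro closed_Un closed_Int) auto
  have YS: "Y \<subseteq> S - L" unfolding Y_def using LX LE XS S_eq by blast
  have gY: "continuous_on Y (g F)" "\<And>x. x \<in> Y \<Longrightarrow> g F x \<noteq> 0" if F: "F \<in> Pow (edges G)" for F
  proof -
    show "continuous_on Y (g F)" by (rule continuous_on_subset[OF g(1)[OF F] YS])
    show "g F x \<noteq> 0" if "x \<in> Y" for x
    proof -
      have "g F x \<in> sphere 0 1" using g(2)[OF F] YS that by blast
      then show ?thesis by auto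
    qed
  qed
  let ?c = "c ` {..<k}"
  define PA where "PA = q ` (L \<inter> A)"
  define PB where "PB = q ` (L \<inter> B)"
  have finP: "finite PA" "finite PB" "finite ?c" unfolding PA_def PB_def using finL by auto
  have YAB: "compact (Y \<inter> A)" "compact (Y \<inter> B)" using Ycl compact_sheets closed_Int_compact by blast+
  have decA: "\<exists>N \<subseteq> PA \<union> ?c. has_sqrt (Y \<inter> A) (\<lambda>x. g F x * (\<Prod>p\<in>N. q x - p))" if F: "F \<in> Pow (edges G)" for F
    unfolding PA_def
  proof (rule sheet_decomposition[OF YAB(1)])
    have "A - L \<inter> A \<subseteq> S - L" using S_eq by blast
    then show "continuous_on (A - L \<inter> A) (g F)" "g F ` (A - L \<inter> A) \<subseteq> sphere 0 1"
      using g(1,2)[OF F] continuous_on_subset by blast+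
  qed (use finL YS in auto)
  then obtain NA where NA: "\<And>F. F \<in> Pow (edges G) \<Longrightarrow> NA F \<subseteq> PA \<union> ?c"
     "\<And>F. F \<in> Pow (edges G) \<Longrightarrow> has_sqrt (Y \<inter> A) (\<lambda>x. g F x * (\<Prod>p\<in>NA F. q x - p))" by metis
  have decB: "\<exists>N \<subseteq> PB \<union> ?c. has_sqrt (Y \<inter> B) (\<lambda>x. g F x * (\<Prod>p\<in>N. q x - p))" if F: "F \<in> Pow (edges G)" for F
    unfolding PB_def
  proof (rule doubled_disc.sheet_decomposition[OF swap YAB(2)])
    have "B - L \<inter> B \<subseteq> S - L" using S_eq by blast
    then show "continuous_on (B - L \<inter> B) (g F)" "g F ` (B - L \<inter> B) \<subseteq> sphere 0 1"
      using g(1,2)[OF F] continuous_on_subset by blast+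
  qed (use finL YS in auto)
  then obtain NB where NB: "\<And>F. F \<in> Pow (edges G) \<Longrightarrow> NB F \<subseteq> PB \<union> ?c"
     "\<And>F. F \<in> Pow (edges G) \<Longrightarrow> has_sqrt (Y \<inter> B) (\<lambda>x. g F x * (\<Prod>p\<in>NB F. q x - p))" by metis
  have Lhd: "q x \<in> holed_disc k c r" "q x \<notin> holed_disc_rim k c r" if "x \<in> L" for x
  proof -
    have "x \<in> S" "x \<notin> A \<inter> B" using that LX LE by blast+
    then show "q x \<in> holed_disc k c r" "q x \<notin> holed_disc_rim k c r" using q_sheets S_eq seam by blast+
  qed
  have Pfar: "p \<notin> cball (c i) r" if p: "p \<in> PB" "i < k" for p i
  proof -
    obtain x where "x \<in> L" "p = q x" using p(1) unfolding PB_def by blast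
    then show ?thesis using Lhd[of x] p(2) unfolding holed_disc_def holed_disc_rim_def by force
  qed
  have cfar: "c j \<notin> cball (c i) r" if "j < k" "i < k" "c j \<noteq> c i" for i j
  proof -
    have "i \<noteq> j" using that(3) by blast
    moreover have "c j \<in> cball (c j) r" using r by simp
    ultimately show ?thesis using holes_disjoint[OF that(2,1)] by blast
  qed
  have finN: "finite (NA F)" "finite (NB F)" if "F \<in> Pow (edges G)" for F
    using NA(1)[OF that] NB(1)[OF that] finP finite_subset by blast+
  have nz: "q x \<noteq> p" if W: "W = A \<or> W = B" and x: "x \<in> Y \<inter> W" and p: "p \<in> q ` (L \<inter> W) \<union> ?c" for W x p
  proof
    assume eq: "q x = p"
    have "q ` W = holed_disc k c r" "inj_on q W" using W q_sheets inj_sheets by auto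
    then have hd: "q x \<in> holed_disc k c r" and inj: "inj_on q W" using x by auto
    show False
    proof (cases "p \<in> ?c")
      case True
      then obtain i where "i < k" "p = c i" by blast
      then show False using hd r unfolding eq holed_disc_def by force
    next
      case False
      then obtain y where y: "y \<in> L \<inter> W" "q x = q y" using eq p by blast
      then have "x = y" using inj_onD[OF inj] x by blast
      then show False using y(1) x YS by blast
    qed
  qed
  define prd where "prd = (\<lambda>N x. \<Prod>p\<in>N. q x - p)"
  have nzA: "prd (NA F) x \<noteq> 0" if F: "F \<in> Pow (edges G)" and x: "x \<in> Y \<inter> A" for F x
  proof -
    have "q x \<noteq> p" if "p \<in> NA F" for p
      by (rule nz[OF _ x]) (use subsetD[OF NA(1)[OF F] that] PA_def in auto)
    then show ?thesis using finN(1)[OF F] unfolding prd_def by (subst prod_zero_iff) auto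
  qed
  have nzB: "prd (NB F) x \<noteq> 0" if F: "F \<in> Pow (edges G)" and x: "x \<in> Y \<inter> B" for F x
  proof -
    have "q x \<noteq> p" if "p \<in> NB F" for p
      by (rule nz[OF _ x]) (use subsetD[OF NB(1)[OF F] that] PB_def in auto)
    then show ?thesis using finN(2)[OF F] unfolding prd_def by (subst prod_zero_iff) auto
  qed
  have cprd: "continuous_on (Y \<inter> W) (prd N)" if "W = A \<or> W = B" for W N
  proof -
    have "continuous_on (Y \<inter> W) q" by (rule continuous_on_subset[OF cont_q]) (use YS in blast)
    then show ?thesis unfolding prd_def by (intro continuous_intros)
  qed
  have sqA: "has_sqrt (Y \<inter> A) (\<lambda>x. g F x * g F' x)"
    if F: "F \<in> Pow (edges G)" "F' \<in> Pow (edges G)" and eq: "NA F = NA F'" for F F'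
  proof (rule has_sqrt_trans[of _ _ "prd (NA F)"])
    show "has_sqrt (Y \<inter> A) (\<lambda>x. g F x * prd (NA F) x)" using NA(2)[OF F(1)] unfolding prd_def .
    show "has_sqrt (Y \<inter> A) (\<lambda>x. prd (NA F) x * g F' x)"
      using NA(2)[OF F(2)] unfolding prd_def eq by (simp only: mult.commute)
  qed (use cprd nzA[OF F(1)] in auto)
  \<comment> \<open>On the boundary circle of a hole the winding number is the same from both sides.  So the holes with odd winding on the copy
    \<open>A\<close> determine those on the copy \<open>B\<close>, and their bits need not be counted again.\<close>
  have NBsub: "c i \<in> NB F'"
    if F: "F \<in> Pow (edges G)" "F' \<in> Pow (edges G)" and eq: "NA F = NA F'" and i: "i < k" "c i \<in> NB F" for F F' i
  proof (rule ccontr)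
    assume notin: "c i \<notin> NB F'"
    let ?T = "{x \<in> A \<inter> B. q x \<in> sphere (c i) r}"
    have TY: "?T \<subseteq> Y \<inter> A" "?T \<subseteq> Y \<inter> B" unfolding Y_def by blast+
    have cg: "continuous_on ?T (g F)" "continuous_on ?T (g F')"
      using continuous_on_subset[OF gY(1)] F TY by blast+
    have nzg: "g F x \<noteq> 0" "g F' x \<noteq> 0" if "x \<in> ?T" for x using gY(2)[OF F(1)] gY(2)[OF F(2)] TY that by blast+
    have 1: "has_sqrt ?T (\<lambda>x. prd (NB F) x * g F x)"
      using has_sqrt_subset[OF NB(2)[OF F(1)] TY(2)] unfolding prd_def by (simp only: mult.commute)
    have 2: "has_sqrt ?T (\<lambda>x. g F x * g F' x)" by (rule has_sqrt_subset[OF sqA[OF F eq] TY(1)])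
    have 3: "has_sqrt ?T (\<lambda>x. g F' x * prd (NB F') x)"
      using has_sqrt_subset[OF NB(2)[OF F(2)] TY(2)] unfolding prd_def .
    have "has_sqrt ?T (\<lambda>x. prd (NB F) x * prd (NB F') x)"
      by (rule has_sqrt_trans[OF has_sqrt_trans[OF 1 2 cg(1) nzg(1)] 3 cg(2) nzg(2)])
    moreover obtain j where j: "continuous_on (holed_disc k c r) j" "j ` holed_disc k c r \<subseteq> A"
      "\<And>z. z \<in> holed_disc k c r \<Longrightarrow> q (j z) = z"
      using sheet_inverse by metis
    have rim: "sphere (c i) r \<subseteq> holed_disc_rim k c r" unfolding holed_disc_rim_def using i(1) by blast
    then have hd: "sphere (c i) r \<subseteq> holed_disc k c r" using rim_in_holed_disc by blast
    have jT: "j ` sphere (c i) r \<subseteq> ?T"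
    proof (rule image_subsetI)
      fix z assume z: "z \<in> sphere (c i) r"
      then have "z \<in> holed_disc k c r" using hd by blast
      then have jz: "j z \<in> A" "q (j z) = z" using j(2,3) by blast+
      moreover have "j z \<in> A \<inter> B" unfolding seam using jz z rim S_eq by auto
      ultimately show "j z \<in> ?T" using z by simp
    qed
    ultimately have "has_sqrt (sphere (c i) r) (\<lambda>z. prd (NB F) (j z) * prd (NB F') (j z))"
      using has_sqrt_compose[OF _ continuous_on_subset[OF j(1) hd] jT] by blast
    then have "has_sqrt (sphere (c i) r) (\<lambda>z. (\<Prod>p\<in>NB F. z - p) * (\<Prod>p\<in>NB F'. z - p))"
    proof (rule has_sqrt_cong)
      fix z assume "z \<in> sphere (c i) r"
      then have "q (j z) = z" using hd j(3) by blast
      then show "prd (NB F) (j z) * prd (NB F') (j z) = (\<Prod>p\<in>NB F. z - p) * (\<Prod>p\<in>NB F'. z - p)"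
        unfolding prd_def by simp
    qed
    moreover have "p \<notin> cball (c i) r" if p: "p \<in> NB F \<union> NB F'" "p \<noteq> c i" for p
    proof -
      have "p \<in> PB \<union> ?c" using p(1) NB(1)[OF F(1)] NB(1)[OF F(2)] by blast
      then show ?thesis using Pfar[OF _ i(1)] cfar[OF _ i(1)] p(2) by blast
    qed
    ultimately show False
      using no_sqrt_prod_on_circle[OF r finN(2)[OF F(1)] finN(2)[OF F(2)] i(2) notin] by blast
  qed
  have sqB: "has_sqrt (Y \<inter> B) (\<lambda>x. g F x * g F' x)"
    if F: "F \<in> Pow (edges G)" "F' \<in> Pow (edges G)" and eq: "NA F = NA F'" "NB F \<inter> PB = NB F' \<inter> PB" for F F'
  proof -
    have "NB F = NB F'"
    proof
      show "NB F \<subseteq> NB F'" using NB(1)[OF F(1)] NBsub[OF F eq(1)] eq(2) by blast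
      show "NB F' \<subseteq> NB F" using NB(1)[OF F(2)] NBsub[OF F(2,1) eq(1)[symmetric]] eq(2) by blast
    qed
    show ?thesis
    proof (rule has_sqrt_trans[of _ _ "prd (NB F)"])
      show "has_sqrt (Y \<inter> B) (\<lambda>x. g F x * prd (NB F) x)" using NB(2)[OF F(1)] unfolding prd_def .
      show "has_sqrt (Y \<inter> B) (\<lambda>x. prd (NB F) x * g F' x)"
        using NB(2)[OF F(2)] unfolding prd_def \<open>NB F = NB F'\<close> by (simp only: mult.commute)
    qed (use cprd nzB[OF F(1)] in auto)
  qed
  define bits where "bits = (\<lambda>F. (NA F, NB F \<inter> PB))"
  \<comment> \<open>Signs along the seam exist only for maps that are squares on each copy.  They are taken relative to a
    representative with the same punctures and holes.\<close>
  define rep where "rep = (\<lambda>d. SOME F. F \<in> Pow (edges G) \<and> bits F = d)"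
  have rep: "rep (bits F) \<in> Pow (edges G) \<and> bits (rep (bits F)) = bits F" if "F \<in> Pow (edges G)" for F
    unfolding rep_def by (rule someI[of "\<lambda>H. H \<in> Pow (edges G) \<and> bits H = bits F" F]) (use that in auto)
  have "\<exists>J. seam_signs Y (\<lambda>x. g F x * g (rep (bits F)) x) J" if F: "F \<in> Pow (edges G)" for F
  proof (rule seam_signs_exist)
    have r': "rep (bits F) \<in> Pow (edges G)" "NA F = NA (rep (bits F))" "NB F \<inter> PB = NB (rep (bits F)) \<inter> PB"
      using rep[OF F] unfolding bits_def by auto
    show "has_sqrt (Y \<inter> A) (\<lambda>x. g F x * g (rep (bits F)) x)" by (rule sqA[OF F r'(1,2)])
    show "has_sqrt (Y \<inter> B) (\<lambda>x. g F x * g (rep (bits F)) x)" by (rule sqB[OF F r'(1,2,3)])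
    show "A \<inter> B \<subseteq> Y" unfolding Y_def by blast
    show "g F x * g (rep (bits F)) x \<noteq> 0" if "x \<in> Y" for x
      using gY(2)[OF F that] gY(2)[OF r'(1) that] by simp
  qed
  then obtain J where J: "\<And>F. F \<in> Pow (edges G) \<Longrightarrow> seam_signs Y (\<lambda>x. g F x * g (rep (bits F)) x) (J F)" by metis
  define \<Phi> where "\<Phi> = (\<lambda>F. (bits F, J F))"
  let ?D = "(Pow (PA \<union> ?c) \<times> Pow PB) \<times> Pow {..<k}"
  have "card (Pow (edges G)) \<le> card ?D * 2 ^ card (verts G)"
  proof (rule card_le_by_fibres[where \<Phi> = \<Phi> and \<phi> = "\<lambda>F s. {e \<in> edges G. (e \<in> F) \<noteq> (e \<inter> s \<noteq> {} \<and> e - s \<noteq> {})}"])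
    show "finite ?D" using finP by simp
    show "finite (verts G)" by (rule fin(1))
    show "\<Phi> F \<in> ?D" if "F \<in> Pow (edges G)" for F
      using NA(1)[OF that] J[OF that] unfolding \<Phi>_def bits_def seam_signs_def by blast
    fix F F' assume F: "F \<in> Pow (edges G)" "F' \<in> Pow (edges G)" and eq: "\<Phi> F = \<Phi> F'"
    define R where "R = rep (bits F)"
    have R: "R \<in> Pow (edges G)" using rep[OF F(1)] unfolding R_def by blast
    have same: "bits F' = bits F" "J F' = J F" using eq unfolding \<Phi>_def by auto
    have "has_sqrt Y (\<lambda>x. (g F x * g R x) * (g F' x * g R x))"
      using equal_seam_signs_sqrt[OF J[OF F(1)] J[OF F(2), unfolded same] Ycl] YS unfolding R_def by blast
    then have "has_sqrt Y (\<lambda>x. (g F x * g F' x) * (g R x * g R x))"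
      by (rule has_sqrt_cong) (simp only: mult_ac)
    then have "has_sqrt Y (\<lambda>x. g F x * g F' x)"
      by (rule has_sqrt_cancel[OF _ has_sqrt_square[OF gY(1)[OF R]]]) (use gY(2)[OF R] in simp)
    then have "has_sqrt ?X (\<lambda>x. g F x * g F' x)" by (rule has_sqrt_subset) (simp add: Y_def)
    then have "has_sqrt ?X (\<lambda>x. (\<Prod>e\<in>F. \<psi> e x) * (\<Prod>e\<in>F'. \<psi> e x))"
      by (rule has_sqrt_cong) (use g(3) F in simp)
    then show "\<exists>s \<subseteq> verts G. F' = {e \<in> edges G. (e \<in> F) \<noteq> (e \<inter> s \<noteq> {} \<and> e - s \<noteq> {})}"
      using sqrt_of_edge_functions_is_cut[OF dr fin(2) eV \<psi>(3,4)] F by blast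
  qed
  moreover have "card ?D \<le> 2 ^ (card ?F + 2 * k)"
  proof -
    have fLA: "finite (L \<inter> A)" "finite (L \<inter> B)" using finL by auto
    have "card (PA \<union> ?c) \<le> card (L \<inter> A) + k"
    proof -
      have "card PA \<le> card (L \<inter> A)" "card ?c \<le> k"
        unfolding PA_def using card_image_le[OF fLA(1), of q] card_image_le[of "{..<k}" c] by auto
      then show ?thesis using card_Un_le[of PA ?c] by linarith
    qed
    moreover have "card PB \<le> card (L \<inter> B)" unfolding PB_def by (rule card_image_le[OF fLA(2)])
    moreover have "card (L \<inter> A) + card (L \<inter> B) \<le> card L"
    proof -
      have "(L \<inter> A) \<inter> (L \<inter> B) = {}" using LE by blast
      then have "card (L \<inter> A) + card (L \<inter> B) = card ((L \<inter> A) \<union> (L \<inter> B))"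
        using card_Un_disjoint[OF fLA] by simp
      also have "\<dots> \<le> card L" by (rule card_mono[OF finL]) blast
      finally show ?thesis .
    qed
    ultimately have "card (PA \<union> ?c) + card PB + k \<le> card ?F + 2 * k" using cardL by linarith
    moreover have "card ?D = 2 ^ (card (PA \<union> ?c) + card PB + k)"
      using finP by (simp add: card_cartesian_product card_Pow power_add)
    ultimately show ?thesis by (simp only:) (rule power_increasing, auto)
  qed
  ultimately have "(2::nat) ^ card (edges G) \<le> 2 ^ (card ?F + 2 * k) * 2 ^ card (verts G)"
    using fin(2) by (metis (no_types, lifting) card_Pow mult_le_mono1 order_trans)
  then have "(2::nat) ^ card (edges G) \<le> 2 ^ (card ?F + 2 * k + card (verts G))" by (simp add: power_add)
  then have "card (edges G) \<le> card ?F + 2 * k + card (verts G)" by (rule power_le_imp_le_exp[rotated]) simp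
  then show ?thesis by linarith
qed

end

section \<open>Charts of a doubled disc\<close>

definition has_plane_chart :: "'p::topological_space set \<Rightarrow> 'p \<Rightarrow> bool" where
  "has_plane_chart S x \<longleftrightarrow> (\<exists>U N \<phi> h. openin (top_of_set S) U \<and> x \<in> U \<and> open (N :: complex set) \<and>
     homeomorphism U N \<phi> h)"

lemma locally_discI:
  fixes S :: "'p::real_normed_vector set"
  assumes "\<And>x. x \<in> S \<Longrightarrow> has_plane_chart S x"
  shows "locally_disc S"
  unfolding locally_disc_def
proof (intro ballI allI impI, elim conjE)
  fix x W assume x: "x \<in> S" and W: "openin (top_of_set S) W" "x \<in> W"
  obtain U N \<phi> h where U: "openin (top_of_set S) U" "x \<in> U" "open (N :: complex set)" and hom: "homeomorphism U N \<phi> h"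
    using assms[OF x] unfolding has_plane_chart_def by blast
  have h: "continuous_on N h" "h ` N = U" "\<phi> ` U = N"
    "\<And>w. w \<in> N \<Longrightarrow> \<phi> (h w) = w" "\<And>y. y \<in> U \<Longrightarrow> h (\<phi> y) = y"
    using hom unfolding homeomorphism_def by auto
  have US: "U \<subseteq> S" using U(1) openin_imp_subset by blast
  have opn: "openin (top_of_set S) (h ` M)" if M: "open M" "M \<subseteq> N" for M
  proof -
    have "openin (top_of_set N) M" using M by (auto simp: openin_open)
    then have "openin (top_of_set U) (h ` M)"
      using homeomorphism_imp_open_map[OF homeomorphism_symD[OF hom]] by blast
    then show ?thesis by (rule openin_trans[OF _ U(1)])
  qed
  define w0 where "w0 = \<phi> x"
  have w0: "w0 \<in> N" "h w0 = x" using U(2) h(3,5) unfolding w0_def by blast+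
  have "openin (top_of_set N) (N \<inter> h -` W)"
    by (rule continuous_openin_preimage[OF h(1) _ W(1)]) (use h(2) US in blast)
  then have "open (N \<inter> h -` W)" using openin_open_trans[OF _ U(3)] by blast
  then obtain e where e: "0 < e" "cball w0 e \<subseteq> N \<inter> h -` W"
    using open_contains_cball w0 W(2) by (metis IntI vimageI)
  define m where "m = (\<lambda>z. w0 + of_real e * z)"
  have m: "m z \<in> cball w0 e" if "z \<in> cball 0 1" for z
    using that e(1) by (auto simp: m_def dist_norm norm_mult)
  have mb: "m ` ball 0 1 = ball w0 e"
  proof
    show "m ` ball 0 1 \<subseteq> ball w0 e" using e(1) by (auto simp: m_def dist_norm norm_mult)
    show "ball w0 e \<subseteq> m ` ball 0 1"
    proof
      fix w assume "w \<in> ball w0 e"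
      then have "w = m ((w - w0) / e)" "(w - w0) / e \<in> ball 0 1"
        using e(1) by (auto simp: m_def dist_norm norm_divide norm_minus_commute)
      then show "w \<in> m ` ball 0 1" by blast
    qed
  qed
  define h' where "h' = (\<lambda>z. h (m z))"
  have sub: "h' ` cball 0 1 \<subseteq> W" "h' ` cball 0 1 \<subseteq> S"
  proof -
    have "h' z \<in> W \<and> h' z \<in> S" if "z \<in> cball 0 1" for z
    proof -
      have "m z \<in> N \<inter> h -` W" by (rule subsetD[OF e(2) m[OF that]])
      then show ?thesis using h(2) US unfolding h'_def by blast
    qed
    then show "h' ` cball 0 1 \<subseteq> W" "h' ` cball 0 1 \<subseteq> S" by blast+
  qed
  have "embedded_disc S h'"
    unfolding embedded_disc_def
  proof (intro conjI)
    show "continuous_on (cball 0 1) h'" unfolding h'_def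
      by (rule continuous_on_compose2[OF h(1)]) (use m e(2) in \<open>auto simp: m_def intro!: continuous_intros\<close>)
    show "inj_on h' (cball 0 1)"
    proof (rule inj_onI)
      fix y z assume yz: "y \<in> cball 0 1" "z \<in> cball 0 1" "h' y = h' z"
      have "m y \<in> N" "m z \<in> N" using m yz e(2) by blast+
      then have "m y = m z" using yz(3) h(4) unfolding h'_def by metis
      then show "y = z" using e(1) by (simp add: m_def)
    qed
    show "h' ` cball 0 1 \<subseteq> S" by (rule sub(2))
    have "h' ` ball 0 1 = h ` ball w0 e" unfolding h'_def mb[symmetric] by (simp add: image_image)
    moreover have "ball w0 e \<subseteq> N" using e(2) ball_subset_cball by blast
    ultimately show "openin (top_of_set S) (h' ` ball 0 1)" using opn by simp
  qed
  moreover have "h' 0 = x" using w0 by (simp add: h'_def m_def)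
  ultimately show "\<exists>h. embedded_disc S h \<and> h 0 = x \<and> h ` cball 0 1 \<subseteq> W" using sub(1) by blast
qed

text \<open>Reflection in the circle with centre \<open>a\<close> and radius \<open>s\<close>.\<close>

definition annulus_inversion :: "complex \<Rightarrow> real \<Rightarrow> complex \<Rightarrow> complex" where
  "annulus_inversion a s w = a + of_real (s\<^sup>2) / cnj (w - a)"

lemma annulus_inversion_props:
  assumes "0 < s" "w \<noteq> a"
  shows "norm (annulus_inversion a s w - a) = s\<^sup>2 / norm (w - a)"
    and "annulus_inversion a s (annulus_inversion a s w) = w"
    and "norm (w - a) = s \<Longrightarrow> annulus_inversion a s w = w"
proof -
  show "norm (annulus_inversion a s w - a) = s\<^sup>2 / norm (w - a)"
    by (simp add: annulus_inversion_def norm_divide norm_power flip: complex_cnj_diff)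
  show "annulus_inversion a s (annulus_inversion a s w) = w"
    using assms by (simp add: annulus_inversion_def field_simps)
  assume "norm (w - a) = s"
  then have "of_real (s\<^sup>2) = (w - a) * cnj (w - a)" using complex_norm_square[of "w - a"] by simp
  then show "annulus_inversion a s w = w"
    using assms(2) by (simp add: annulus_inversion_def del: complex_cnj_diff of_real_power)
qed

context doubled_disc
begin

text \<open>Near a boundary circle the copy \<open>A\<close> is placed on its own side of the circle by \<open>q\<close>, and the copy \<open>B\<close> on the other
side by \<open>q\<close> followed by the reflection \<open>J\<close>.\<close>

lemma chart_across_seam:
  assumes N: "open N" "x \<in> S" "q x \<in> N" and J: "continuous_on N J" "J ` N \<subseteq> N" "\<And>w. w \<in> N \<Longrightarrow> J (J w) = w"
    and cover: "\<And>w. w \<in> N \<Longrightarrow> w \<in> holed_disc k c r \<or> J w \<in> holed_disc k c r"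
    and rim: "\<And>w. \<lbrakk>w \<in> N; w \<in> holed_disc k c r; J w \<in> holed_disc k c r\<rbrakk> \<Longrightarrow> w \<in> holed_disc_rim k c r"
    and fixed: "\<And>w. \<lbrakk>w \<in> N; w \<in> holed_disc_rim k c r\<rbrakk> \<Longrightarrow> J w = w"
  shows "has_plane_chart S x"
proof -
  let ?D = "holed_disc k c r" and ?R = "holed_disc_rim k c r"
  obtain jA where jA: "continuous_on ?D jA" "jA ` ?D \<subseteq> A" "\<And>z. z \<in> ?D \<Longrightarrow> q (jA z) = z" "\<And>x. x \<in> A \<Longrightarrow> jA (q x) = x"
    by (rule sheet_inverse) (rule that)
  obtain jB where jB: "continuous_on ?D jB" "jB ` ?D \<subseteq> B" "\<And>z. z \<in> ?D \<Longrightarrow> q (jB z) = z" "\<And>x. x \<in> B \<Longrightarrow> jB (q x) = x"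
    by (rule doubled_disc.sheet_inverse[OF swap]) (rule that)
  have qD: "q y \<in> ?D" if "y \<in> S" for y using that S_eq q_sheets by blast
  have seamI: "y \<in> A \<inter> B" if "y \<in> S" "q y \<in> ?R" for y using that seam by blast
  have jAB: "jA w = jB w" if w: "w \<in> ?R" for w
  proof -
    have wD: "w \<in> ?D" using w rim_in_holed_disc by blast
    have "jA w \<in> A" "q (jA w) = w" using jA wD by blast+
    then have "jA w \<in> B" using seamI[of "jA w"] S_eq w by auto
    then show ?thesis using jB(4)[of "jA w"] \<open>q (jA w) = w\<close> by simp
  qed
  define U where "U = {y \<in> S. q y \<in> N}"
  define \<phi> where "\<phi> = (\<lambda>y. if y \<in> A then q y else J (q y))"
  define h where "h = (\<lambda>w. if w \<in> ?D then jA w else jB (J w))"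
  have "U = S \<inter> q -` N" unfolding U_def by blast
  then have opU: "openin (top_of_set S) U" using continuous_openin_preimage_gen[OF cont_q N(1)] by simp
  have \<phi>B: "\<phi> y = J (q y)" if "y \<in> U \<inter> B" for y
  proof (cases "y \<in> A")
    case True
    then have "q y \<in> ?R" "q y \<in> N" using that seam unfolding U_def by blast+
    then show ?thesis using fixed True unfolding \<phi>_def by simp
  qed (simp add: \<phi>_def)
  have US: "U \<subseteq> S" "q ` U \<subseteq> N" unfolding U_def by blast+
  have c\<phi>: "continuous_on ((U \<inter> A) \<union> (U \<inter> B)) \<phi>"
  proof (rule continuous_on_Un_local)
    show "closedin (top_of_set ((U \<inter> A) \<union> (U \<inter> B))) (U \<inter> A)"
      unfolding closedin_closed by (rule exI[of _ A]) (use compact_sheets compact_imp_closed in blast)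
    show "closedin (top_of_set ((U \<inter> A) \<union> (U \<inter> B))) (U \<inter> B)"
      unfolding closedin_closed by (rule exI[of _ B]) (use compact_sheets compact_imp_closed in blast)
    have cq: "continuous_on (U \<inter> W) q" for W by (rule continuous_on_subset[OF cont_q]) (use US in blast)
    show "continuous_on (U \<inter> A) \<phi>" by (rule continuous_on_eq[OF cq]) (simp add: \<phi>_def)
    have "continuous_on (U \<inter> B) (\<lambda>y. J (q y))" by (rule continuous_on_compose2[OF J(1) cq]) (use US in blast)
    then show "continuous_on (U \<inter> B) \<phi>" by (rule continuous_on_eq) (use \<phi>B in simp)
  qed
  have "(U \<inter> A) \<union> (U \<inter> B) = U" using US S_eq by blast
  then have c\<phi>: "continuous_on U \<phi>" using c\<phi> by simp
  have \<phi>N: "\<phi> ` U \<subseteq> N" using US(2) J(2) unfolding \<phi>_def by (auto simp: image_subset_iff)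
  define N1 where "N1 = N \<inter> ?D"
  define N2 where "N2 = N \<inter> J -` ?D"
  have Dcl: "closed ?D" using compact_continuous_image[OF cont_q_sheets(1) compact_sheets(1)] q_sheets compact_imp_closed by metis
  have Nun: "N1 \<union> N2 = N" unfolding N1_def N2_def using cover by blast
  have h2: "h w = jB (J w)" if "w \<in> N2" for w
  proof (cases "w \<in> ?D")
    case True
    then have "w \<in> ?R" "J w = w" using that rim fixed unfolding N2_def by blast+
    then show ?thesis using jAB True unfolding h_def by simp
  qed (simp add: h_def)
  have ch: "continuous_on (N1 \<union> N2) h"
  proof (rule continuous_on_Un_local)
    show "closedin (top_of_set (N1 \<union> N2)) N1" unfolding Nun unfolding N1_def using Dcl by (simp add: closedin_closed_Int)
    show "closedin (top_of_set (N1 \<union> N2)) N2" unfolding Nun unfolding N2_def by (rule continuous_closedin_preimage[OF J(1) Dcl])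
    show "continuous_on N1 h" by (rule continuous_on_eq[OF continuous_on_subset[OF jA(1)]]) (auto simp: N1_def h_def)
    have "continuous_on N2 (\<lambda>w. jB (J w))"
      by (rule continuous_on_compose2[OF jB(1) continuous_on_subset[OF J(1)]]) (auto simp: N2_def)
    then show "continuous_on N2 h" by (rule continuous_on_eq) (use h2 in simp)
  qed
  have hU: "h w \<in> U \<and> \<phi> (h w) = w" if w: "w \<in> N" for w
  proof (cases "w \<in> ?D")
    case True
    then have "h w = jA w" "jA w \<in> A" "q (jA w) = w" using jA unfolding h_def by auto
    then show ?thesis using w S_eq unfolding U_def \<phi>_def by auto
  next
    case False
    then have Jw: "J w \<in> ?D" "J w \<in> N" using cover[OF w] J(2) w by blast+
    then have hw: "h w = jB (J w)" "jB (J w) \<in> B" "q (jB (J w)) = J w" using jB False unfolding h_def by auto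
    then have hwU: "h w \<in> U" using Jw S_eq unfolding U_def by auto
    then have "\<phi> (h w) = J (J w)" using \<phi>B[of "h w"] hw by simp
    then show ?thesis using hwU J(3)[OF w] by simp
  qed
  have h\<phi>: "h (\<phi> y) = y" if y: "y \<in> U" for y
  proof (cases "y \<in> A")
    case True
    then show ?thesis using jA(4) q_sheets unfolding \<phi>_def h_def by auto
  next
    case False
    then have yB: "y \<in> B" "q y \<in> N" "q y \<in> ?D" using y S_eq qD unfolding U_def by auto
    have "J (q y) \<notin> ?D"
    proof
      assume "J (q y) \<in> ?D"
      then have "q y \<in> ?R" using rim yB by blast
      then show False using seamI[of y] False y US by blast
    qed
    then have "h (\<phi> y) = jB (J (J (q y)))" using False unfolding \<phi>_def h_def by simp
    then show ?thesis using J(3)[OF yB(2)] jB(4)[OF yB(1)] by simp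
  qed
  have "homeomorphism U N \<phi> h"
  proof (rule homeomorphismI)
    show "continuous_on N h" using ch Nun by simp
    show "\<phi> ` U \<subseteq> N" by (rule \<phi>N)
    show "h ` N \<subseteq> U" using hU by blast
  qed (use c\<phi> hU h\<phi> in auto)
  then show ?thesis unfolding has_plane_chart_def using opU N unfolding U_def by blast
qed

text \<open>The annulus between the radii \<open>s\<^sup>2 / b\<close> and \<open>b\<close> is invariant under reflection in the circle of radius \<open>s\<close>.  The two
alternatives for the side cover the boundaries of the holes and the outer boundary.\<close>

lemma chart_across_circle:
  assumes s: "0 < s" "s < b" and x: "x \<in> S" "norm (q x - a) = s"
    and rim: "\<And>w. \<lbrakk>s\<^sup>2 / b < norm (w - a); norm (w - a) < b\<rbrakk> \<Longrightarrow> w \<in> holed_disc_rim k c r \<longleftrightarrow> norm (w - a) = s"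
    and side: "(\<forall>w. s\<^sup>2 / b < norm (w - a) \<and> norm (w - a) < b \<longrightarrow> (w \<in> holed_disc k c r \<longleftrightarrow> s \<le> norm (w - a))) \<or>
      (\<forall>w. s\<^sup>2 / b < norm (w - a) \<and> norm (w - a) < b \<longrightarrow> (w \<in> holed_disc k c r \<longleftrightarrow> norm (w - a) \<le> s))"
  shows "has_plane_chart S x"
proof -
  define N where "N = {w. s\<^sup>2 / b < norm (w - a)} \<inter> {w. norm (w - a) < b}"
  let ?J = "annulus_inversion a s"
  have b0: "0 < b" using s by linarith
  have lo: "0 < s\<^sup>2 / b" using s b0 by simp
  have ne: "w \<noteq> a" if "w \<in> N" for w using that lo unfolding N_def by auto
  note inv = annulus_inversion_props[OF s(1) ne]
  have JN: "?J w \<in> N" if w: "w \<in> N" for w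
  proof -
    have n0: "0 < norm (w - a)" using ne[OF w] by simp
    have "s\<^sup>2 / b < s\<^sup>2 / norm (w - a)" "s\<^sup>2 / norm (w - a) < b"
      using w n0 b0 s unfolding N_def by (auto simp: field_simps intro!: divide_strict_left_mono)
    then show ?thesis unfolding N_def by (simp add: inv(1)[OF w])
  qed
  have Jle: "(s \<le> norm (?J w - a)) \<longleftrightarrow> norm (w - a) \<le> s" "(norm (?J w - a) \<le> s) \<longleftrightarrow> s \<le> norm (w - a)" if w: "w \<in> N" for w
  proof -
    have n0: "0 < norm (w - a)" using ne[OF w] by simp
    show "(s \<le> norm (?J w - a)) \<longleftrightarrow> norm (w - a) \<le> s" "(norm (?J w - a) \<le> s) \<longleftrightarrow> s \<le> norm (w - a)"
      unfolding inv(1)[OF w] using n0 s(1) by (auto simp: field_simps power2_eq_square)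
  qed
  show ?thesis
  proof (rule chart_across_seam[of N x ?J])
    show "open N" unfolding N_def by (intro open_Int open_Collect_less continuous_intros)
    show "q x \<in> N" using x s b0 unfolding N_def by (simp add: field_simps power2_eq_square)
    show "continuous_on N ?J" unfolding annulus_inversion_def
      using ne by (intro continuous_intros) auto
    show "?J ` N \<subseteq> N" using JN by blast
    show "?J (?J w) = w" if "w \<in> N" for w using inv(2)[OF that] .
    show "w \<in> holed_disc k c r \<or> ?J w \<in> holed_disc k c r" if w: "w \<in> N" for w
      using side w JN[OF w] Jle[OF w] unfolding N_def by fastforce
    show "w \<in> holed_disc_rim k c r" if w: "w \<in> N" "w \<in> holed_disc k c r" "?J w \<in> holed_disc k c r" for w
    proof -
      have "norm (w - a) = s" using side w JN[OF w(1)] Jle[OF w(1)] unfolding N_def by fastforce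
      then show ?thesis using rim[of w] w(1) unfolding N_def by blast
    qed
    show "?J w = w" if w: "w \<in> N" "w \<in> holed_disc_rim k c r" for w
      using inv(3)[OF w(1)] rim[of w] w unfolding N_def by blast
  qed (rule x(1))
qed

lemma chart_off_seam:
  assumes "x \<in> A - B"
  shows "has_plane_chart S x"
proof -
  let ?D = "holed_disc k c r" and ?R = "holed_disc_rim k c r"
  obtain jA where jA: "continuous_on ?D jA" "jA ` ?D \<subseteq> A" "\<And>z. z \<in> ?D \<Longrightarrow> q (jA z) = z" "\<And>x. x \<in> A \<Longrightarrow> jA (q x) = x"
    by (rule sheet_inverse) (rule that)
  define N where "N = ball 0 1 - (\<Union>i<k. cball (c i) r)"
  have opN: "open N" unfolding N_def by (intro open_Diff closed_UN) auto
  have Neq: "N = ?D - ?R"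
  proof (rule Set.set_eqI)
    fix z :: complex
    have "z \<in> ball 0 1 \<longleftrightarrow> z \<in> cball 0 1 \<and> z \<notin> sphere 0 1" by auto
    moreover have "z \<in> cball (c i) r \<longleftrightarrow> z \<in> ball (c i) r \<or> z \<in> sphere (c i) r" for i by auto
    ultimately show "z \<in> N \<longleftrightarrow> z \<in> ?D - ?R" unfolding N_def holed_disc_def holed_disc_rim_def by blast
  qed
  define U where "U = A - B"
  have "closedin (top_of_set S) B" using S_eq compact_sheets compact_imp_closed by (intro closed_subset) auto
  then have "openin (top_of_set S) (S - B)" by (intro openin_diff) auto
  moreover have "S - B = U" unfolding U_def using S_eq by blast
  ultimately have opU: "openin (top_of_set S) U" by simp
  have UN: "q ` U \<subseteq> N" unfolding Neq U_def using q_sheets(1) seam S_eq by blast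
  have jU: "jA ` N \<subseteq> U"
  proof (rule image_subsetI)
    fix z assume z: "z \<in> N"
    then have "jA z \<in> A" "q (jA z) = z" using jA(2,3) unfolding Neq by blast+
    moreover have "jA z \<notin> A \<inter> B" using z \<open>q (jA z) = z\<close> unfolding seam Neq by simp
    ultimately show "jA z \<in> U" unfolding U_def by blast
  qed
  have "homeomorphism U N q jA"
  proof (rule homeomorphismI)
    show "continuous_on U q" by (rule continuous_on_subset[OF cont_q_sheets(1)]) (simp add: U_def)
    show "continuous_on N jA" by (rule continuous_on_subset[OF jA(1)]) (simp add: Neq)
    show "q (jA w) = w" if "w \<in> N" for w using jA(3) that unfolding Neq by blast
    show "jA (q y) = y" if "y \<in> U" for y using jA(4) that unfolding U_def by blast
  qed (use UN jU in auto)
  then show ?thesis unfolding has_plane_chart_def using opU opN assms unfolding U_def by blast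
qed

theorem locally_disc_S: "locally_disc S"
proof (rule locally_discI)
  fix x assume x: "x \<in> S"
  consider "x \<in> A - B" | "x \<in> B - A" | "x \<in> A \<inter> B" using x S_eq by blast
  then show "has_plane_chart S x"
  proof cases
    case 1 then show ?thesis by (rule chart_off_seam)
  next
    case 2 then show ?thesis by (rule doubled_disc.chart_off_seam[OF swap])
  next
    case 3
    then have "q x \<in> holed_disc_rim k c r" using seam by blast
    then consider "norm (q x - 0) = 1" | i where "i < k" "norm (q x - c i) = r"
      unfolding holed_disc_rim_def by (auto simp: dist_norm norm_minus_commute)
    then show ?thesis
    proof cases
      case 1
      have "compact ({0} \<union> (\<Union>i<k. cball (c i) r))" by (intro compact_Un compact_UN) auto
      then have "compact (norm ` ({0} \<union> (\<Union>i<k. cball (c i) r)))"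
        by (rule compact_continuous_image[rotated]) (intro continuous_intros)
      then obtain d where d: "d \<in> norm ` ({0} \<union> (\<Union>i<k. cball (c i) r))"
          "\<And>y. y \<in> norm ` ({0} \<union> (\<Union>i<k. cball (c i) r)) \<Longrightarrow> y \<le> d"
        using compact_attains_sup[of "norm ` ({0} \<union> (\<Union>i<k. cball (c i) r))"] by blast
      have "d < 1"
      proof -
        have "{0} \<union> (\<Union>i<k. cball (c i) r) \<subseteq> ball 0 1" using holes_inside by auto
        then show ?thesis using d(1) by auto
      qed
      \<comment> \<open>All holes lie inside the circle of radius \<open>e < 1\<close>.\<close>
      define e where "e = max d (1/2)"
      have e: "0 < e" "e < 1" "d \<le> e" using \<open>d < 1\<close> unfolding e_def by auto
      have out: "w \<notin> cball (c i) r" if "i < k" "e < norm w" for w i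
        using d(2)[of "norm w"] that e(3) by force
      have out': "w \<notin> ball (c i) r" "w \<notin> sphere (c i) r" if "i < k" "e < norm w" for w i
        using out[OF that] by auto
      show ?thesis
      proof (rule chart_across_circle[of 1 "1 / e" x 0])
        show "w \<in> holed_disc_rim k c r \<longleftrightarrow> norm (w - 0) = 1" if "1\<^sup>2 / (1 / e) < norm (w - 0)" for w
          using that out'(2)[of _ w] unfolding holed_disc_rim_def by auto
        have "w \<in> holed_disc k c r \<longleftrightarrow> norm (w - 0) \<le> 1" if "1\<^sup>2 / (1 / e) < norm (w - 0)" for w
          using that out'(1)[of _ w] unfolding holed_disc_def by auto
        then show "(\<forall>w. 1\<^sup>2 / (1 / e) < norm (w - 0) \<and> norm (w - 0) < 1 / e \<longrightarrow> (w \<in> holed_disc k c r \<longleftrightarrow> 1 \<le> norm (w - 0))) \<or>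
          (\<forall>w. 1\<^sup>2 / (1 / e) < norm (w - 0) \<and> norm (w - 0) < 1 / e \<longrightarrow> (w \<in> holed_disc k c r \<longleftrightarrow> norm (w - 0) \<le> 1))"
          by blast
      qed (use e x 1 in auto)
    next
      case (2 i)
      define O' where "O' = ball 0 1 - (\<Union>j\<in>{..<k} - {i}. cball (c j) r)"
      have "open O'" unfolding O'_def by (intro open_Diff closed_UN) auto
      moreover have "cball (c i) r \<subseteq> O'"
        unfolding O'_def using holes_inside[OF 2(1)] holes_disjoint[OF 2(1)] by blast
      ultimately obtain d where d: "0 < d" "(\<Union>z\<in>cball (c i) r. cball z d) \<subseteq> O'"
        using compact_subset_open_imp_cball_epsilon_subset[OF compact_cball] by metis
      have inO: "w \<in> O'" if "norm (w - c i) < r + d" for w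
      proof (cases "norm (w - c i) \<le> r")
        case True
        then have "w \<in> cball (c i) r" by (simp add: dist_norm norm_minus_commute)
        moreover have "w \<in> cball w d" using d(1) by simp
        ultimately show ?thesis using d(2) by blast
      next
        case False
        define z where "z = c i + of_real (r / norm (w - c i)) * (w - c i)"
        have n0: "norm (w - c i) > 0" using False r by linarith
        have "norm (z - c i) = r" using n0 r by (simp add: z_def norm_mult norm_divide)
        then have zc: "z \<in> cball (c i) r" by (simp add: dist_norm norm_minus_commute)
        have "w - z = of_real (1 - r / norm (w - c i)) * (w - c i)" by (simp add: z_def algebra_simps)
        then have "norm (w - z) = \<bar>1 - r / norm (w - c i)\<bar> * norm (w - c i)" by (simp only: norm_mult norm_of_real)
        also have "\<dots> = norm (w - c i) - r" using False n0 r by (simp add: abs_if field_simps)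
        finally have "w \<in> cball z d" using that by (simp add: dist_norm norm_minus_commute)
        then show ?thesis using d(2) zc by blast
      qed
      have inN: "norm w < 1 \<and> (\<forall>j<k. j \<noteq> i \<longrightarrow> w \<notin> cball (c j) r)" if "norm (w - c i) < r + d" for w
        using inO[OF that] unfolding O'_def by auto
      have dist_i: "dist (c i) w = norm (w - c i)" for w by (simp add: dist_norm norm_minus_commute)
      show ?thesis
      proof (rule chart_across_circle[of r "r + d" x "c i"])
        show "w \<in> holed_disc_rim k c r \<longleftrightarrow> norm (w - c i) = r" if w: "norm (w - c i) < r + d" for w
        proof
          assume "w \<in> holed_disc_rim k c r"
          then consider "norm w = 1" | j where "j < k" "w \<in> sphere (c j) r" unfolding holed_disc_rim_def by auto
          then show "norm (w - c i) = r"
          proof cases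
            case 1 then show ?thesis using inN[OF w] by simp
          next
            case (2 j)
            then have "j = i" using inN[OF w] sphere_cball by blast
            then show ?thesis using 2 dist_i by simp
          qed
        next
          assume "norm (w - c i) = r"
          then show "w \<in> holed_disc_rim k c r" using 2(1) dist_i unfolding holed_disc_rim_def by auto
        qed
        have "w \<in> holed_disc k c r \<longleftrightarrow> r \<le> norm (w - c i)" if w: "norm (w - c i) < r + d" for w
        proof
          assume "w \<in> holed_disc k c r"
          then show "r \<le> norm (w - c i)" using 2(1) dist_i[of w] unfolding holed_disc_def by force
        next
          assume le: "r \<le> norm (w - c i)"
          have "w \<notin> ball (c j) r" if "j < k" for j
          proof (cases "j = i")
            case True then show ?thesis using le dist_i by simp
          next
            case False then show ?thesis using inN[OF w] that ball_subset_cball by blast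
          qed
          then show "w \<in> holed_disc k c r" using inN[OF w] unfolding holed_disc_def by auto
        qed
        then show "(\<forall>w. r\<^sup>2 / (r + d) < norm (w - c i) \<and> norm (w - c i) < r + d \<longrightarrow> (w \<in> holed_disc k c r \<longleftrightarrow> r \<le> norm (w - c i))) \<or>
          (\<forall>w. r\<^sup>2 / (r + d) < norm (w - c i) \<and> norm (w - c i) < r + d \<longrightarrow> (w \<in> holed_disc k c r \<longleftrightarrow> norm (w - c i) \<le> r))"
          by blast
      qed (use r d x 2 in auto)
    qed
  qed
qed

text \<open>If the holes are centred on the real axis, moving away from the axis never enters a hole; so each point
of the disc with holes is joined to the unit circle by a vertical segment.\<close>

lemma connected_S_real_centres:
  assumes real: "\<And>i. i < k \<Longrightarrow> Im (c i) = 0"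
  shows "connected S"
proof -
  let ?D = "holed_disc k c r"
  have reach: "\<exists>y\<in>sphere 0 1. connected_component ?D z y" if z: "z \<in> ?D" for z
  proof -
    \<comment> \<open>The direction that leads away from the real axis.\<close>
    define \<sigma> :: real where "\<sigma> = (if Im z \<ge> 0 then 1 else -1)"
    have \<sigma>: "\<sigma> * \<sigma> = 1" "0 \<le> \<sigma> * Im z" unfolding \<sigma>_def by auto
    have n1: "(Re z)\<^sup>2 + (Im z)\<^sup>2 \<le> 1" using z unfolding holed_disc_def by (auto simp: cmod_def)
    define y where "y = Complex (Re z) (\<sigma> * sqrt (1 - (Re z)\<^sup>2))"
    have Re1: "(Re z)\<^sup>2 \<le> 1" using n1 zero_le_power2[of "Im z"] by linarith
    have s2: "\<sigma>\<^sup>2 = 1" using \<sigma> by (simp add: power2_eq_square)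
    have y1: "norm y = 1" using Re1 s2 by (simp add: y_def cmod_def power_mult_distrib)
    have seg: "closed_segment z y \<subseteq> ?D"
    proof
      fix w assume "w \<in> closed_segment z y"
      then obtain u where u: "0 \<le> u" "u \<le> 1" "w = (1 - u) *\<^sub>R z + u *\<^sub>R y" unfolding in_segment by blast
      have "Re w = (1 - u) * Re z + u * Re z" using u(3) by (simp add: y_def)
      then have Rew: "Re w = Re z" by (simp add: algebra_simps)
      have Imw: "\<sigma> * Im w = (1 - u) * (\<sigma> * Im z) + u * sqrt (1 - (Re z)\<^sup>2)"
      proof -
        have "Im w = (1 - u) * Im z + u * (\<sigma> * sqrt (1 - (Re z)\<^sup>2))" using u(3) by (simp add: y_def)
        then have "\<sigma> * Im w = (1 - u) * (\<sigma> * Im z) + u * (\<sigma> * \<sigma>) * sqrt (1 - (Re z)\<^sup>2)"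
          by (simp only: distrib_left mult_ac)
        then show ?thesis using \<sigma> by simp
      qed
      have "sqrt ((\<sigma> * Im z)\<^sup>2) \<le> sqrt (1 - (Re z)\<^sup>2)"
        using n1 s2 by (intro real_sqrt_le_mono) (simp add: power_mult_distrib)
      then have le: "\<sigma> * Im z \<le> sqrt (1 - (Re z)\<^sup>2)" using \<sigma>(2) by simp
      have lb: "\<sigma> * Im z \<le> \<sigma> * Im w"
      proof -
        have "u * (\<sigma> * Im z) \<le> u * sqrt (1 - (Re z)\<^sup>2)" by (rule mult_left_mono[OF le u(1)])
        then show ?thesis unfolding Imw by (simp add: algebra_simps)
      qed
      have ub: "\<sigma> * Im w \<le> sqrt (1 - (Re z)\<^sup>2)"
      proof -
        have "(1 - u) * (\<sigma> * Im z) \<le> (1 - u) * sqrt (1 - (Re z)\<^sup>2)" using le u by (intro mult_left_mono) auto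
        then show ?thesis unfolding Imw by (simp add: algebra_simps)
      qed
      have sq: "(Im z)\<^sup>2 \<le> (Im w)\<^sup>2" "(Im w)\<^sup>2 \<le> 1 - (Re z)\<^sup>2"
      proof -
        have "(\<sigma> * Im z)\<^sup>2 \<le> (\<sigma> * Im w)\<^sup>2" by (rule power_mono[OF lb \<sigma>(2)])
        then show "(Im z)\<^sup>2 \<le> (Im w)\<^sup>2" using s2 by (simp add: power_mult_distrib)
        have "(\<sigma> * Im w)\<^sup>2 \<le> (sqrt (1 - (Re z)\<^sup>2))\<^sup>2" using \<sigma>(2) lb by (intro power_mono[OF ub]) linarith
        then show "(Im w)\<^sup>2 \<le> 1 - (Re z)\<^sup>2" using s2 Re1 by (simp add: power_mult_distrib)
      qed
      have "norm w \<le> 1" using sq(2) Rew by (simp add: cmod_def)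
      moreover have "w \<notin> ball (c i) r" if i: "i < k" for i
      proof -
        have "norm (z - c i) \<le> norm (w - c i)"
          unfolding cmod_def using sq(1) Rew real[OF i] by simp
        moreover have "r \<le> norm (z - c i)"
          using z i unfolding holed_disc_def by (force simp: dist_norm norm_minus_commute)
        ultimately show ?thesis by (simp add: dist_norm norm_minus_commute)
      qed
      ultimately show "w \<in> ?D" unfolding holed_disc_def by auto
    qed
    have "connected_component ?D z y"
      unfolding connected_component_def by (rule exI[of _ "closed_segment z y"]) (use seg in auto)
    then show ?thesis using y1 by (intro bexI[of _ y]) auto
  qed
  have sD: "sphere 0 1 \<subseteq> ?D" using rim_in_holed_disc unfolding holed_disc_rim_def by blast
  have csph: "connected (sphere (0::complex) 1)" by (rule connected_sphere) simp
  have cD: "connected ?D"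
    unfolding connected_iff_connected_component
  proof (intro ballI)
    fix z w assume "z \<in> ?D" "w \<in> ?D"
    then obtain y v where y: "y \<in> sphere 0 1" "connected_component ?D z y" and v: "v \<in> sphere 0 1" "connected_component ?D w v"
      using reach by meson
    have "connected_component ?D y v"
      unfolding connected_component_def by (rule exI[of _ "sphere 0 1"]) (use y v sD csph in auto)
    then show "connected_component ?D z w"
      using y(2) v(2) connected_component_trans connected_component_sym by metis
  qed
  have cA: "connected A"
  proof -
    obtain j where j: "continuous_on ?D j" "j ` ?D \<subseteq> A" "\<And>z. z \<in> ?D \<Longrightarrow> q (j z) = z" "\<And>x. x \<in> A \<Longrightarrow> j (q x) = x"
      by (rule sheet_inverse) (rule that)
    have "A \<subseteq> j ` ?D" using j(4) q_sheets(1) by force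
    then have "A = j ` ?D" using j(2) by blast
    then show ?thesis using connected_continuous_image[OF j(1) cD] by simp
  qed
  have cB: "connected B"
  proof -
    obtain j where j: "continuous_on ?D j" "j ` ?D \<subseteq> B" "\<And>z. z \<in> ?D \<Longrightarrow> q (j z) = z" "\<And>x. x \<in> B \<Longrightarrow> j (q x) = x"
      by (rule doubled_disc.sheet_inverse[OF swap]) (rule that)
    have "B \<subseteq> j ` ?D" using j(4) q_sheets(2) by force
    then have "B = j ` ?D" using j(2) by blast
    then show ?thesis using connected_continuous_image[OF j(1) cD] by simp
  qed
  have "A \<inter> B \<noteq> {}"
  proof -
    have "1 \<in> q ` A" unfolding q_sheets using sD by auto
    then obtain x where "x \<in> A" "q x = 1" by force
    then show ?thesis using seam S_eq unfolding holed_disc_rim_def by auto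
  qed
  then show ?thesis unfolding S_eq using connected_Un[OF cA cB] by blast
qed

end

section \<open>The sphere with handles as a doubled disc\<close>

definition handle_radius :: "nat \<Rightarrow> real" where
  "handle_radius k = 1 / (2 * real k)"

definition tube :: "nat \<Rightarrow> nat \<Rightarrow> (complex \<times> real) set" where
  "tube k i = cball 0 1 \<inter> (sphere (handle_centre k i) (handle_radius k) \<times> UNIV)"

definition perforated_sphere :: "nat \<Rightarrow> (complex \<times> real) set" where
  "perforated_sphere k = sphere 0 1 - (\<Union>i<k. ball (handle_centre k i) (handle_radius k) \<times> UNIV)"

text \<open>The upper half of a tube is pressed into the hole that the tube leaves in the sphere.  The point at height \<open>t\<close> is moved
towards the axis by a factor that decreases from 1 at the upper rim to 1/2 at height 0, so that the remaining
hole has half the radius.\<close>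

definition fold_tube :: "nat \<Rightarrow> nat \<Rightarrow> complex \<times> real \<Rightarrow> complex" where
  "fold_tube k i x = handle_centre k i +
     of_real (1 / 2 + \<bar>snd x\<bar> / (2 * sqrt (1 - (norm (fst x))\<^sup>2))) * (fst x - handle_centre k i)"

text \<open>Vertical projection on the sphere.  On the tubes it is \<open>fold_tube\<close>, which agrees with the projection at the rims.
Upper and lower half of the surface have the same image.\<close>

definition fold_surface :: "nat \<Rightarrow> complex \<times> real \<Rightarrow> complex" where
  "fold_surface k x = (if \<exists>i<k. x \<in> tube k i then fold_tube k (THE i. i < k \<and> x \<in> tube k i) x else fst x)"

context
  fixes k :: nat
  assumes k: "0 < k"
begin

abbreviation "hr \<equiv> handle_radius k"
abbreviation "hc \<equiv> handle_centre k"

lemma sphere_with_handles_eq: "sphere_with_handles k = perforated_sphere k \<union> (\<Union>i<k. tube k i)"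
  unfolding sphere_with_handles_def perforated_sphere_def tube_def handle_radius_def by simp

lemma hr_pos: "0 < hr" using k by (simp add: handle_radius_def)

lemma handle_inside:
  assumes i: "i < k"
  shows "cball (hc i) hr \<subseteq> ball 0 1"
proof
  fix z assume z: "z \<in> cball (hc i) hr"
  have "norm (hc i) = \<bar>(2 * real i + 1) / real k - 1\<bar>" unfolding handle_centre_def by (simp only: norm_of_real)
  also have "\<dots> \<le> 1 - 1 / real k"
  proof -
    have "(2 * real i + 1) / real k \<ge> 1 / real k" "(2 * real i + 1) / real k \<le> (2 * real k - 1) / real k"
      using i k by (auto intro!: divide_right_mono)
    moreover have "(2 * real k - 1) / real k = 2 - 1 / real k" using k by (simp add: field_simps)
    ultimately show ?thesis by linarith
  qed
  finally have "norm (hc i) \<le> 1 - 1 / real k" .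
  moreover have "norm (z - hc i) \<le> 1 / (2 * real k)" using z by (simp add: dist_norm norm_minus_commute handle_radius_def)
  moreover have "1 / (2 * real k) < 1 / real k" using k by (simp add: field_simps)
  moreover have "norm z \<le> norm (z - hc i) + norm (hc i)" using norm_triangle_ineq[of "z - hc i" "hc i"] by simp
  ultimately have "norm z < 1" by linarith
  then show "z \<in> ball 0 1" by simp
qed

lemma handle_disjoint:
  assumes "i < k" "j < k" "i \<noteq> j"
  shows "cball (hc i) hr \<inter> cball (hc j) hr = {}"
proof (rule ccontr)
  assume "cball (hc i) hr \<inter> cball (hc j) hr \<noteq> {}"
  then obtain z where z: "dist (hc i) z \<le> hr" "dist (hc j) z \<le> hr" by auto
  then have "dist (hc i) (hc j) \<le> hr + hr" using dist_triangle2[of "hc i" "hc j" z] by linarith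
  also have "hr + hr = 1 / real k" using k by (simp add: handle_radius_def field_simps)
  finally have le: "dist (hc i) (hc j) \<le> 1 / real k" .
  have "hc i - hc j = of_real (2 * (real i - real j) / real k)"
    unfolding handle_centre_def by (simp add: diff_divide_distrib add_divide_distrib algebra_simps)
  then have "dist (hc i) (hc j) = 2 * \<bar>real i - real j\<bar> / real k"
    unfolding dist_norm by (simp only: norm_of_real abs_divide abs_mult abs_numeral abs_of_nat)
  moreover have "1 \<le> \<bar>real i - real j\<bar>" using assms(3) by auto
  then have "2 / real k \<le> 2 * \<bar>real i - real j\<bar> / real k" using k by (simp add: divide_right_mono)
  moreover have "1 / real k < 2 / real k" using k by (simp add: divide_strict_right_mono)
  ultimately show False using le by linarith
qed

lemma handle_unique: "\<lbrakk>i < k; j < k; z \<in> cball (hc i) hr; z \<in> cball (hc j) hr\<rbrakk> \<Longrightarrow> i = j"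
  using handle_disjoint by blast

lemma tube_unique: "\<lbrakk>i < k; j < k; x \<in> tube k i; x \<in> tube k j\<rbrakk> \<Longrightarrow> i = j"
  using handle_unique[of i j "fst x"] unfolding tube_def by auto

lemma fold_on_tube:
  assumes "i < k" "x \<in> tube k i"
  shows "fold_surface k x = fold_tube k i x"
proof -
  have "(THE i. i < k \<and> x \<in> tube k i) = i" using assms tube_unique by (intro the_equality) blast+
  then show ?thesis using assms unfolding fold_surface_def by auto
qed

lemma tube_facts:
  assumes "i < k" "(z, t) \<in> tube k i"
  shows "norm (z - hc i) = hr" "norm z < 1" "0 < sqrt (1 - (norm z)\<^sup>2)" "\<bar>t\<bar> \<le> sqrt (1 - (norm z)\<^sup>2)"
proof -
  show 1: "norm (z - hc i) = hr" using assms(2) unfolding tube_def by (auto simp: dist_norm norm_minus_commute)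
  then have "z \<in> cball (hc i) hr" by (simp add: dist_norm norm_minus_commute)
  then show 2: "norm z < 1" using handle_inside[OF assms(1)] by auto
  then have "(norm z)\<^sup>2 < 1" by (simp add: power_less_one_iff abs_square_less_1)
  then show "0 < sqrt (1 - (norm z)\<^sup>2)" by simp
  have "norm (z, t) \<le> 1" using assms(2) unfolding tube_def by simp
  then have "(norm z)\<^sup>2 + t\<^sup>2 \<le> 1" by (simp add: norm_Pair)
  then have "sqrt (t\<^sup>2) \<le> sqrt (1 - (norm z)\<^sup>2)" by (intro real_sqrt_le_mono) simp
  then show "\<bar>t\<bar> \<le> sqrt (1 - (norm z)\<^sup>2)" by simp
qed

lemma perforated_facts:
  assumes "(z, t) \<in> perforated_sphere k"
  shows "(norm z)\<^sup>2 + t\<^sup>2 = 1" "\<bar>t\<bar> = sqrt (1 - (norm z)\<^sup>2)" "norm z \<le> 1" "\<And>i. i < k \<Longrightarrow> hr \<le> norm (z - hc i)"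
proof -
  have "norm (z, t) = 1" using assms unfolding perforated_sphere_def by simp
  then show 1: "(norm z)\<^sup>2 + t\<^sup>2 = 1" by (simp add: norm_Pair)
  then have "t\<^sup>2 = 1 - (norm z)\<^sup>2" by linarith
  then show "\<bar>t\<bar> = sqrt (1 - (norm z)\<^sup>2)" by (metis real_sqrt_abs)
  have "(norm z)\<^sup>2 \<le> 1" using 1 zero_le_power2[of t] by linarith
  then show "norm z \<le> 1" by (simp add: power_le_one_iff abs_square_le_1)
  fix i assume "i < k"
  then have "z \<notin> ball (hc i) hr" using assms unfolding perforated_sphere_def by auto
  then show "hr \<le> norm (z - hc i)" by (simp add: dist_norm norm_minus_commute)
qed

lemma fold_on_perforated:
  assumes x: "(z, t) \<in> perforated_sphere k"
  shows "fold_surface k (z, t) = z"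
proof (cases "\<exists>i<k. (z, t) \<in> tube k i")
  case True
  then obtain i where i: "i < k" "(z, t) \<in> tube k i" by blast
  have "1 / 2 + \<bar>t\<bar> / (2 * sqrt (1 - (norm z)\<^sup>2)) = 1"
    using perforated_facts(2)[OF x] tube_facts(3)[OF i] by (simp add: field_simps)
  then have "fold_surface k (z, t) = hc i + of_real 1 * (z - hc i)"
    by (simp only: fold_on_tube[OF i] fold_tube_def fst_conv snd_conv)
  then show ?thesis by simp
next
  case False
  then show ?thesis unfolding fold_surface_def by (simp only: if_False fst_conv)
qed

lemma surface_cases:
  assumes "x \<in> sphere_with_handles k"
  obtains z t where "x = (z, t)" "(z, t) \<in> perforated_sphere k"
  | i z t where "i < k" "x = (z, t)" "(z, t) \<in> tube k i"
  using assms unfolding sphere_with_handles_eq by (cases x) auto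

lemma closed_pieces: "closed (perforated_sphere k)" "closed (tube k i)"
proof -
  show "closed (tube k i)" unfolding tube_def by (intro closed_Int closed_Times) auto
  have "open (\<Union>i<k. ball (hc i) hr \<times> (UNIV :: real set))" by (intro open_UN ballI open_Times) auto
  then show "closed (perforated_sphere k)" unfolding perforated_sphere_def by (intro closed_Diff) auto
qed

lemma compact_surface: "compact (sphere_with_handles k)"
proof -
  have "closed (sphere_with_handles k)"
    unfolding sphere_with_handles_eq using closed_pieces by (intro closed_Un closed_UN) auto
  moreover have "sphere_with_handles k \<subseteq> cball 0 1"
    unfolding sphere_with_handles_eq perforated_sphere_def tube_def by auto
  ultimately show ?thesis using bounded_subset[OF bounded_cball] compact_eq_bounded_closed by blast
qed

lemma continuous_fold: "continuous_on (sphere_with_handles k) (fold_surface k)"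
  unfolding sphere_with_handles_eq
proof (rule continuous_on_closed_Un)
  show "closed (perforated_sphere k)" by (rule closed_pieces)
  show "closed (\<Union>i<k. tube k i)" using closed_pieces by (intro closed_UN) auto
  show "continuous_on (perforated_sphere k) (fold_surface k)"
    by (rule continuous_on_eq[of _ fst]) (use fold_on_perforated in \<open>auto intro!: continuous_intros\<close>)
  show "continuous_on (\<Union>i<k. tube k i) (fold_surface k)"
  proof (rule continuous_on_closed_Union)
    fix i assume i: "i \<in> {..<k}"
    have "continuous_on (tube k i) (fold_tube k i)"
      unfolding fold_tube_def
    proof (intro continuous_intros ballI)
      fix x assume x: "x \<in> tube k i"
      obtain z t where "x = (z, t)" by (cases x)
      then show "2 * sqrt (1 - (norm (fst x))\<^sup>2) \<noteq> 0" using tube_facts(3)[of i z t] x i by simp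
    qed
    then show "continuous_on (tube k i) (fold_surface k)"
      by (rule continuous_on_eq) (use fold_on_tube i in simp)
  qed (use closed_pieces in auto)
qed

text \<open>The inverse of \<open>fold_surface\<close> on the upper half.\<close>

definition unfold_upper :: "complex \<Rightarrow> complex \<times> real" where
  "unfold_upper w = (if \<exists>i<k. w \<in> ball (hc i) hr
     then let i = (THE i. i < k \<and> w \<in> ball (hc i) hr);
              z = hc i + of_real (hr / norm (w - hc i)) * (w - hc i)
          in (z, (2 * norm (w - hc i) / hr - 1) * sqrt (1 - (norm z)\<^sup>2))
     else (w, sqrt (1 - (norm w)\<^sup>2)))"

lemma unfold_in_ball:
  assumes "i < k" "w \<in> ball (hc i) hr"
  shows "unfold_upper w = (let z = hc i + of_real (hr / norm (w - hc i)) * (w - hc i)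
          in (z, (2 * norm (w - hc i) / hr - 1) * sqrt (1 - (norm z)\<^sup>2)))"
proof -
  have "(THE i. i < k \<and> w \<in> ball (hc i) hr) = i"
    using assms handle_unique ball_subset_cball by (intro the_equality) blast+
  then show ?thesis using assms unfolding unfold_upper_def by (auto simp: Let_def)
qed

lemma unfold_off_balls:
  assumes "\<And>i. i < k \<Longrightarrow> hr \<le> norm (w - hc i)"
  shows "unfold_upper w = (w, sqrt (1 - (norm w)\<^sup>2))"
proof -
  have "\<not> (\<exists>i<k. w \<in> ball (hc i) hr)" using assms by (force simp: dist_norm norm_minus_commute)
  then show ?thesis unfolding unfold_upper_def by (simp only: if_False)
qed

lemma tube_top_in_perforated:
  assumes i: "i < k" and x: "(z, t) \<in> tube k i" and top: "\<bar>t\<bar> = sqrt (1 - (norm z)\<^sup>2)"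
  shows "(z, t) \<in> perforated_sphere k"
proof -
  note tf = tube_facts[OF i x]
  have "t\<^sup>2 = (sqrt (1 - (norm z)\<^sup>2))\<^sup>2" using top by (metis power2_abs)
  moreover have "0 \<le> 1 - (norm z)\<^sup>2" using tf(3) by (simp add: less_imp_le)
  ultimately have "(norm z)\<^sup>2 + t\<^sup>2 = 1" by simp
  then have "(z, t) \<in> sphere 0 1" by (simp add: norm_Pair)
  moreover have "z \<notin> ball (hc j) hr" if j: "j < k" for j
  proof
    assume zj: "z \<in> ball (hc j) hr"
    have "z \<in> cball (hc i) hr" using tf(1) by (simp add: dist_norm norm_minus_commute)
    then have "i = j" using handle_unique[OF i j] zj ball_subset_cball by blast
    then show False using zj tf(1) by (simp add: dist_norm norm_minus_commute)
  qed
  ultimately show ?thesis unfolding perforated_sphere_def by auto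
qed

lemma fold_tube_facts:
  assumes i: "i < k" and x: "(z, t) \<in> tube k i"
  defines "l \<equiv> 1 / 2 + \<bar>t\<bar> / (2 * sqrt (1 - (norm z)\<^sup>2))"
  shows "fold_surface k (z, t) - hc i = of_real l * (z - hc i)" "1 / 2 \<le> l" "l \<le> 1"
    "norm (fold_surface k (z, t) - hc i) = l * hr" "l = 1 / 2 \<longleftrightarrow> t = 0" "l = 1 \<longleftrightarrow> \<bar>t\<bar> = sqrt (1 - (norm z)\<^sup>2)"
proof -
  note tf = tube_facts[OF i x]
  let ?d = "sqrt (1 - (norm z)\<^sup>2)"
  show 1: "fold_surface k (z, t) - hc i = of_real l * (z - hc i)"
    using fold_on_tube[OF i x] unfolding fold_tube_def l_def by simp
  show 2: "1 / 2 \<le> l" unfolding l_def using tf(3) by simp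
  have "\<bar>t\<bar> / (2 * ?d) \<le> 1 / 2" using tf(3,4) by (simp add: field_simps)
  then show "l \<le> 1" unfolding l_def by linarith
  have "norm (fold_surface k (z, t) - hc i) = \<bar>l\<bar> * norm (z - hc i)" unfolding 1 by (simp only: norm_mult norm_of_real)
  then show "norm (fold_surface k (z, t) - hc i) = l * hr" using 2 tf(1) by simp
  show "l = 1 / 2 \<longleftrightarrow> t = 0" unfolding l_def using tf(3) by simp
  show "l = 1 \<longleftrightarrow> \<bar>t\<bar> = ?d" unfolding l_def using tf(3) by (auto simp: field_simps)
qed

lemma unfold_fold:
  assumes x: "(z, t) \<in> sphere_with_handles k" "0 \<le> t"
  shows "unfold_upper (fold_surface k (z, t)) = (z, t)"
proof -
  have perf: "unfold_upper (fold_surface k (z, t)) = (z, t)" if p: "(z, t) \<in> perforated_sphere k"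
    using unfold_off_balls[OF perforated_facts(4)[OF p]] perforated_facts(2)[OF p] x(2)
    unfolding fold_on_perforated[OF p] by simp
  show ?thesis
    using x(1)
  proof (cases rule: surface_cases)
    case (1 z' t') then show ?thesis using perf by simp
  next
    case (2 i z' t')
    then have i: "i < k" "(z, t) \<in> tube k i" by auto
    define l where "l = 1 / 2 + \<bar>t\<bar> / (2 * sqrt (1 - (norm z)\<^sup>2))"
    note ff = fold_tube_facts[OF i, folded l_def] and tf = tube_facts[OF i]
    show ?thesis
    proof (cases "l = 1")
      case True
      then show ?thesis using perf tube_top_in_perforated[OF i] ff(6) by blast
    next
      case False
      let ?w = "fold_surface k (z, t)"
      have l: "0 < l" "l < 1" using ff(2,3) False by auto
      have "norm (?w - hc i) < hr" unfolding ff(4) using l hr_pos by simp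
      then have "?w \<in> ball (hc i) hr" by (simp only: mem_ball dist_norm norm_minus_commute)
      note u = unfold_in_ball[OF i(1) this]
      have eq: "hr / norm (?w - hc i) = 1 / l" unfolding ff(4) using hr_pos l by (simp add: field_simps)
      have z: "hc i + of_real (hr / norm (?w - hc i)) * (?w - hc i) = z"
        unfolding eq unfolding ff(1) using l(1) by simp
      have "2 * norm (?w - hc i) / hr - 1 = 2 * l - 1" unfolding ff(4) using hr_pos by (simp add: field_simps)
      also have "\<dots> = t / sqrt (1 - (norm z)\<^sup>2)" unfolding l_def using x(2) by simp
      finally have "(2 * norm (?w - hc i) / hr - 1) * sqrt (1 - (norm z)\<^sup>2) = t" using tf(3) by simp
      then show ?thesis unfolding u Let_def z by simp
    qed
  qed
qed

lemma fold_unfold: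
  assumes w: "w \<in> holed_disc k hc (hr / 2)"
  shows "unfold_upper w \<in> sphere_with_handles k" "0 \<le> snd (unfold_upper w)" "fold_surface k (unfold_upper w) = w"
proof -
  have nw: "norm w \<le> 1" using w unfolding holed_disc_def by auto
  have "unfold_upper w \<in> sphere_with_handles k \<and> 0 \<le> snd (unfold_upper w) \<and> fold_surface k (unfold_upper w) = w"
  proof (cases "\<exists>i<k. w \<in> ball (hc i) hr")
    case False
    then have far: "hr \<le> norm (w - hc i)" if "i < k" for i using that by (force simp: dist_norm norm_minus_commute)
    note u = unfold_off_balls[OF far]
    have n2: "(norm w)\<^sup>2 \<le> 1" using nw by (simp add: power_le_one)
    have "(w, sqrt (1 - (norm w)\<^sup>2)) \<in> perforated_sphere k"
      unfolding perforated_sphere_def using n2 False by (auto simp: norm_Pair)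
    then show ?thesis using u fold_on_perforated n2 unfolding sphere_with_handles_eq by auto
  next
    case True
    then obtain i where i: "i < k" "w \<in> ball (hc i) hr" by blast
    define m where "m = norm (w - hc i)"
    define z where "z = hc i + of_real (hr / m) * (w - hc i)"
    define t where "t = (2 * m / hr - 1) * sqrt (1 - (norm z)\<^sup>2)"
    have u: "unfold_upper w = (z, t)" using unfold_in_ball[OF i] unfolding Let_def z_def t_def m_def .
    have m: "hr / 2 \<le> m" "m < hr"
    proof -
      have "w \<notin> ball (hc i) (hr / 2)" using w i(1) unfolding holed_disc_def by blast
      then show "hr / 2 \<le> m" unfolding m_def by (simp add: dist_norm norm_minus_commute)
      show "m < hr" using i(2) unfolding m_def by (simp add: dist_norm norm_minus_commute)
    qed
    have m0: "0 < m" using m(1) hr_pos by linarith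
    have nz: "norm (z - hc i) = hr"
    proof -
      have "norm (z - hc i) = \<bar>hr / m\<bar> * m" unfolding z_def m_def by (simp add: norm_mult norm_divide)
      then show ?thesis using m0 hr_pos by simp
    qed
    then have zc: "z \<in> cball (hc i) hr" "z \<in> sphere (hc i) hr" by (simp_all add: dist_norm norm_minus_commute)
    then have "z \<in> ball 0 1" using handle_inside[OF i(1)] by blast
    then have "norm z < 1" by simp
    then have n2: "(norm z)\<^sup>2 < 1" by (simp add: abs_square_less_1)
    have coef: "0 \<le> 2 * m / hr - 1" "2 * m / hr - 1 \<le> 1" using m hr_pos by (simp_all add: field_simps)
    have t: "0 \<le> t" "t \<le> sqrt (1 - (norm z)\<^sup>2)"
      unfolding t_def using coef n2 by (auto intro: mult_left_le_one_le)
    have "t\<^sup>2 \<le> (sqrt (1 - (norm z)\<^sup>2))\<^sup>2" by (rule power_mono[OF t(2,1)])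
    then have "norm (z, t) \<le> 1" using n2 by (simp add: norm_Pair)
    then have tb: "(z, t) \<in> tube k i" unfolding tube_def using zc by simp
    define l where "l = 1 / 2 + \<bar>t\<bar> / (2 * sqrt (1 - (norm z)\<^sup>2))"
    note ff = fold_tube_facts[OF i(1) tb, folded l_def]
    have "l = 1 / 2 + (2 * m / hr - 1) / 2" unfolding l_def t_def using n2 coef by (simp add: abs_mult)
    then have l: "l = m / hr" by (simp add: field_simps)
    have "fold_surface k (z, t) - hc i = of_real (m / hr) * (of_real (hr / m) * (w - hc i))"
      using ff(1) unfolding l z_def by simp
    also have "\<dots> = w - hc i" using m0 hr_pos by (simp add: field_simps)
    finally show ?thesis using u tb t(1) i(1) unfolding sphere_with_handles_eq by auto
  qed
  then show "unfold_upper w \<in> sphere_with_handles k" "0 \<le> snd (unfold_upper w)" "fold_surface k (unfold_upper w) = w"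
    by blast+
qed

lemma fold_in_holed_disc:
  assumes "x \<in> sphere_with_handles k"
  shows "fold_surface k x \<in> holed_disc k hc (hr / 2)" 
    and "snd x = 0 \<longleftrightarrow> fold_surface k x \<in> holed_disc_rim k hc (hr / 2)"
proof -
  have "fold_surface k x \<in> holed_disc k hc (hr / 2) \<and> (snd x = 0 \<longleftrightarrow> fold_surface k x \<in> holed_disc_rim k hc (hr / 2))"
    using assms
  proof (cases rule: surface_cases)
    case (1 z t)
    note pf = perforated_facts[OF 1(2)]
    have far: "hr / 2 < dist (hc i) z" if "i < k" for i
      using pf(4)[OF that] hr_pos by (simp add: dist_norm norm_minus_commute)
    have "t = 0 \<longleftrightarrow> norm z = 1"
    proof
      assume "t = 0" then show "norm z = 1" using pf(1) by (simp add: power2_eq_1_iff) (smt (verit) norm_ge_zero)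
    next
      assume "norm z = 1" then show "t = 0" using pf(1) by simp
    qed
    then show ?thesis using fold_on_perforated[OF 1(2)] pf(3) far 1(1)
      unfolding holed_disc_def holed_disc_rim_def by force
  next
    case (2 i z t)
    define l where "l = 1 / 2 + \<bar>t\<bar> / (2 * sqrt (1 - (norm z)\<^sup>2))"
    note ff = fold_tube_facts[OF 2(1,3), folded l_def]
    let ?w = "fold_surface k (z, t)"
    have "l * hr \<le> 1 * hr" by (rule mult_right_mono[OF ff(3)]) (use hr_pos in simp)
    then have d: "dist (hc i) ?w = l * hr" "l * hr \<le> hr" using ff(4) by (simp_all add: dist_norm norm_minus_commute)
    then have wi: "?w \<in> cball (hc i) hr" by simp
    then have "?w \<in> ball 0 1" using handle_inside[OF 2(1)] by blast
    then have n1: "norm ?w < 1" by simp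
    have other: "hr / 2 < dist (hc j) ?w" if "j < k" "j \<noteq> i" for j
    proof (rule ccontr)
      assume "\<not> hr / 2 < dist (hc j) ?w"
      then have "?w \<in> cball (hc j) hr" using hr_pos by simp
      then show False using handle_unique[OF that(1) 2(1)] wi that(2) by blast
    qed
    have ge: "hr / 2 \<le> dist (hc i) ?w" unfolding d(1) using mult_right_mono[OF ff(2), of hr] hr_pos by simp
    have eq: "dist (hc i) ?w = hr / 2 \<longleftrightarrow> t = 0" unfolding d(1) ff(5)[symmetric] using hr_pos by auto
    have "?w \<in> holed_disc k hc (hr / 2)"
      using n1 other ge unfolding holed_disc_def by (auto, metis leD less_imp_le)
    moreover have "?w \<in> holed_disc_rim k hc (hr / 2) \<longleftrightarrow> dist (hc i) ?w = hr / 2"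
    proof
      assume "?w \<in> holed_disc_rim k hc (hr / 2)"
      then obtain j where "j < k" "dist (hc j) ?w = hr / 2" using n1 unfolding holed_disc_rim_def by auto
      then show "dist (hc i) ?w = hr / 2" using other[of j] by fastforce
    qed (use 2(1) in \<open>auto simp: holed_disc_rim_def\<close>)
    ultimately show ?thesis using eq 2(2) by simp
  qed
  then show "fold_surface k x \<in> holed_disc k hc (hr / 2)"
    and "snd x = 0 \<longleftrightarrow> fold_surface k x \<in> holed_disc_rim k hc (hr / 2)" by blast+
qed

lemma fold_mirror:
  assumes "(z, t) \<in> sphere_with_handles k"
  shows "(z, - t) \<in> sphere_with_handles k" "fold_surface k (z, - t) = fold_surface k (z, t)"
proof -
  have tb: "(z, - t) \<in> tube k i \<longleftrightarrow> (z, t) \<in> tube k i" for i unfolding tube_def by (simp add: norm_Pair)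
  have pf: "(z, - t) \<in> perforated_sphere k \<longleftrightarrow> (z, t) \<in> perforated_sphere k"
    unfolding perforated_sphere_def by (simp add: norm_Pair)
  show "(z, - t) \<in> sphere_with_handles k" using assms tb pf unfolding sphere_with_handles_eq by auto
  show "fold_surface k (z, - t) = fold_surface k (z, t)"
  proof -
    have "fold_tube k i (z, - t) = fold_tube k i (z, t)" for i by (simp add: fold_tube_def)
    then show ?thesis unfolding fold_surface_def tb fst_conv by (simp only:)
  qed
qed

text \<open>The two copies are the parts of the surface with nonnegative and with nonpositive height; the seam is the part at
height 0, which consists of the equator and of one circle on each tube.\<close>

theorem sphere_with_handles_doubled_disc:
  "doubled_disc (sphere_with_handles k) {x \<in> sphere_with_handles k. 0 \<le> snd x} {x \<in> sphere_with_handles k. snd x \<le> 0}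
     (fold_surface k) k (handle_centre k) (handle_radius k / 2)"
proof -
  let ?S = "sphere_with_handles k"
  let ?A = "{x \<in> ?S. 0 \<le> snd x}" and ?B = "{x \<in> ?S. snd x \<le> 0}"
  let ?q = "fold_surface k"
  have rle: "hr / 2 \<le> hr" using hr_pos by simp
  have inj: "inj_on ?q ?A"
    by (rule inj_on_inverseI[of _ unfold_upper]) (use unfold_fold in auto)
  have im: "?q ` ?A = holed_disc k hc (hr / 2)"
  proof
    show "?q ` ?A \<subseteq> holed_disc k hc (hr / 2)" using fold_in_holed_disc by blast
    show "holed_disc k hc (hr / 2) \<subseteq> ?q ` ?A"
    proof
      fix w assume "w \<in> holed_disc k hc (hr / 2)"
      then show "w \<in> ?q ` ?A" using fold_unfold[of w] by (intro image_eqI[of _ _ "unfold_upper w"]) auto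
    qed
  qed
  define \<mu> :: "complex \<times> real \<Rightarrow> complex \<times> real" where "\<mu> = (\<lambda>x. (fst x, - snd x))"
  have \<mu>: "\<mu> x \<in> ?S" "?q (\<mu> x) = ?q x" if "x \<in> ?S" for x
    using fold_mirror[of "fst x" "snd x"] that unfolding \<mu>_def by simp_all
  have \<mu>\<mu>: "\<mu> (\<mu> x) = x" "snd (\<mu> x) = - snd x" for x unfolding \<mu>_def by simp_all
  have \<mu>A: "\<mu> ` ?B = ?A"
  proof
    show "\<mu> ` ?B \<subseteq> ?A" using \<mu>(1) \<mu>\<mu>(2) by auto
    show "?A \<subseteq> \<mu> ` ?B"
    proof
      fix x assume x: "x \<in> ?A"
      have "\<mu> x \<in> ?B" using x \<mu>(1)[of x] \<mu>\<mu>(2)[of x] by simp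
      then show "x \<in> \<mu> ` ?B" using \<mu>\<mu>(1)[of x] by (metis imageI)
    qed
  qed
  have injB: "inj_on ?q ?B"
  proof (rule inj_onI)
    fix x y assume xy: "x \<in> ?B" "y \<in> ?B" "?q x = ?q y"
    have "\<mu> x \<in> ?A" "\<mu> y \<in> ?A" using xy \<mu>A by blast+
    moreover have "?q (\<mu> x) = ?q (\<mu> y)" using xy \<mu>(2) by simp
    ultimately have "\<mu> x = \<mu> y" using inj_onD[OF inj] by blast
    then show "x = y" using \<mu>\<mu>(1) by metis
  qed
  have imB: "?q ` ?B = holed_disc k hc (hr / 2)"
  proof -
    have "?q ` ?B = ?q ` \<mu> ` ?B" unfolding image_image by (rule image_cong) (use \<mu>(2) in auto)
    then show ?thesis unfolding \<mu>A im .
  qed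
  show ?thesis
  proof (rule doubled_disc.intro)
    show "0 < hr / 2" using hr_pos by simp
    show "cball (hc i) (hr / 2) \<subseteq> ball 0 1" if "i < k" for i
      using handle_inside[OF that] subset_cball[OF rle] by blast
    show "cball (hc i) (hr / 2) \<inter> cball (hc j) (hr / 2) = {}" if "i < k" "j < k" "i \<noteq> j" for i j
      using handle_disjoint[OF that] subset_cball[OF rle, of "hc i"] subset_cball[OF rle, of "hc j"] by blast
    have "closed {x :: complex \<times> real. 0 \<le> snd x}" "closed {x :: complex \<times> real. snd x \<le> 0}"
      by (intro closed_Collect_le continuous_intros)+
    then have "compact (?S \<inter> {x. 0 \<le> snd x})" "compact (?S \<inter> {x. snd x \<le> 0})"
      using compact_surface compact_Int_closed by blast+
    moreover have "?A = ?S \<inter> {x. 0 \<le> snd x}" "?B = ?S \<inter> {x. snd x \<le> 0}" by blast+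
    ultimately show "compact ?A" "compact ?B" by (simp_all only:)
    show "?S = ?A \<union> ?B" by auto
    show "continuous_on ?S ?q" by (rule continuous_fold)
    show "inj_on ?q ?A" "inj_on ?q ?B" "?q ` ?A = holed_disc k hc (hr / 2)" "?q ` ?B = holed_disc k hc (hr / 2)"
      using inj injB im imB by simp_all
    show "?A \<inter> ?B = {x \<in> ?S. ?q x \<in> holed_disc_rim k hc (hr / 2)}"
    proof -
      have "?A \<inter> ?B = {x \<in> ?S. snd x = 0}" by auto
      also have "\<dots> = {x \<in> ?S. ?q x \<in> holed_disc_rim k hc (hr / 2)}"
        using fold_in_holed_disc(2) by blast
      finally show ?thesis .
    qed
  qed
qed

end

section \<open>Graphs with too many edges\<close>

text \<open>The inequalities \<open>3 F \<le> 2 E\<close> and \<open>E \<le> V + F + 2 k\<close> together.\<close>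

lemma drawing_edge_bound:
  assumes k: "0 < k" and dr: "drawable_on (sphere_with_handles k) G"
    and fin: "finite (verts G)" "finite (edges G)" and three: "3 \<le> card (edges G)"
    and e2: "\<And>e. e \<in> edges G \<Longrightarrow> card e = 2 \<and> e \<subseteq> verts G"
  shows "card (edges G) \<le> 3 * card (verts G) + 6 * k"
proof -
  interpret doubled_disc "sphere_with_handles k" "{x \<in> sphere_with_handles k. 0 \<le> snd x}"
      "{x \<in> sphere_with_handles k. snd x \<le> 0}" "fold_surface k" k "handle_centre k" "handle_radius k / 2"
    by (rule sphere_with_handles_doubled_disc[OF k])
  have conn: "connected (sphere_with_handles k)"
    by (rule connected_S_real_centres) (simp add: handle_centre_def)
  obtain pos curve0 where "drawing_on (sphere_with_handles k) G pos curve0"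
    using dr unfolding drawable_on_def by blast
  then obtain curve where c: "drawing_on (sphere_with_handles k) G pos curve" "straight_drawing (sphere_with_handles k) G curve"
    using straight_drawing_exists[OF locally_disc_S _ fin] by metis
  let ?F = "components (sphere_with_handles k - drawn_set G curve)"
  have "3 * card ?F \<le> 2 * card (edges G)"
    by (rule three_faces_le_two_edges(2)[OF locally_disc_S conn c fin(2) three e2])
  moreover have "finite ?F"
    by (rule three_faces_le_two_edges(1)[OF locally_disc_S conn c fin(2) three e2])
  then have "card (edges G) \<le> card (verts G) + card ?F + 2 * k"
    using edges_le_vertices_faces[OF locally_disc_S c(1) fin] e2 by blast
  ultimately show ?thesis by linarith
qed

text \<open>Two edges with the common vertex \<open>v\<close> are determined by \<open>v\<close> and the set \<open>P\<close> of the two other vertices, and conversely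
\<open>v\<close> and \<open>P\<close> can be read off from the intersection and the union of the two edges.\<close>

lemma card_edges_line_graph_complete:
  assumes N: "finite N" and G: "edges G = {e. e \<subseteq> N \<and> card e = 2}"
  shows "card N * ((card N - 1) choose 2) \<le> card (edges (line_graph G))"
proof -
  let ?P = "Sigma N (\<lambda>v. {P. P \<subseteq> N - {v} \<and> card P = 2})"
  define \<phi> where "\<phi> = (\<lambda>(v, P). (\<lambda>a. {v, a}) ` P :: 'a set set)"
  have "card ?P = (\<Sum>v\<in>N. card {P. P \<subseteq> N - {v} \<and> card P = 2})"
    using N by (intro card_SigmaI) auto
  also have "\<dots> = (\<Sum>v\<in>N. (card N - 1) choose 2)"
    using N by (intro sum.cong) (simp_all add: n_subsets)
  finally have cP: "card ?P = card N * ((card N - 1) choose 2)" by simp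
  have pair: "\<exists>a b. P = {a, b} \<and> a \<noteq> b \<and> a \<noteq> v \<and> b \<noteq> v \<and> a \<in> N \<and> b \<in> N \<and> v \<in> N" if vP: "(v, P) \<in> ?P" for v P
  proof -
    have "card P = 2" "P \<subseteq> N - {v}" "v \<in> N" using vP by auto
    then show ?thesis unfolding card_2_iff by blast
  qed
  have inter: "\<Inter>(\<phi> (v, P)) = {v}" "\<Union>(\<phi> (v, P)) = insert v P" if vP: "(v, P) \<in> ?P" for v P
  proof -
    obtain a b where "P = {a, b}" "a \<noteq> b" "a \<noteq> v" "b \<noteq> v" using pair[OF vP] by blast
    then show "\<Inter>(\<phi> (v, P)) = {v}" "\<Union>(\<phi> (v, P)) = insert v P" unfolding \<phi>_def by auto
  qed
  have inj: "inj_on \<phi> ?P"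
  proof (rule inj_onI, clarify)
    fix v P w Q assume vP: "v \<in> N" "P \<subseteq> N - {v}" "card P = 2" and wQ: "w \<in> N" "Q \<subseteq> N - {w}" "card Q = 2"
      and eq: "\<phi> (v, P) = \<phi> (w, Q)"
    have m: "(v, P) \<in> ?P" "(w, Q) \<in> ?P" using vP wQ by auto
    have "{v} = {w}" using inter(1)[OF m(1)] inter(1)[OF m(2)] eq by simp
    then have "v = w" by simp
    moreover have "insert v P = insert w Q" using inter(2)[OF m(1)] inter(2)[OF m(2)] eq by simp
    ultimately show "v = w \<and> P = Q" using vP(2) wQ(2) by blast
  qed
  have "\<phi> ` ?P \<subseteq> edges (line_graph G)"
  proof (rule image_subsetI)
    fix x assume x: "x \<in> ?P"
    obtain v P where vP: "x = (v, P)" by (cases x)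
    obtain a b where ab: "P = {a, b}" "a \<noteq> b" "a \<noteq> v" "b \<noteq> v" "a \<in> N" "b \<in> N" "v \<in> N"
      using pair x unfolding vP by blast
    have "\<phi> x = {{v, a}, {v, b}}" unfolding \<phi>_def vP ab(1) by simp
    moreover have "{v, a} \<in> edges G" "{v, b} \<in> edges G" unfolding G using ab by auto
    moreover have "{v, a} \<noteq> {v, b}" using ab by (auto simp: doubleton_eq_iff)
    moreover have "{v, a} \<inter> {v, b} \<noteq> {}" by blast
    ultimately show "\<phi> x \<in> edges (line_graph G)" unfolding line_graph_def by auto
  qed
  moreover have "finite (edges (line_graph G))"
  proof (rule finite_subset)
    show "edges (line_graph G) \<subseteq> Pow (Pow N)" unfolding line_graph_def using G by auto
  qed (use N in simp)
  ultimately have "card ?P \<le> card (edges (line_graph G))" by (rule card_inj_on_le[OF inj])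
  then show ?thesis unfolding cP .
qed

lemma line_graph_complete_not_drawable:
  assumes N: "finite N" "6 \<le> card N" and G: "edges G = {e. e \<subseteq> N \<and> card e = 2}" and k: "k \<in> {1, 2}"
  shows "\<not> drawable_on (sphere_with_handles k) (line_graph G)"
proof
  assume dr: "drawable_on (sphere_with_handles k) (line_graph G)"
  let ?n = "card N" and ?L = "line_graph G"
  have V: "verts ?L = {e. e \<subseteq> N \<and> card e = 2}" unfolding line_graph_def using G by simp
  have cV: "card (verts ?L) = ?n choose 2" unfolding V by (rule n_subsets[OF N(1)])
  have E: "?n * ((?n - 1) choose 2) \<le> card (edges ?L)" by (rule card_edges_line_graph_complete[OF N(1) G])
  have "finite (verts ?L)" unfolding V using N(1) by auto
  moreover have "finite (edges ?L)"
  proof (rule finite_subset)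
    show "edges ?L \<subseteq> Pow (Pow N)" unfolding line_graph_def using G by auto
  qed (use N in simp)
  moreover have "card e = 2 \<and> e \<subseteq> verts ?L" if e: "e \<in> edges ?L" for e
  proof -
    obtain f g where "e = {f, g}" "f \<in> edges G" "g \<in> edges G" "f \<noteq> g"
      using e unfolding line_graph_def by auto
    then show ?thesis unfolding line_graph_def by simp
  qed
  moreover obtain m where m: "?n = m + 6" using N(2) by (metis add.commute le_Suc_ex)
  have c1: "2 * ((m + 6) choose 2) = (m + 6) * (m + 5)"
  proof -
    have "(m + 6) choose 2 = (m + 6) * (m + 5) div 2" by (simp add: choose_two add.commute)
    moreover have "even ((m + 6) * (m + 5))" by simp
    ultimately show ?thesis by simp
  qed
  have c2: "2 * ((m + 5) choose 2) = (m + 5) * (m + 4)"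
  proof -
    have "(m + 5) choose 2 = (m + 5) * (m + 4) div 2" by (simp add: choose_two add.commute)
    moreover have "even ((m + 5) * (m + 4))" by simp
    ultimately show ?thesis by simp
  qed
  have E': "(m + 6) * ((m + 5) * (m + 4)) \<le> 2 * card (edges ?L)"
  proof -
    have "(m + 6) * ((m + 5) choose 2) \<le> card (edges ?L)" using E m by (simp add: add.commute)
    moreover have "(m + 6) * ((m + 5) * (m + 4)) = 2 * ((m + 6) * ((m + 5) choose 2))"
      unfolding c2[symmetric] by (simp only: mult_ac)
    ultimately show ?thesis by linarith
  qed
  then have three: "3 \<le> card (edges ?L)"
    by (simp add: algebra_simps)
  ultimately have "card (edges ?L) \<le> 3 * card (verts ?L) + 6 * k"
    using k by (intro drawing_edge_bound[OF _ dr]) auto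
  \<comment> \<open>This is \<open>E \<le> 3 V + 12\<close> with both sides doubled.\<close>
  then have "2 * card (edges ?L) \<le> 3 * ((m + 6) * (m + 5)) + 24"
    using k unfolding cV m c1[symmetric] by auto
  then have "(m + 6) * ((m + 5) * (m + 4)) \<le> 3 * ((m + 6) * (m + 5)) + 24" using E' by linarith
  then show False by (simp add: algebra_simps)
qed

section \<open>Drawing on the octahedron\<close>

text \<open>The great circle arc between two orthogonal unit vectors, as the radial projection of the segment.\<close>

definition octahedron_arc :: "'b::real_inner \<Rightarrow> 'b \<Rightarrow> real \<Rightarrow> 'b" where
  "octahedron_arc a b t = sgn ((1 - t) *\<^sub>R a + t *\<^sub>R b)"

lemma octahedron_arc:
  fixes a b :: "'b::real_inner"
  assumes "norm a = 1" "norm b = 1" "a \<bullet> b = 0"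
  shows "arc (octahedron_arc a b)" "path_image (octahedron_arc a b) \<subseteq> sphere 0 1"
    "pathstart (octahedron_arc a b) = a" "pathfinish (octahedron_arc a b) = b"
    "\<And>x. x \<in> path_image (octahedron_arc a b) \<Longrightarrow>
       \<exists>\<alpha> \<beta>. 0 \<le> \<alpha> \<and> 0 \<le> \<beta> \<and> x = \<alpha> *\<^sub>R a + \<beta> *\<^sub>R b"
proof -
  define p where "p = (\<lambda>t. (1 - t) *\<^sub>R a + t *\<^sub>R b)"
  have aa: "a \<bullet> a = 1" "b \<bullet> b = 1" "b \<bullet> a = 0" using assms by (simp_all add: dot_square_norm inner_commute)
  have pa: "p t \<bullet> a = 1 - t" "p t \<bullet> b = t" for t
    using assms(3) aa by (simp_all add: p_def inner_add_left)
  have p0: "p t \<noteq> 0" for t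
  proof
    assume "p t = 0"
    then show False using pa[of t] by simp
  qed
  have arc_p: "octahedron_arc a b t = (1 / norm (p t)) *\<^sub>R p t" for t
    unfolding octahedron_arc_def p_def sgn_div_norm by (simp add: divide_inverse)
  have cp: "continuous_on {0..1} p" unfolding p_def by (intro continuous_intros)
  have "path (octahedron_arc a b)"
    unfolding path_def arc_p using p0 by (intro continuous_intros cp) auto
  moreover have "inj_on (octahedron_arc a b) {0..1}"
  proof (rule inj_onI)
    fix s t :: real assume st: "s \<in> {0..1}" "t \<in> {0..1}" "octahedron_arc a b s = octahedron_arc a b t"
    define u where "u = 1 / norm (p s)"
    define v where "v = 1 / norm (p t)"
    have uv: "0 < u" "0 < v" unfolding u_def v_def using p0 by auto
    have eq: "u *\<^sub>R p s = v *\<^sub>R p t" using st(3) unfolding arc_p u_def v_def .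
    have "u * (1 - s) = v * (1 - t)" using arg_cong[OF eq, of "\<lambda>x. x \<bullet> a"] pa by simp
    moreover have us: "u * s = v * t" using arg_cong[OF eq, of "\<lambda>x. x \<bullet> b"] pa by simp
    ultimately have "u = v" by (simp add: algebra_simps)
    then show "s = t" using us uv by simp
  qed
  ultimately show "arc (octahedron_arc a b)" unfolding arc_def by blast
  show "path_image (octahedron_arc a b) \<subseteq> sphere 0 1"
    unfolding path_image_def arc_p using p0 by auto
  show "pathstart (octahedron_arc a b) = a" "pathfinish (octahedron_arc a b) = b"
    using assms(1,2) by (simp_all add: pathstart_def pathfinish_def octahedron_arc_def sgn_div_norm)
  fix x assume "x \<in> path_image (octahedron_arc a b)"
  then obtain t where t: "t \<in> {0..1}" "x = octahedron_arc a b t" unfolding path_image_def by blast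
  have "x = ((1 - t) / norm (p t)) *\<^sub>R a + (t / norm (p t)) *\<^sub>R b"
    unfolding t(2) arc_p by (simp add: p_def scaleR_add_right)
  then show "\<exists>\<alpha> \<beta>. 0 \<le> \<alpha> \<and> 0 \<le> \<beta> \<and> x = \<alpha> *\<^sub>R a + \<beta> *\<^sub>R b"
    using t(1) by (intro exI[of _ "(1 - t) / norm (p t)"] exI[of _ "t / norm (p t)"]) auto
qed

text \<open>A point of the arc between \<open>a\<close> and \<open>b\<close> has positive inner product with no vertex of the octahedron except
\<open>a\<close> and \<open>b\<close>.  A common point of two arcs is therefore a nonnegative multiple of a common end.\<close>

lemma octahedral_drawing:
  fixes pos :: "'v \<Rightarrow> 'b::real_inner"
  assumes inj: "inj_on pos (verts G)"
    and unit: "\<And>v. v \<in> verts G \<Longrightarrow> norm (pos v) = 1"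
    and nonpos: "\<And>v w. \<lbrakk>v \<in> verts G; w \<in> verts G; v \<noteq> w\<rbrakk> \<Longrightarrow> pos v \<bullet> pos w \<le> 0"
    and edge: "\<And>e. e \<in> edges G \<Longrightarrow> \<exists>v w. e = {v, w} \<and> v \<noteq> w \<and> v \<in> verts G \<and> w \<in> verts G \<and> pos v \<bullet> pos w = 0"
  shows "drawable_on (sphere (0::'b) 1) G"
proof -
  obtain st fi where sf: "\<And>e. e \<in> edges G \<Longrightarrow> e = {st e, fi e} \<and> st e \<noteq> fi e \<and> st e \<in> verts G \<and> fi e \<in> verts G \<and> pos (st e) \<bullet> pos (fi e) = 0"
    using edge by metis
  define curve where "curve = (\<lambda>e. octahedron_arc (pos (st e)) (pos (fi e)))"
  have oa: "arc (curve e)" "path_image (curve e) \<subseteq> sphere 0 1" "pathstart (curve e) = pos (st e)" "pathfinish (curve e) = pos (fi e)"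
    "\<And>x. x \<in> path_image (curve e) \<Longrightarrow> \<exists>\<alpha> \<beta>. 0 \<le> \<alpha> \<and> 0 \<le> \<beta> \<and> x = \<alpha> *\<^sub>R pos (st e) + \<beta> *\<^sub>R pos (fi e)"
    if e: "e \<in> edges G" for e
    unfolding curve_def using octahedron_arc[of "pos (st e)" "pos (fi e)"] unit sf[OF e] by auto
  have eV: "e \<subseteq> verts G" if e: "e \<in> edges G" for e
  proof -
    have "e = {st e, fi e}" "st e \<in> verts G" "fi e \<in> verts G" using sf[OF e] by blast+
    then show ?thesis by (metis empty_subsetI insert_subset)
  qed
  have ends: "pos ` e = {pos (st e), pos (fi e)}" if e: "e \<in> edges G" for e
  proof -
    have "e = {st e, fi e}" using sf[OF e] by blast
    then have "pos ` e = pos ` {st e, fi e}" by (rule arg_cong)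
    then show ?thesis by simp
  qed
  have sub: "pos ` e \<subseteq> path_image (curve e)" if e: "e \<in> edges G" for e
    unfolding ends[OF e] using oa(3,4)[OF e] pathstart_in_path_image[of "curve e"] pathfinish_in_path_image[of "curve e"] by simp
  have sq: "pos v \<bullet> pos v = 1" if "v \<in> verts G" for v using unit[OF that] by (simp add: dot_square_norm)
  have off: "x \<bullet> pos v \<le> 0" if e: "e \<in> edges G" and x: "x \<in> path_image (curve e)" and v: "v \<in> verts G" "v \<notin> e" for e x v
  proof -
    obtain \<alpha> \<beta> where lm: "0 \<le> \<alpha>" "0 \<le> \<beta>" "x = \<alpha> *\<^sub>R pos (st e) + \<beta> *\<^sub>R pos (fi e)" using oa(5)[OF e x] by blast
    have "st e \<noteq> v" "fi e \<noteq> v" using sf[OF e] v(2) by blast+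
    then have "pos (st e) \<bullet> pos v \<le> 0" "pos (fi e) \<bullet> pos v \<le> 0" using nonpos sf[OF e] v(1) by auto
    then have "\<alpha> * (pos (st e) \<bullet> pos v) \<le> 0" "\<beta> * (pos (fi e) \<bullet> pos v) \<le> 0"
      using lm by (auto intro: mult_nonneg_nonpos)
    then show ?thesis unfolding lm(3) by (simp add: inner_add_left)
  qed
  have common: "x \<in> pos ` (e \<inter> f)" if e: "e \<in> edges G" and x: "x \<in> path_image (curve e)" and f: "f \<noteq> e" "\<not> e \<subseteq> f"
      and neg: "\<And>v. v \<in> e - f \<Longrightarrow> x \<bullet> pos v \<le> 0" for e f x
  proof -
    obtain \<alpha> \<beta> where lm: "0 \<le> \<alpha>" "0 \<le> \<beta>" "x = \<alpha> *\<^sub>R pos (st e) + \<beta> *\<^sub>R pos (fi e)" using oa(5)[OF e x] by blast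
    have vs: "st e \<in> verts G" "fi e \<in> verts G" "pos (st e) \<bullet> pos (fi e) = 0" "pos (fi e) \<bullet> pos (st e) = 0" "e = {st e, fi e}"
      using sf[OF e] by (auto simp: inner_commute)
    have mem: "st e \<in> e" "fi e \<in> e" using vs(5) by blast+
    have xs: "x \<bullet> pos (st e) = \<alpha>" "x \<bullet> pos (fi e) = \<beta>"
      unfolding lm(3) using vs(3,4) sq[OF vs(1)] sq[OF vs(2)] by (simp_all add: inner_add_left)
    have nx: "norm x = 1" using oa(2)[OF e] x by auto
    have zs: "\<alpha> = 0" if "st e \<notin> f" using neg[of "st e"] that mem xs(1) lm(1) by auto
    have zf: "\<beta> = 0" if "fi e \<notin> f" using neg[of "fi e"] that mem xs(2) lm(2) by auto
    show ?thesis
    proof (cases "st e \<in> f")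
      case True
      have "fi e \<notin> f"
      proof
        assume "fi e \<in> f"
        then have "{st e, fi e} \<subseteq> f" using True by simp
        then show False using f(2) vs(5) by metis
      qed
      then have "x = \<alpha> *\<^sub>R pos (st e)" using lm(3) zf by simp
      then have "x = pos (st e)" using nx lm(1) unit[OF vs(1)] by simp
      then show ?thesis using True mem by blast
    next
      case False
      then have x1: "x = \<beta> *\<^sub>R pos (fi e)" using lm(3) zs by simp
      then have "\<beta> = 1" using nx lm(2) unit[OF vs(2)] by simp
      then have "fi e \<in> f" using zf by fastforce
      then show ?thesis using x1 \<open>\<beta> = 1\<close> mem by auto
    qed
  qed
  have "drawing_on (sphere (0::'b) 1) G pos curve"
    unfolding drawing_on_def
  proof (intro conjI ballI impI)
    show "inj_on pos (verts G)" by (rule inj)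
    show "pos ` verts G \<subseteq> sphere 0 1" using unit by auto
  next
    fix e assume e: "e \<in> edges G"
    show "arc (curve e)" "path_image (curve e) \<subseteq> sphere 0 1" using oa[OF e] by auto
    show "{pathstart (curve e), pathfinish (curve e)} = pos ` e" using oa(3,4)[OF e] ends[OF e] by simp
    show "path_image (curve e) \<inter> pos ` verts G = pos ` e"
    proof
      show "pos ` e \<subseteq> path_image (curve e) \<inter> pos ` verts G" using sub[OF e] eV[OF e] by blast
      show "path_image (curve e) \<inter> pos ` verts G \<subseteq> pos ` e"
      proof
        fix x assume x: "x \<in> path_image (curve e) \<inter> pos ` verts G"
        then obtain v where v: "v \<in> verts G" "x = pos v" by blast
        show "x \<in> pos ` e"
        proof (rule ccontr)
          assume "x \<notin> pos ` e"
          then have "v \<notin> e" using v by blast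
          then show False using off[OF e _ v(1), of x] x sq[OF v(1)] v(2) by simp
        qed
      qed
    qed
  next
    fix e f assume ef: "e \<in> edges G" "f \<in> edges G" "e \<noteq> f"
    show "path_image (curve e) \<inter> path_image (curve f) = pos ` (e \<inter> f)"
    proof
      show "pos ` (e \<inter> f) \<subseteq> path_image (curve e) \<inter> path_image (curve f)" using sub[OF ef(1)] sub[OF ef(2)] by blast
      show "path_image (curve e) \<inter> path_image (curve f) \<subseteq> pos ` (e \<inter> f)"
      proof
        fix x assume x: "x \<in> path_image (curve e) \<inter> path_image (curve f)"
        have "\<not> e \<subseteq> f"
        proof
          assume "e \<subseteq> f"
          moreover have "e = {st e, fi e}" "st e \<noteq> fi e" "f = {st f, fi f}" using sf[OF ef(1)] sf[OF ef(2)] by auto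
          ultimately have "e = f" by (metis (no_types, lifting) doubleton_eq_iff empty_subsetI insertE insert_subset singletonD)
          then show False using ef(3) by simp
        qed
        moreover have "x \<bullet> pos v \<le> 0" if "v \<in> e - f" for v
          using off[OF ef(2), of x v] x that eV[OF ef(1)] by blast
        ultimately show "x \<in> pos ` (e \<inter> f)" using common[OF ef(1), of x f] x ef(3) by blast
      qed
    qed
  qed
  then show ?thesis unfolding drawable_on_def by blast
qed

text \<open>The six pairs of elements of \<open>{0, 1, 2, 3}\<close> label the vertices of the octahedron in such a way that disjoint pairs are
antipodal.\<close>

definition octahedron_vertex :: "nat set \<Rightarrow> complex \<times> real" where
  "octahedron_vertex e =
    (if e = {0, 1} then (1, 0) else if e = {2, 3} then (-1, 0) else
     if e = {0, 2} then (\<i>, 0) else if e = {1, 3} then (-\<i>, 0) else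
     if e = {0, 3} then (0, 1) else (0, -1))"

lemma octahedron_vertex_values:
  "octahedron_vertex {0, 1} = (1, 0)" "octahedron_vertex {2, 3} = (-1, 0)"
  "octahedron_vertex {0, 2} = (\<i>, 0)" "octahedron_vertex {1, 3} = (-\<i>, 0)"
  "octahedron_vertex {0, 3} = (0, 1)" "octahedron_vertex {1, 2} = (0, -1)"
  unfolding octahedron_vertex_def by (simp_all add: doubleton_eq_iff)

lemma pairs_of_four:
  assumes "e \<subseteq> {..<4::nat}" "card e = 2"
  shows "e \<in> {{0, 1}, {2, 3}, {0, 2}, {1, 3}, {0, 3}, {1, 2}}"
proof -
  obtain a b where ab: "e = {a, b}" "a \<noteq> b" using assms(2) by (auto simp: card_2_iff)
  then have "a \<in> {0, 1, 2, 3}" "b \<in> {0, 1, 2, 3}" using assms(1) by auto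
  then show ?thesis using ab(2) unfolding ab(1) by (elim insertE emptyE) (simp_all add: doubleton_eq_iff)
qed

lemma line_graph_small_complete_planar:
  assumes N: "finite N" "card N \<le> 4" and G: "edges G = {e. e \<subseteq> N \<and> card e = 2}"
  shows "drawable_on (sphere_with_handles 0) (line_graph G)"
proof -
  let ?L = "line_graph G"
  have "card N \<le> card {..<4::nat}" using N(2) by simp
  then obtain \<iota> where \<iota>: "\<iota> ` N \<subseteq> {..<4::nat}" "inj_on \<iota> N"
    using card_le_inj[of N "{..<4::nat}"] N(1) by blast
  define pos where "pos = (\<lambda>e. octahedron_vertex (\<iota> ` e))"
  let ?Q = "{{0, 1}, {2, 3}, {0, 2}, {1, 3}, {0, 3}, {1, 2}} :: nat set set"
  have V: "verts ?L = {e. e \<subseteq> N \<and> card e = 2}" unfolding line_graph_def using G by simp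
  have Q: "\<iota> ` e \<in> ?Q" if "e \<in> verts ?L" for e
  proof (rule pairs_of_four)
    have e: "e \<subseteq> N" "card e = 2" using that unfolding V by auto
    show "\<iota> ` e \<subseteq> {..<4}" using \<iota>(1) e(1) by blast
    show "card (\<iota> ` e) = 2" using card_image[OF inj_on_subset[OF \<iota>(2) e(1)]] e(2) by simp
  qed
  have inj: "\<iota> ` e = \<iota> ` f \<longleftrightarrow> e = f" if "e \<in> verts ?L" "f \<in> verts ?L" for e f
    using inj_on_image_eq_iff[OF \<iota>(2)] that unfolding V by blast
  have disj: "\<iota> ` e \<inter> \<iota> ` f = {} \<longleftrightarrow> e \<inter> f = {}" if "e \<in> verts ?L" "f \<in> verts ?L" for e f
    using inj_on_image_Int[OF \<iota>(2), of e f] that unfolding V by (metis (no_types, lifting) image_is_empty mem_Collect_eq)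
  have oct: "norm (octahedron_vertex a) = 1" if "a \<in> ?Q" for a
    using that by (elim insertE emptyE) (simp_all add: octahedron_vertex_values norm_Pair del: One_nat_def)
  have oct2: "octahedron_vertex a \<bullet> octahedron_vertex b \<le> 0 \<and> (a \<inter> b \<noteq> {} \<longrightarrow> octahedron_vertex a \<bullet> octahedron_vertex b = 0)"
    if "a \<in> ?Q" "b \<in> ?Q" "a \<noteq> b" for a b
    using that by (elim insertE emptyE) (simp_all add: octahedron_vertex_values del: One_nat_def)
  have "drawable_on (sphere (0 :: complex \<times> real) 1) ?L"
  proof (rule octahedral_drawing[of pos])
    show "norm (pos v) = 1" if "v \<in> verts ?L" for v using oct[OF Q[OF that]] unfolding pos_def .
    show np: "pos v \<bullet> pos w \<le> 0" if "v \<in> verts ?L" "w \<in> verts ?L" "v \<noteq> w" for v w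
      using oct2[OF Q[OF that(1)] Q[OF that(2)]] inj[OF that(1,2)] that(3) unfolding pos_def by blast
    show "inj_on pos (verts ?L)"
    proof (rule inj_onI, rule ccontr)
      fix v w assume vw: "v \<in> verts ?L" "w \<in> verts ?L" "pos v = pos w" "v \<noteq> w"
      then have "pos v \<bullet> pos v \<le> 0" using np[OF vw(1,2,4)] by simp
      then show False using oct[OF Q[OF vw(1)]] unfolding pos_def by (simp add: dot_square_norm)
    qed
    show "\<exists>v w. e = {v, w} \<and> v \<noteq> w \<and> v \<in> verts ?L \<and> w \<in> verts ?L \<and> pos v \<bullet> pos w = 0" if eL: "e \<in> edges ?L" for e
    proof -
      obtain v w where vw: "e = {v, w}" "v \<in> edges G" "w \<in> edges G" "v \<noteq> w" "v \<inter> w \<noteq> {}"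
        using eL unfolding line_graph_def by auto
      then have m: "v \<in> verts ?L" "w \<in> verts ?L" unfolding line_graph_def by auto
      have "pos v \<bullet> pos w = 0"
        using oct2[OF Q[OF m(1)] Q[OF m(2)]] inj[OF m] disj[OF m] vw(4,5) unfolding pos_def by blast
      then show ?thesis using vw m by blast
    qed
  qed
  then show ?thesis unfolding sphere_with_handles_0 .
qed

text \<open>A finite infimum of a set of extended naturals is attained.\<close>

lemma genus_eq_imp_drawable:
  assumes "genus G = enat k"
  shows "drawable_on (sphere_with_handles k) G"
proof -
  let ?X = "enat ` {k. drawable_on (sphere_with_handles k) G}"
  have "?X \<noteq> {}"
  proof
    assume "?X = {}"
    then have "genus G = \<infinity>" unfolding genus_def Inf_enat_def by (rule if_P)
    then show False using assms by simp
  qed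
  then obtain x where "x \<in> ?X" by blast
  then have "(LEAST x. x \<in> ?X) \<in> ?X" by (rule LeastI)
  then have "Inf ?X \<in> ?X" unfolding Inf_enat_def using \<open>?X \<noteq> {}\<close> by (simp only: if_False)
  then show ?thesis using assms unfolding genus_def by auto
qed

theorem theorem4p1:
  fixes A :: "('a, 'b) ring_scheme"
  assumes "cring A"
    and "\<one>\<^bsub>A\<^esub> \<noteq> \<zero>\<^bsub>A\<^esub>"
    and "finite (carrier A)"
    and "local_ring A"
  shows "genus (line_graph (essential_graph A)) \<noteq> 1 \<and>
         genus (line_graph (essential_graph A)) \<noteq> 2"
proof -
  interpret finite_local_ring A
    using assms unfolding finite_local_ring_def finite_local_ring_axioms_def by blast
  let ?N = "nonzero_zero_divisors A" and ?L = "line_graph (essential_graph A)"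
  have finN: "finite ?N"
    using assms(3) by (rule finite_subset[rotated]) (auto simp: nonzero_zero_divisors_def)
  note G = essential_graph_complete
  show ?thesis
  proof (cases "card ?N \<le> 4")
    case True
    then have "drawable_on (sphere_with_handles 0) ?L"
      by (rule line_graph_small_complete_planar[OF finN _ G])
    then have "genus ?L \<le> enat 0" unfolding genus_def by (intro Inf_lower) blast
    then show ?thesis by (auto simp: enat_0)
  next
    case False
    then have "6 \<le> card ?N" using card_zero_divisors_not_5 by linarith
    then have "\<not> drawable_on (sphere_with_handles k) ?L" if "k \<in> {1, 2}" for k
      by (rule line_graph_complete_not_drawable[OF finN _ G that])
    then have "genus ?L \<noteq> enat 1" "genus ?L \<noteq> enat 2" using genus_eq_imp_drawable by blast+
    then show ?thesis by (simp add: one_enat_def numeral_eq_enat)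
  qed
qed

end
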